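(* Suppose $x\neq 0$. If $x\notin\mathbb{Z}$, then the algebra $\mathbb{A}_n(x)$ is semisimple.
   Context: Let $K$ be a field, $x$ an element transcendental or algebraic over $K$, and $F=K(x)$, assumed of characteristic zero; "semisimple" means isomorphic to a finite direct product of full matrix algebras over $F$, and $x\notin\mathbb{Z}$ means $x$ is not in the image of $\mathbb{Z}$ in $F$. Let $\mathscr{A}_n$ be the set of graphs on $\{1,\dots,n\}\cup\{1',\dots,n'\}$ (top row $1,\dots,n$, bottom row $1',\dots,n'$) in which every vertex has degree $0$ or $1$ (degree-$0$ vertices are said to carry loops). For diagrams $\mathfrak a,\mathfrak b$, stack $\mathfrak a$ above $\mathfrak b$ identifying bottom vertex $i'$ of $\mathfrak a$ with top vertex $i$ of $\mathfrak b$; let $\ell(\mathfrak a,\mathfrak b)$ be the number of connected components lying entirely in the middle row and $G'(\mathfrak a,\mathfrak b)$ the diagram on the top row of $\mathfrak a$ and bottom row of $\mathfrak b$ joining two vertices iff they are connected by a path; set $\mathfrak a\mathfrak b=x^{\ell(\mathfrak a,\mathfrak b)}G'(\mathfrak a,\mathfrak b)$. $\mathbb{A}_n(x)$ is the $F$-algebra with basis $\mathscr{A}_n$ and this (bilinearly extended) product. *)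

theory Defs
  imports Main
begin

text \<open>Vertices of an n-diagram: (False,i) is top vertex i, (True,i) is bottom vertex i', i < n.\<close>

type_synonym vert = "bool \<times> nat"
type_synonym diagram = "vert set set"

definition verts :: "nat \<Rightarrow> vert set" where
  "verts n = UNIV \<times> {..<n}"

text \<open>A diagram: set of edges (2-element vertex sets), pairwise disjoint, so every
  vertex has degree 0 or 1.\<close>
definition is_diagram :: "nat \<Rightarrow> diagram \<Rightarrow> bool" where
  "is_diagram n D \<longleftrightarrow>
     (\<forall>e\<in>D. \<exists>u v. e = {u, v} \<and> u \<in> verts n \<and> v \<in> verts n \<and> u \<noteq> v) \<and>
     (\<forall>e\<in>D. \<forall>e'\<in>D. e \<noteq> e' \<longrightarrow> e \<inter> e' = {})"

definition diagrams :: "nat \<Rightarrow> diagram set" where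
  "diagrams n = {D. is_diagram n D}"

text \<open>Stacking: the three rows are row 0 (top of a), row 1 (middle: bottom of a = top of b),
  row 2 (bottom of b).\<close>

definition emb_top :: "vert \<Rightarrow> nat \<times> nat" where
  "emb_top v = (if fst v then (1, snd v) else (0, snd v))"

definition emb_bot :: "vert \<Rightarrow> nat \<times> nat" where
  "emb_bot v = (if fst v then (2, snd v) else (1, snd v))"

definition stack_edges :: "diagram \<Rightarrow> diagram \<Rightarrow> (nat \<times> nat) set set" where
  "stack_edges a b = (\<lambda>e. emb_top ` e) ` a \<union> (\<lambda>e. emb_bot ` e) ` b"

definition stack_verts :: "nat \<Rightarrow> (nat \<times> nat) set" where
  "stack_verts n = {0, 1, 2} \<times> {..<n}"

definition stack_conn :: "diagram \<Rightarrow> diagram \<Rightarrow> ((nat \<times> nat) \<times> (nat \<times> nat)) set" where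
  "stack_conn a b = {(u, v). {u, v} \<in> stack_edges a b}\<^sup>*"

definition stack_components :: "nat \<Rightarrow> diagram \<Rightarrow> diagram \<Rightarrow> (nat \<times> nat) set set" where
  "stack_components n a b = stack_verts n // (stack_conn a b \<inter> (stack_verts n \<times> stack_verts n))"

definition ell :: "nat \<Rightarrow> diagram \<Rightarrow> diagram \<Rightarrow> nat" where
  "ell n a b = card {C \<in> stack_components n a b. C \<subseteq> {1} \<times> {..<n}}"

definition lift_outer :: "vert \<Rightarrow> nat \<times> nat" where
  "lift_outer v = (if fst v then (2, snd v) else (0, snd v))"

definition Gprime :: "nat \<Rightarrow> diagram \<Rightarrow> diagram \<Rightarrow> diagram" where
  "Gprime n a b = {{p, q} | p q. p \<in> verts n \<and> q \<in> verts n \<and> p \<noteq> q \<and>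
                       (lift_outer p, lift_outer q) \<in> stack_conn a b}"

text \<open>The algebra A_n(x): elements are coefficient functions on diagrams, supported on
  the (finite) set of n-diagrams.\<close>

definition An_carrier :: "nat \<Rightarrow> (diagram \<Rightarrow> 'a::field) set" where
  "An_carrier n = {f. \<forall>D. D \<notin> diagrams n \<longrightarrow> f D = 0}"

definition An_mult :: "nat \<Rightarrow> 'a::field \<Rightarrow> (diagram \<Rightarrow> 'a) \<Rightarrow> (diagram \<Rightarrow> 'a) \<Rightarrow> (diagram \<Rightarrow> 'a)" where
  "An_mult n x f g = (\<lambda>c. \<Sum>a\<in>diagrams n. \<Sum>b\<in>diagrams n.
       (if Gprime n a b = c then f a * g b * x ^ ell n a b else 0))"

text \<open>Finite direct products of full matrix algebras: block sizes ds; element M k i j is the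
  (i,j) entry of the k-th block.\<close>

definition MP_carrier :: "nat list \<Rightarrow> (nat \<Rightarrow> nat \<Rightarrow> nat \<Rightarrow> 'a::field) set" where
  "MP_carrier ds = {M. \<forall>k i j. \<not> (k < length ds \<and> i < ds ! k \<and> j < ds ! k) \<longrightarrow> M k i j = 0}"

definition MP_mult :: "nat list \<Rightarrow> (nat \<Rightarrow> nat \<Rightarrow> nat \<Rightarrow> 'a::field) \<Rightarrow> (nat \<Rightarrow> nat \<Rightarrow> nat \<Rightarrow> 'a)
     \<Rightarrow> (nat \<Rightarrow> nat \<Rightarrow> nat \<Rightarrow> 'a)" where
  "MP_mult ds M N = (\<lambda>k i j. if k < length ds \<and> i < ds ! k \<and> j < ds ! k
       then (\<Sum>l<ds ! k. M k i l * N k l j) else 0)"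

definition An_semisimple :: "nat \<Rightarrow> 'a::field \<Rightarrow> bool" where
  "An_semisimple n x \<longleftrightarrow>
     (\<exists>(ds :: nat list) (\<phi> :: (diagram \<Rightarrow> 'a) \<Rightarrow> (nat \<Rightarrow> nat \<Rightarrow> nat \<Rightarrow> 'a)).
        (\<forall>d \<in> set ds. d > 0) \<and>
        bij_betw \<phi> (An_carrier n) (MP_carrier ds) \<and>
        (\<forall>f\<in>An_carrier n. \<forall>g\<in>An_carrier n. \<phi> (\<lambda>D. f D + g D) = (\<lambda>k i j. \<phi> f k i j + \<phi> g k i j)) \<and>
        (\<forall>c. \<forall>f\<in>An_carrier n. \<phi> (\<lambda>D. c * f D) = (\<lambda>k i j. c * \<phi> f k i j)) \<and>
        (\<forall>f\<in>An_carrier n. \<forall>g\<in>An_carrier n.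
            \<phi> (An_mult n x f g) = MP_mult ds (\<phi> f) (\<phi> g)))"

end

theory Submission
  imports Defs Complex_Main "HOL-Library.Function_Algebras" "HOL-Combinatorics.Permutations"
begin

text \<open>
  Induction on \<open>n\<close>. The diagrams with fewer than \<open>n\<close> through strands span an ideal \<open>J\<close> of \<open>A\<^sub>n\<close>, the
  permutation diagrams span a copy of the group algebra of \<open>S\<^sub>n\<close>, and \<open>A\<^sub>n\<close> is the direct sum of the
  two. If \<open>p\<close> is the idempotent proportional to the identity of \<open>A\<^sub>n\<^sub>-\<^sub>1\<close>, then \<open>p A\<^sub>n p\<close> is a copy of
  \<open>A\<^sub>n\<^sub>-\<^sub>1\<close> and \<open>J\<close> is generated by \<open>p\<close>, so primitive idempotents of \<open>A\<^sub>n\<^sub>-\<^sub>1\<close> generate \<open>J\<close>. As soon as no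
  nonzero element of \<open>J\<close> is annihilated by \<open>J\<close> on one side, \<open>J\<close> is a product of matrix algebras and
  has a unit, and a complement of \<open>J\<close> is a copy of the group algebra of \<open>S\<^sub>n\<close>.

  For the annihilator, look at the coefficients \<open>c\<close> of such an element and make the top vertices
  count as bottom vertices one at a time: it suffices to treat the diagrams in which all top vertices
  are joined to the bottom except for one loop or one cap. The loop case is immediate from \<open>x \<noteq> 0\<close>. In the
  cap case the hooks give \<open>(X\<^sub>n\<^sub>-\<^sub>1 + X\<^sub>n) c = (2 - x) c\<close> for the Jucys-Murphy elements, whose eigenvalues
  are integers.

  The group algebra of \<open>S\<^sub>n\<close> splits over any field of characteristic zero because the joint spectral
  idempotents of the Jucys-Murphy elements are primitive, have rational coefficients and are
  self-adjoint for a form that is positive definite over the rationals.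
\<close>

section \<open>Split algebras\<close>

text \<open>The target consists of matrix algebras over the base field itself, so the absence of a
  radical is not enough: every block has to split. Blocks are therefore carried by idempotents
  \<open>e\<close> whose corner is the line through \<open>e\<close>, and the induction transports
  such idempotents rather than semisimplicity. The idempotent proportional to the smaller identity
  needs the factor \<open>inverse x\<close> because a diagram of size \<open>n - 1\<close>, read in
  size \<open>n\<close>, has an isolated vertex in each row; in a product the middle one is an inner
  component of its own and costs a factor \<open>x\<close>. The constant \<open>2 - x\<close> has
  three sources. In the coefficient of a hook times \<open>c\<close> at a diagram with that cap, the
  diagram itself counts with \<open>x\<close>. The diagram with the cap deleted contributes
  \<open>-1\<close>, by the equation for a dot. All other terms exchange one end of the cap with
  another counted vertex, so they sum to \<open>1 - x\<close> times the coefficient. The two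
  Jucys-Murphy elements contain one transposition more, the exchange of the two ends, which fixes
  the diagram and adds 1.\<close>

lemma bchoice3:
  assumes "\<forall>e\<in>E. \<exists>d u v. P e d u v"
  shows "\<exists>d u v. \<forall>e\<in>E. P e (d e) (u e) (v e)"
proof -
  obtain t where "\<forall>e\<in>E. P e (fst (t e)) (fst (snd (t e))) (snd (snd (t e)))"
    using bchoice[of E "\<lambda>e t. P e (fst t) (fst (snd t)) (snd (snd t))"] assms by auto
  then show ?thesis by (intro exI[of _ "\<lambda>e. fst (t e)"] exI[of _ "\<lambda>e. fst (snd (t e))"]
      exI[of _ "\<lambda>e. snd (snd (t e))"])
qed

text \<open>
  The multiplication is total on the type: the diagram algebra ignores the coefficients outside the
  set of \<open>n\<close>-diagrams, so it is associative everywhere and only its unit is tied to the carrier.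
\<close>

locale assoc_algebra = vector_space scale
  for scale :: "'a::field \<Rightarrow> 'v::ab_group_add \<Rightarrow> 'v" (infixr "*s" 75) +
  fixes mul :: "'v \<Rightarrow> 'v \<Rightarrow> 'v" (infixl "\<odot>" 70)
  assumes mul_assoc: "(a \<odot> b) \<odot> c = a \<odot> (b \<odot> c)"
    and add_mul: "(a + b) \<odot> c = a \<odot> c + b \<odot> c"
    and mul_add: "a \<odot> (b + c) = a \<odot> b + a \<odot> c"
    and scale_mul [simp]: "(r *s a) \<odot> b = r *s (a \<odot> b)"
    and mul_scale [simp]: "a \<odot> (r *s b) = r *s (a \<odot> b)"
begin

lemma zero_mul [simp]: "0 \<odot> a = 0"
  by (metis add_mul add_cancel_right_right)

lemma mul_zero [simp]: "a \<odot> 0 = 0"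
  by (metis mul_add add_cancel_right_right)

lemma diff_mul: "(a - b) \<odot> c = a \<odot> c - b \<odot> c"
  by (metis add_mul add_diff_cancel diff_add_cancel)

lemma mul_diff: "c \<odot> (a - b) = c \<odot> a - c \<odot> b"
  by (metis mul_add add_diff_cancel diff_add_cancel)

lemma sum_mul: "sum f I \<odot> c = (\<Sum>i\<in>I. f i \<odot> c)"
  by (induction I rule: infinite_finite_induct) (auto simp: add_mul)

lemma mul_sum: "c \<odot> sum f I = (\<Sum>i\<in>I. c \<odot> f i)"
  by (induction I rule: infinite_finite_induct) (auto simp: mul_add)

lemma mul_absorb: "a \<odot> b = c \<Longrightarrow> a \<odot> (b \<odot> y) = c \<odot> y"
  by (simp flip: mul_assoc)

lemmas mul_distribs = add_mul mul_add diff_mul mul_diff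

section \<open>Primitive idempotents and the pairing of their one-sided ideals\<close>

definition unital_subalgebra :: "'v set \<Rightarrow> 'v \<Rightarrow> bool" where
  "unital_subalgebra C one \<longleftrightarrow> subspace C \<and> (\<forall>a\<in>C. \<forall>b\<in>C. a \<odot> b \<in> C) \<and> one \<in> C \<and>
     (\<forall>a\<in>C. one \<odot> a = a \<and> a \<odot> one = a)"

text \<open>Each corner consists of scalar multiples of \<open>e\<close>, which makes the block of
  \<open>e\<close> split over the base field. The last condition forbids two members in the same
  block, so a family keeps one idempotent per block.\<close>

definition primitive_family :: "'v set \<Rightarrow> 'v set \<Rightarrow> bool" where
  "primitive_family C E \<longleftrightarrow> finite E \<and> E \<subseteq> C \<and> (\<forall>e\<in>E. e \<noteq> 0 \<and> e \<odot> e = e) \<and>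
     (\<forall>e\<in>E. \<forall>a\<in>C. \<exists>r. e \<odot> (a \<odot> e) = r *s e) \<and>
     (\<forall>e\<in>E. \<forall>f\<in>E. e \<noteq> f \<longrightarrow> (\<forall>a\<in>C. e \<odot> (a \<odot> f) = 0))"

text \<open>Multiplication pairs the right ideal of \<open>e\<close> with its left ideal, with
  values in the line through \<open>e\<close>. The two halves say that this pairing has no kernel on
  either side.\<close>

definition nondegenerate :: "'v set \<Rightarrow> 'v set \<Rightarrow> bool" where
  "nondegenerate C E \<longleftrightarrow> (\<forall>e\<in>E. \<forall>v\<in>C.
     (v \<odot> e = v \<and> (\<forall>a\<in>C. e \<odot> (a \<odot> v) = 0) \<longrightarrow> v = 0) \<and>
     (e \<odot> v = v \<and> (\<forall>a\<in>C. v \<odot> (a \<odot> e) = 0) \<longrightarrow> v = 0))"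

definition generated_ideal :: "'v set \<Rightarrow> 'v set \<Rightarrow> 'v set" where
  "generated_ideal C E = span {a \<odot> (e \<odot> b) | a e b. a \<in> C \<and> e \<in> E \<and> b \<in> C}"

definition split_algebra :: "'v set \<Rightarrow> 'v \<Rightarrow> 'v set \<Rightarrow> bool" where
  "split_algebra C one E \<longleftrightarrow> unital_subalgebra C one \<and> primitive_family C E \<and>
     nondegenerate C E \<and> one \<in> generated_ideal C E"

lemma unital_subalgebraD:
  assumes "unital_subalgebra C one"
  shows "subspace C" "a \<in> C \<Longrightarrow> b \<in> C \<Longrightarrow> a \<odot> b \<in> C" "one \<in> C"
    "a \<in> C \<Longrightarrow> one \<odot> a = a" "a \<in> C \<Longrightarrow> a \<odot> one = a"
  using assms unfolding unital_subalgebra_def by auto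

lemma primitive_familyD:
  assumes "primitive_family C E"
  shows "finite E" "e \<in> E \<Longrightarrow> e \<in> C" "e \<in> E \<Longrightarrow> e \<noteq> 0" "e \<in> E \<Longrightarrow> e \<odot> e = e"
    "e \<in> E \<Longrightarrow> a \<in> C \<Longrightarrow> \<exists>r. e \<odot> (a \<odot> e) = r *s e"
    "e \<in> E \<Longrightarrow> f \<in> E \<Longrightarrow> e \<noteq> f \<Longrightarrow> a \<in> C \<Longrightarrow> e \<odot> (a \<odot> f) = 0"
  using assms unfolding primitive_family_def by auto

lemma nondegenerateD:
  assumes "nondegenerate C E" "e \<in> E" "v \<in> C"
  shows "v \<odot> e = v \<Longrightarrow> (\<And>a. a \<in> C \<Longrightarrow> e \<odot> (a \<odot> v) = 0) \<Longrightarrow> v = 0"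
    "e \<odot> v = v \<Longrightarrow> (\<And>a. a \<in> C \<Longrightarrow> v \<odot> (a \<odot> e) = 0) \<Longrightarrow> v = 0"
  using assms unfolding nondegenerate_def by blast+

text \<open>The \<open>u i\<close> lie in the left ideal of \<open>e\<close> and the
  \<open>v i\<close> in its right ideal, dual to each other with \<open>e\<close> in the role of 1.
  The products \<open>u i \<odot> v j\<close> are then matrix units.\<close>

definition dual_system :: "'v set \<Rightarrow> 'v \<Rightarrow> nat \<Rightarrow> (nat \<Rightarrow> 'v) \<Rightarrow> (nat \<Rightarrow> 'v) \<Rightarrow> bool" where
  "dual_system C e d u v \<longleftrightarrow>
     (\<forall>i<d. u i \<in> C \<and> v i \<in> C \<and> u i \<odot> e = u i \<and> e \<odot> v i = v i) \<and>
     (\<forall>i<d. \<forall>j<d. v i \<odot> u j = (if i = j then e else 0))"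

lemma dual_systemD:
  assumes "dual_system C e d u v" "i < d"
  shows "u i \<in> C" "v i \<in> C" "u i \<odot> e = u i" "e \<odot> v i = v i"
    "j < d \<Longrightarrow> v i \<odot> u j = (if i = j then e else 0)"
  using assms unfolding dual_system_def by auto

text \<open>Multiplying a linear relation between the \<open>u j\<close> by \<open>v i\<close>
  isolates one coefficient, so they are independent. The bound guarantees that a longest dual system
  exists.\<close>

lemma dual_system_le_card:
  assumes ds: "dual_system C e d u v" and e0: "e \<noteq> 0" and S: "finite S" "C \<subseteq> span S"
  shows "d \<le> card S"
proof -
  have inj: "inj_on u {..<d}"
  proof (rule inj_onI)
    fix i j assume "i \<in> {..<d}" "j \<in> {..<d}" "u i = u j"
    then show "i = j"
      using dual_systemD(5)[OF ds, of i i] dual_systemD(5)[OF ds, of i j] e0 by (auto split: if_splits)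
  qed
  have "independent (u ` {..<d})"
  proof (rule independent_if_scalars_zero)
    fix f x assume s: "(\<Sum>x\<in>u ` {..<d}. f x *s x) = 0" and "x \<in> u ` {..<d}"
    then obtain i where i: "i < d" "x = u i" by auto
    have "0 = v i \<odot> (\<Sum>j<d. f (u j) *s u j)"
      using s by (simp add: sum.reindex[OF inj])
    also have "\<dots> = (\<Sum>j<d. f (u j) *s (v i \<odot> u j))"
      by (simp add: mul_sum)
    also have "\<dots> = (\<Sum>j<d. if i = j then f (u j) *s e else 0)"
      by (rule sum.cong) (use dual_systemD(5)[OF ds \<open>i < d\<close>] in auto)
    also have "\<dots> = f (u i) *s e"
      using i by (simp add: sum.delta)
    finally show "f x = 0" using i e0 by simp
  qed simp
  moreover have "u ` {..<d} \<subseteq> span S"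
    using dual_systemD(1)[OF ds] S by auto
  ultimately have "card (u ` {..<d}) \<le> card S"
    using independent_span_bound S by blast
  then show ?thesis using card_image[OF inj] by simp
qed

lemma dual_system_extend:
  assumes ds: "dual_system C e d u v" and C: "subspace C" and e: "e \<odot> e = e"
    and w: "w \<in> C" "w \<odot> e = w" "\<And>i. i < d \<Longrightarrow> v i \<odot> w = 0"
    and y: "y \<in> C" "e \<odot> y = y" "\<And>i. i < d \<Longrightarrow> y \<odot> u i = 0" "y \<odot> w = e"
  shows "dual_system C e (Suc d) (u(d := w)) (v(d := y))"
  using assms unfolding dual_system_def by (auto simp: less_Suc_eq)

text \<open>A longest dual system spans: if some \<open>w\<close> in the left ideal differed from
  its projection onto the \<open>u i\<close>, the remainder and a partner supplied by nondegeneracy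
  would lengthen the system, as in Gram-Schmidt. The expansion in the right ideal then follows from
  the other half of nondegeneracy.\<close>

lemma exists_dual_bases:
  assumes C: "unital_subalgebra C one" and E: "primitive_family C E" and nd: "nondegenerate C E"
    and e: "e \<in> E" and S: "finite S" "C \<subseteq> span S"
  shows "\<exists>d u v. dual_system C e d u v \<and> 0 < d \<and>
     (\<forall>w\<in>C. w \<odot> e = w \<longrightarrow> (\<Sum>i<d. u i \<odot> (v i \<odot> w)) = w) \<and>
     (\<forall>w\<in>C. e \<odot> w = w \<longrightarrow> (\<Sum>i<d. w \<odot> (u i \<odot> v i)) = w)"
proof -
  note Cd = unital_subalgebraD[OF C] and Ed = primitive_familyD[OF E]
  have ee: "e \<odot> e = e" and e0: "e \<noteq> 0" and eC: "e \<in> C" using Ed e by auto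
  have "\<exists>d. (\<exists>u v. dual_system C e d u v) \<and> (\<forall>d'. (\<exists>u v. dual_system C e d' u v) \<longrightarrow> d' \<le> d)"
  proof (rule ex_has_greatest_nat[where f = "\<lambda>d. d" and b = "Suc (card S)", of _ 0])
    show "\<exists>u v. dual_system C e 0 u v" by (simp add: dual_system_def)
    show "\<forall>d. (\<exists>u v. dual_system C e d u v) \<longrightarrow> d < Suc (card S)"
      using dual_system_le_card[OF _ e0 S] by (auto simp: less_Suc_eq_le)
  qed
  then obtain d u v where ds: "dual_system C e d u v"
    and max: "\<And>d' u' v'. dual_system C e d' u' v' \<Longrightarrow> d' \<le> d" by blast
  note D = dual_systemD[OF ds]
  have left: "(\<Sum>i<d. u i \<odot> (v i \<odot> w)) = w" if w: "w \<in> C" "w \<odot> e = w" for w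
  proof (rule ccontr)
    assume ne: "(\<Sum>i<d. u i \<odot> (v i \<odot> w)) \<noteq> w"
    define w' where "w' = w - (\<Sum>i<d. u i \<odot> (v i \<odot> w))"
    have w'C: "w' \<in> C" unfolding w'_def
      using w D Cd by (intro subspace_diff[OF Cd(1)] subspace_sum[OF Cd(1)]) auto
    have w'e: "w' \<odot> e = w'" unfolding w'_def
      by (simp add: diff_mul sum_mul mul_assoc w)
    have vw': "v i \<odot> w' = 0" if "i < d" for i
    proof -
      have "v i \<odot> (\<Sum>j<d. u j \<odot> (v j \<odot> w)) = (\<Sum>j<d. (v i \<odot> u j) \<odot> (v j \<odot> w))"
        by (simp add: mul_sum mul_assoc)
      also have "\<dots> = (\<Sum>j<d. if i = j then v j \<odot> w else 0)"
        by (rule sum.cong) (use D(4,5) that in \<open>auto simp flip: mul_assoc\<close>)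
      also have "\<dots> = v i \<odot> w" using that by (simp add: sum.delta)
      finally show ?thesis by (simp add: w'_def mul_diff)
    qed
    have "w' \<noteq> 0" using ne by (simp add: w'_def)
    then obtain a where a: "a \<in> C" "e \<odot> (a \<odot> w') \<noteq> 0"
      using nondegenerateD(1)[OF nd e w'C w'e] by blast
    have aw: "a \<odot> w' \<in> C" using a w'C Cd by auto
    obtain r where r: "e \<odot> ((a \<odot> w') \<odot> e) = r *s e" using Ed(5)[OF e aw] by auto
    then have r': "e \<odot> (a \<odot> w') = r *s e" by (simp add: mul_assoc w'e)
    have r0: "r \<noteq> 0" using a r' by auto
    \<comment> \<open>Since \<open>e \<odot> (a \<odot> w')\<close> is \<open>r\<close> times
      \<open>e\<close>, dividing by \<open>r\<close> makes \<open>y\<close> dual to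
      \<open>w'\<close>.\<close>
    define y where "y = inverse r *s (e \<odot> a)"
    have y: "y \<in> C" "e \<odot> y = y" "y \<odot> w' = e"
      using a Cd eC r' r0 by (auto simp: y_def subspace_scale mul_assoc) (simp add: ee flip: mul_assoc)
    \<comment> \<open>Removing the components along the \<open>v i\<close> makes \<open>y'\<close>
      vanish on every \<open>u j\<close>; the product with \<open>w'\<close> stays \<open>e\<close>
      because all \<open>v i \<odot> w'\<close> are zero.\<close>
    define y' where "y' = y - (\<Sum>i<d. y \<odot> (u i \<odot> v i))"
    have y'C: "y' \<in> C" unfolding y'_def
      using y D Cd by (intro subspace_diff[OF Cd(1)] subspace_sum[OF Cd(1)]) auto
    have ey': "e \<odot> y' = y'" unfolding y'_def
      by (simp add: mul_diff mul_sum y flip: mul_assoc)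
    have y'u: "y' \<odot> u j = 0" if "j < d" for j
    proof -
      have "(\<Sum>i<d. y \<odot> (u i \<odot> v i)) \<odot> u j = (\<Sum>i<d. y \<odot> (u i \<odot> (v i \<odot> u j)))"
        by (simp add: sum_mul mul_assoc)
      also have "\<dots> = (\<Sum>i<d. if i = j then y \<odot> u i else 0)"
        by (rule sum.cong) (use D(3,5) that in auto)
      also have "\<dots> = y \<odot> u j" using that by (simp add: sum.delta')
      finally show ?thesis by (simp add: y'_def diff_mul)
    qed
    have "y' \<odot> w' = e" using vw' y by (simp add: y'_def diff_mul sum_mul mul_assoc)
    then have "dual_system C e (Suc d) (u(d := w')) (v(d := y'))"
      using dual_system_extend[OF ds Cd(1) ee w'C w'e vw' y'C ey' y'u] by auto
    then show False using max by fastforce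
  qed
  have right: "(\<Sum>i<d. w \<odot> (u i \<odot> v i)) = w" if w: "w \<in> C" "e \<odot> w = w" for w
  proof -
    define w' where "w' = w - (\<Sum>i<d. w \<odot> (u i \<odot> v i))"
    have w'C: "w' \<in> C" unfolding w'_def
      using w D Cd by (intro subspace_diff[OF Cd(1)] subspace_sum[OF Cd(1)]) auto
    have ew': "e \<odot> w' = w'" unfolding w'_def
      by (simp add: mul_diff mul_sum w flip: mul_assoc)
    \<comment> \<open>The remainder annihilates the left ideal, because the sum of the
      \<open>u i \<odot> v i\<close> acts there as the identity by \<open>left\<close>.\<close>
    have "w' \<odot> (a \<odot> e) = 0" if "a \<in> C" for a
    proof -
      have "w \<odot> (\<Sum>i<d. u i \<odot> (v i \<odot> (a \<odot> e))) = w \<odot> (a \<odot> e)"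
        using left[of "a \<odot> e"] that eC Cd ee by (simp add: mul_assoc)
      then show ?thesis by (simp add: w'_def diff_mul sum_mul mul_sum mul_assoc)
    qed
    then have "w' = 0" using nondegenerateD(2)[OF nd e w'C ew'] by blast
    then show ?thesis by (simp add: w'_def)
  qed
  have "0 < d" using left[OF eC ee] e0 by (cases d) auto
  then show ?thesis using ds left right by blast
qed


text \<open>The block of \<open>e\<close> is the matrix of left multiplication by \<open>a\<close>
  on the left ideal of \<open>e\<close> in the basis \<open>u e\<close>: its entry is the scalar
  \<open>r\<close> with \<open>v e i \<odot> (a \<odot> u e j) = r *s e\<close>. An element with
  zero matrices annihilates all these left ideals, hence the ideal they generate, hence
  \<open>one\<close>. The matrix units \<open>u e i \<odot> v e j\<close> give surjectivity.\<close>

theorem split_algebra_iso_matrices: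
  assumes sp: "split_algebra C one E" and S: "finite S" "C \<subseteq> span S"
  shows "\<exists>(ds :: nat list) (\<phi> :: 'v \<Rightarrow> nat \<Rightarrow> nat \<Rightarrow> nat \<Rightarrow> 'a).
     (\<forall>d\<in>set ds. d > 0) \<and> bij_betw \<phi> C (MP_carrier ds) \<and>
     (\<forall>f\<in>C. \<forall>g\<in>C. \<phi> (f + g) = (\<lambda>k i j. \<phi> f k i j + \<phi> g k i j)) \<and>
     (\<forall>c. \<forall>f\<in>C. \<phi> (c *s f) = (\<lambda>k i j. c * \<phi> f k i j)) \<and>
     (\<forall>f\<in>C. \<forall>g\<in>C. \<phi> (f \<odot> g) = MP_mult ds (\<phi> f) (\<phi> g))"
proof -
  have C: "unital_subalgebra C one" and E: "primitive_family C E" and nd: "nondegenerate C E"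
    and gen: "one \<in> generated_ideal C E" using sp unfolding split_algebra_def by auto
  note Cd = unital_subalgebraD[OF C] and Ed = primitive_familyD[OF E]
  obtain es where es: "set es = E" "distinct es" using finite_distinct_list[OF Ed(1)] by auto
  have "\<forall>e\<in>E. \<exists>d u v. dual_system C e d u v \<and> 0 < d \<and>
     (\<forall>w\<in>C. w \<odot> e = w \<longrightarrow> (\<Sum>i<d. u i \<odot> (v i \<odot> w)) = w) \<and>
     (\<forall>w\<in>C. e \<odot> w = w \<longrightarrow> (\<Sum>i<d. w \<odot> (u i \<odot> v i)) = w)"
    using exists_dual_bases[OF C E nd _ S] by (intro ballI)
  from bchoice3[OF this] obtain d u v where "\<forall>e\<in>E. dual_system C e (d e) (u e) (v e) \<and> 0 < d e \<and>
     (\<forall>w\<in>C. w \<odot> e = w \<longrightarrow> (\<Sum>i<d e. u e i \<odot> (v e i \<odot> w)) = w) \<and>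
     (\<forall>w\<in>C. e \<odot> w = w \<longrightarrow> (\<Sum>i<d e. w \<odot> (u e i \<odot> v e i)) = w)"
    by (elim exE)
  then have duv: "\<And>e. e \<in> E \<Longrightarrow> dual_system C e (d e) (u e) (v e)"
    "\<And>e. e \<in> E \<Longrightarrow> 0 < d e"
    "\<And>e w. e \<in> E \<Longrightarrow> w \<in> C \<Longrightarrow> w \<odot> e = w \<Longrightarrow> (\<Sum>i<d e. u e i \<odot> (v e i \<odot> w)) = w"
    by auto
  note D = dual_systemD[OF duv(1)]
  define ds where "ds = map d es"
  \<comment> \<open>Meaningful on multiples of \<open>e\<close>, where the scalar is unique because
    \<open>e\<close> is nonzero.\<close>
  define cf where "cf e y = (THE r. y = r *s e)" for e y
  have cf: "cf e (r *s e) = r" if "e \<in> E" for e r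
    unfolding cf_def using Ed(3)[OF that] by (auto intro!: the_equality)
  define \<phi> where "\<phi> a k i j = (if k < length es \<and> i < d (es ! k) \<and> j < d (es ! k)
      then cf (es ! k) (v (es ! k) i \<odot> (a \<odot> u (es ! k) j)) else 0)" for a k i j
  have esE: "es ! k \<in> E" if "k < length es" for k using es that by auto
  have \<phi>_eq: "\<phi> a k i j = r" if "v (es ! k) i \<odot> (a \<odot> u (es ! k) j) = r *s (es ! k)"
    "k < length es" "i < d (es ! k)" "j < d (es ! k)" for a k i j r
    unfolding \<phi>_def using that cf[OF esE] by simp
  have \<phi>0: "\<phi> a k i j = 0" if "\<not> (k < length es \<and> i < d (es ! k) \<and> j < d (es ! k))" for a k i j
    unfolding \<phi>_def using that by auto
  have \<phi>: "v (es ! k) i \<odot> (a \<odot> u (es ! k) j) = \<phi> a k i j *s (es ! k)"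
    if "a \<in> C" "k < length es" "i < d (es ! k)" "j < d (es ! k)" for a k i j
  proof -
    let ?e = "es ! k"
    have e: "?e \<in> E" using that esE by auto
    have "v ?e i \<odot> (a \<odot> u ?e j) \<in> C" using Cd(2) D e that by simp
    then obtain r where "?e \<odot> ((v ?e i \<odot> (a \<odot> u ?e j)) \<odot> ?e) = r *s ?e" using Ed(5) e by blast
    then have "v ?e i \<odot> (a \<odot> u ?e j) = r *s ?e"
      by (simp add: mul_assoc D(3)[OF e that(4)] mul_absorb[OF D(4)[OF e that(3)]])
    then show ?thesis using \<phi>_eq that by metis
  qed
  have ds_conv: "k < length ds \<and> i < ds ! k \<and> j < ds ! k \<longleftrightarrow>
      k < length es \<and> i < d (es ! k) \<and> j < d (es ! k)" for k i j
    by (auto simp: ds_def)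
  have add: "\<phi> (f + g) = (\<lambda>k i j. \<phi> f k i j + \<phi> g k i j)" if "f \<in> C" "g \<in> C" for f g
  proof (intro ext)
    fix k i j show "\<phi> (f + g) k i j = \<phi> f k i j + \<phi> g k i j"
    proof (cases "k < length es \<and> i < d (es ! k) \<and> j < d (es ! k)")
      case True
      then show ?thesis using \<phi>[OF that(1)] \<phi>[OF that(2)]
        by (intro \<phi>_eq) (auto simp: mul_distribs scale_left_distrib)
    qed (simp add: \<phi>0)
  qed
  have scl: "\<phi> (c *s f) = (\<lambda>k i j. c * \<phi> f k i j)" if "f \<in> C" for c f
  proof (intro ext)
    fix k i j show "\<phi> (c *s f) k i j = c * \<phi> f k i j"
    proof (cases "k < length es \<and> i < d (es ! k) \<and> j < d (es ! k)")
      case True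
      then show ?thesis using \<phi>[OF that(1)] by (intro \<phi>_eq) auto
    qed (simp add: \<phi>0)
  qed
  have mlt: "\<phi> (f \<odot> g) = MP_mult ds (\<phi> f) (\<phi> g)" if f: "f \<in> C" and g: "g \<in> C" for f g
  proof (intro ext)
    fix k i j show "\<phi> (f \<odot> g) k i j = MP_mult ds (\<phi> f) (\<phi> g) k i j"
    proof (cases "k < length es \<and> i < d (es ! k) \<and> j < d (es ! k)")
      case True
      let ?e = "es ! k"
      have e: "?e \<in> E" using True esE by auto
      \<comment> \<open>Expanding \<open>g \<odot> u ?e j\<close> in the basis inserts the sum over
        the middle index of the matrix product.\<close>
      have "(\<Sum>l<d ?e. u ?e l \<odot> (v ?e l \<odot> (g \<odot> u ?e j))) = g \<odot> u ?e j"
        using D(1,3)[OF e, of j] True g Cd(2) by (intro duv(3)[OF e]) (simp_all add: mul_assoc)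
      from arg_cong[OF this, of "\<lambda>y. v ?e i \<odot> (f \<odot> y)"]
      have "v ?e i \<odot> ((f \<odot> g) \<odot> u ?e j) =
          (\<Sum>l<d ?e. (v ?e i \<odot> (f \<odot> u ?e l)) \<odot> (v ?e l \<odot> (g \<odot> u ?e j)))"
        by (simp add: mul_sum mul_assoc)
      also have "\<dots> = (\<Sum>l<d ?e. (\<phi> f k i l * \<phi> g k l j) *s ?e)"
        using \<phi>[OF f, of k i] \<phi>[OF g, of k _ j] True Ed(4)[OF e] by (intro sum.cong) auto
      finally have "\<phi> (f \<odot> g) k i j = (\<Sum>l<d ?e. \<phi> f k i l * \<phi> g k l j)"
        using True by (intro \<phi>_eq) (auto simp: scale_sum_left)
      then show ?thesis using True by (simp add: MP_mult_def ds_def)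
    next
      case False
      then show ?thesis unfolding MP_mult_def ds_conv by (auto simp: \<phi>0)
    qed
  qed
  have inj0: "a = 0" if a: "a \<in> C" and z: "\<And>k i j. \<phi> a k i j = 0" for a
  proof -
    have au: "a \<odot> u e j = 0" if e: "e \<in> E" and j: "j < d e" for e j
    proof -
      obtain k where k: "k < length es" "e = es ! k" using es e by (metis in_set_conv_nth)
      have "v e i \<odot> (a \<odot> u e j) = 0" if "i < d e" for i
        using \<phi>[OF a, of k i j] z k j that by simp
      moreover have "(\<Sum>i<d e. u e i \<odot> (v e i \<odot> (a \<odot> u e j))) = a \<odot> u e j"
        using D(1,3)[OF e j] a Cd(2) by (intro duv(3)[OF e]) (simp_all add: mul_assoc)
      ultimately show ?thesis by simp
    qed
    have aw: "a \<odot> w = 0" if e: "e \<in> E" and "w \<in> C" "w \<odot> e = w" for e w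
    proof -
      have "a \<odot> w = (\<Sum>i<d e. (a \<odot> u e i) \<odot> (v e i \<odot> w))"
        using arg_cong[OF duv(3)[OF that], of "\<lambda>y. a \<odot> y"] by (simp add: mul_sum mul_assoc)
      then show ?thesis using au[OF e] by simp
    qed
    have "a \<odot> y = 0" if "y \<in> generated_ideal C E" for y
      using that unfolding generated_ideal_def
    proof (induction rule: span_induct_alt)
      case (step c x y)
      then obtain b e b' where x: "x = b \<odot> (e \<odot> b')" "b \<in> C" "e \<in> E" by auto
      have "a \<odot> (b \<odot> e) = 0" using aw[OF x(3), of "b \<odot> e"] x Ed Cd(2) by (simp add: mul_assoc)
      then have "a \<odot> x = 0" using mul_absorb[of a "b \<odot> e" 0 b'] x(1) by (simp add: mul_assoc)
      then show ?case using step by (simp add: mul_add)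
    qed simp
    then show ?thesis using gen a Cd(5) by metis
  qed
  have "inj_on \<phi> C"
  proof (rule inj_onI)
    fix f g assume f: "f \<in> C" and g: "g \<in> C" and eq: "\<phi> f = \<phi> g"
    have g': "(-1) *s g \<in> C" using g Cd(1) by (intro subspace_scale)
    have "f + (-1) *s g = 0"
    proof (rule inj0)
      show "f + (-1) *s g \<in> C" using f g' Cd(1) by (intro subspace_add)
      show "\<phi> (f + (-1) *s g) k i j = 0" for k i j
        using add[OF f g'] scl[OF g, of "-1"] eq by simp
    qed
    then show "f = g" by simp
  qed
  moreover have "\<phi> ` C = MP_carrier ds"
  proof
    show "\<phi> ` C \<subseteq> MP_carrier ds" unfolding MP_carrier_def ds_conv using \<phi>0 by blast
    show "MP_carrier ds \<subseteq> \<phi> ` C"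
    proof
      fix M :: "nat \<Rightarrow> nat \<Rightarrow> nat \<Rightarrow> 'a" assume M: "M \<in> MP_carrier ds"
      define a where "a = (\<Sum>k<length es. \<Sum>i<d (es ! k). \<Sum>j<d (es ! k).
          M k i j *s (u (es ! k) i \<odot> v (es ! k) j))"
      have aC: "a \<in> C" unfolding a_def
        using D(1,2)[OF esE] Cd(2) by (intro subspace_sum[OF Cd(1)] subspace_scale[OF Cd(1)]) auto
      have "\<phi> a k i j = M k i j" for k i j
      proof (cases "k < length es \<and> i < d (es ! k) \<and> j < d (es ! k)")
        case True
        let ?e = "es ! k"
        have e: "?e \<in> E" using True esE by auto
        \<comment> \<open>Matrix units of different blocks multiply to zero, by the orthogonality
          condition of the family.\<close>
        have other: "v ?e i \<odot> (u (es ! l) s \<odot> b) = 0"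
          if "l < length es" "l \<noteq> k" "s < d (es ! l)" for l s b
        proof -
          have ne: "?e \<noteq> es ! l" using that es True nth_eq_iff_index_eq by blast
          have "v ?e i \<odot> u (es ! l) s = ?e \<odot> ((v ?e i \<odot> u (es ! l) s) \<odot> (es ! l))"
            using True that(1)
            by (simp add: mul_assoc D(3)[OF esE that(3)] mul_absorb[OF D(4)[OF e]])
          also have "\<dots> = 0" using that True by (intro Ed(6)[OF e esE ne] Cd(2) D(2)[OF e] D(1)[OF esE]) auto
          finally show ?thesis by (simp add: mul_absorb)
        qed
        have "v ?e i \<odot> (a \<odot> u ?e j) = (\<Sum>l<length es. \<Sum>s<d (es ! l). \<Sum>t<d (es ! l).
           M l s t *s (v ?e i \<odot> (u (es ! l) s \<odot> (v (es ! l) t \<odot> u ?e j))))"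
          by (simp add: a_def sum_mul mul_sum mul_assoc)
        also have "\<dots> = (\<Sum>l<length es. if l = k then (\<Sum>s<d ?e. \<Sum>t<d ?e.
           M k s t *s (v ?e i \<odot> (u ?e s \<odot> (v ?e t \<odot> u ?e j)))) else 0)"
          by (rule sum.cong) (use other in auto)
        also have "\<dots> = (\<Sum>s<d ?e. \<Sum>t<d ?e. M k s t *s ((v ?e i \<odot> u ?e s) \<odot> (v ?e t \<odot> u ?e j)))"
          using True by (simp add: sum.delta mul_assoc)
        also have "\<dots> = (\<Sum>s<d ?e. if s = i then (\<Sum>t<d ?e. if t = j then M k i j *s ?e else 0) else 0)"
          using True D(5)[OF e] Ed(4)[OF e]
          by (intro sum.cong refl) (auto simp: sum.delta if_distrib[where f = "\<lambda>y. a \<odot> y" for a]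
              if_distrib[where f = "\<lambda>y. r *s y" for r] cong: if_cong)
        also have "\<dots> = M k i j *s ?e" using True by (simp add: sum.delta)
        finally show ?thesis using True \<phi>_eq by blast
      next
        case False
        then show ?thesis using M \<phi>0 unfolding MP_carrier_def ds_conv by simp
      qed
      then have "\<phi> a = M" by (intro ext) auto
      then show "M \<in> \<phi> ` C" using aC by blast
    qed
  qed
  ultimately have "bij_betw \<phi> C (MP_carrier ds)" by (simp add: bij_betw_def)
  moreover have "\<forall>d\<in>set ds. d > 0" using duv(2) es by (auto simp: ds_def)
  ultimately show ?thesis using add scl mlt by (intro exI[of _ ds] exI[of _ \<phi>]) blast
qed

section \<open>The ideal generated by a family of idempotents, and its complement\<close>

lemma generated_idealI: "a \<in> C \<Longrightarrow> e \<in> E \<Longrightarrow> b \<in> C \<Longrightarrow> a \<odot> (e \<odot> b) \<in> generated_ideal C E"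
  unfolding generated_ideal_def by (rule span_base) blast

lemma subspace_generated_ideal: "subspace (generated_ideal C E)"
  unfolding generated_ideal_def by (rule subspace_span)

lemma generated_ideal_induct [consumes 1, case_names generator zero add scale]:
  assumes "y \<in> generated_ideal C E"
    and gen: "\<And>a e b. a \<in> C \<Longrightarrow> e \<in> E \<Longrightarrow> b \<in> C \<Longrightarrow> P (a \<odot> (e \<odot> b))"
    and "P 0" and "\<And>x y. P x \<Longrightarrow> P y \<Longrightarrow> P (x + y)" and "\<And>c x. P x \<Longrightarrow> P (c *s x)"
  shows "P y"
  using assms(1) unfolding generated_ideal_def
proof (induction rule: span_induct_alt)
  case (step c x y)
  then show ?case using assms(4,5) gen by blast
qed (rule assms(3))

lemma generated_ideal_mul:
  assumes C: "unital_subalgebra C one" and E: "E \<subseteq> C" and y: "y \<in> generated_ideal C E"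
  shows "y \<in> C" "c \<in> C \<Longrightarrow> c \<odot> y \<in> generated_ideal C E" "c \<in> C \<Longrightarrow> y \<odot> c \<in> generated_ideal C E"
proof -
  note Cd = unital_subalgebraD[OF C] and I = subspace_generated_ideal[of C E]
  show "y \<in> C" using y
    by (induction rule: generated_ideal_induct)
      (use E Cd(2) in \<open>auto intro: subspace_add[OF Cd(1)] subspace_scale[OF Cd(1)] subspace_0[OF Cd(1)]\<close>)
  show "c \<odot> y \<in> generated_ideal C E" if "c \<in> C" using y
  proof (induction rule: generated_ideal_induct)
    case (generator a e b)
    then show ?case using generated_idealI[of "c \<odot> a" C e E b] Cd(2) that by (simp add: mul_assoc)
  qed (auto simp: mul_add intro: subspace_add[OF I] subspace_scale[OF I] subspace_0[OF I])
  show "y \<odot> c \<in> generated_ideal C E" if "c \<in> C" using y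
  proof (induction rule: generated_ideal_induct)
    case (generator a e b)
    then show ?case using generated_idealI[of a C e E "b \<odot> c"] Cd(2) that by (simp add: mul_assoc)
  qed (auto simp: add_mul intro: subspace_add[OF I] subspace_scale[OF I] subspace_0[OF I])
qed

text \<open>A generator \<open>a \<odot> (f \<odot> b)\<close> of the ideal annihilates any
  \<open>v\<close> in the kernel of the pairing at \<open>e\<close>: for \<open>f = e\<close> by
  assumption, for other \<open>f\<close> because different blocks are orthogonal. Since
  \<open>v\<close> itself lies in the ideal, faithfulness of the ideal on itself makes it
  zero.\<close>

lemma nondegenerate_if_ideal_faithful:
  assumes C: "unital_subalgebra C one" and E: "primitive_family C E"
    and QL: "\<And>v. v \<in> generated_ideal C E \<Longrightarrow> (\<And>j. j \<in> generated_ideal C E \<Longrightarrow> j \<odot> v = 0) \<Longrightarrow> v = 0"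
    and QR: "\<And>v. v \<in> generated_ideal C E \<Longrightarrow> (\<And>j. j \<in> generated_ideal C E \<Longrightarrow> v \<odot> j = 0) \<Longrightarrow> v = 0"
  shows "nondegenerate C E"
  unfolding nondegenerate_def
proof (intro ballI conjI impI; elim conjE)
  note Cd = unital_subalgebraD[OF C] and Ed = primitive_familyD[OF E]
  fix e v assume e: "e \<in> E" and v: "v \<in> C"
  {
    assume ve: "v \<odot> e = v" and z: "\<forall>a\<in>C. e \<odot> (a \<odot> v) = 0"
    show "v = 0"
    proof (rule QL)
      show "v \<in> generated_ideal C E"
        using generated_idealI[OF v e Cd(3)] ve e Ed(2) Cd(5) by simp
      fix j assume "j \<in> generated_ideal C E"
      then show "j \<odot> v = 0"
      proof (induction rule: generated_ideal_induct)
        case (generator a f b)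
        have "f \<odot> (b \<odot> v) = 0"
        proof (cases "f = e")
          case True then show ?thesis using z generator by simp
        next
          case False
          then have "f \<odot> ((b \<odot> v) \<odot> e) = 0" using Ed(6)[of f e "b \<odot> v"] generator e v Cd(2) by simp
          then show ?thesis by (simp add: mul_assoc ve)
        qed
        then show ?case by (simp add: mul_assoc)
      qed (auto simp: add_mul)
    qed
  next
    assume ev: "e \<odot> v = v" and z: "\<forall>a\<in>C. v \<odot> (a \<odot> e) = 0"
    show "v = 0"
    proof (rule QR)
      show "v \<in> generated_ideal C E"
        using generated_idealI[OF Cd(3) e v] ev v Cd(4) by simp
      fix j assume "j \<in> generated_ideal C E"
      then show "v \<odot> j = 0"
      proof (induction rule: generated_ideal_induct)
        case (generator a f b)
        have "v \<odot> (a \<odot> f) = 0"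
        proof (cases "f = e")
          case True then show ?thesis using z generator by simp
        next
          case False
          then have "e \<odot> ((v \<odot> a) \<odot> f) = 0" using Ed(6)[of e f "v \<odot> a"] generator e v Cd(2) by simp
          then show ?thesis by (simp add: mul_assoc mul_absorb[OF ev])
        qed
        from mul_absorb[OF this, of b] show ?case by (simp add: mul_assoc)
      qed (auto simp: mul_add)
    qed
  }
qed

text \<open>The unit is the sum of the diagonal matrix units \<open>u e i \<odot> v e i\<close> over
  all blocks. On \<open>a \<odot> (e \<odot> b)\<close> only the block of \<open>e\<close>
  contributes, and there the dual bases expand \<open>a \<odot> e\<close> and
  \<open>e \<odot> b\<close>.\<close>

lemma generated_ideal_has_unit:
  assumes C: "unital_subalgebra C one" and E: "primitive_family C E" and nd: "nondegenerate C E"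
    and S: "finite S" "C \<subseteq> span S"
  shows "\<exists>\<epsilon>\<in>generated_ideal C E. \<forall>y\<in>generated_ideal C E. \<epsilon> \<odot> y = y \<and> y \<odot> \<epsilon> = y"
proof -
  note Cd = unital_subalgebraD[OF C] and Ed = primitive_familyD[OF E]
  have "\<forall>e\<in>E. \<exists>d u v. dual_system C e d u v \<and> 0 < d \<and>
     (\<forall>w\<in>C. w \<odot> e = w \<longrightarrow> (\<Sum>i<d. u i \<odot> (v i \<odot> w)) = w) \<and>
     (\<forall>w\<in>C. e \<odot> w = w \<longrightarrow> (\<Sum>i<d. w \<odot> (u i \<odot> v i)) = w)"
    using exists_dual_bases[OF C E nd _ S] by (intro ballI)
  from bchoice3[OF this] obtain d u v where "\<forall>e\<in>E. dual_system C e (d e) (u e) (v e) \<and> 0 < d e \<and>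
     (\<forall>w\<in>C. w \<odot> e = w \<longrightarrow> (\<Sum>i<d e. u e i \<odot> (v e i \<odot> w)) = w) \<and>
     (\<forall>w\<in>C. e \<odot> w = w \<longrightarrow> (\<Sum>i<d e. w \<odot> (u e i \<odot> v e i)) = w)"
    by (elim exE)
  then have duv: "\<And>e. e \<in> E \<Longrightarrow> dual_system C e (d e) (u e) (v e)"
    "\<And>e w. e \<in> E \<Longrightarrow> w \<in> C \<Longrightarrow> w \<odot> e = w \<Longrightarrow> (\<Sum>i<d e. u e i \<odot> (v e i \<odot> w)) = w"
    "\<And>e w. e \<in> E \<Longrightarrow> w \<in> C \<Longrightarrow> e \<odot> w = w \<Longrightarrow> (\<Sum>i<d e. w \<odot> (u e i \<odot> v e i)) = w"
    by auto
  note D = dual_systemD[OF duv(1)]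
  define \<epsilon> where "\<epsilon> = (\<Sum>e\<in>E. \<Sum>i<d e. u e i \<odot> v e i)"
  have "\<epsilon> \<in> generated_ideal C E" unfolding \<epsilon>_def
  proof (intro subspace_sum[OF subspace_generated_ideal])
    fix e i assume "e \<in> E" "i \<in> {..<d e}"
    then show "u e i \<odot> v e i \<in> generated_ideal C E"
      using generated_idealI[OF D(1) _ D(2), of e i e E e i] D(4) by simp
  qed
  moreover have "\<epsilon> \<odot> y = y \<and> y \<odot> \<epsilon> = y" if "y \<in> generated_ideal C E" for y
    using that
  proof (induction rule: generated_ideal_induct)
    case (generator a e b)
    note e = \<open>e \<in> E\<close>
    have zl: "v f i \<odot> (a \<odot> e) = 0" if "f \<in> E" "f \<noteq> e" "i < d f" for f i
    proof -
      have "f \<odot> ((v f i \<odot> a) \<odot> e) = 0"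
        using that e generator Cd(2) D by (intro Ed(6)) auto
      then show ?thesis by (simp add: mul_assoc mul_absorb[OF D(4)[OF that(1,3)]])
    qed
    have "\<epsilon> \<odot> (a \<odot> e) = (\<Sum>f\<in>E. \<Sum>i<d f. u f i \<odot> (v f i \<odot> (a \<odot> e)))"
      by (simp add: \<epsilon>_def sum_mul mul_assoc)
    also have "\<dots> = (\<Sum>f\<in>E. if f = e then \<Sum>i<d e. u e i \<odot> (v e i \<odot> (a \<odot> e)) else 0)"
      by (rule sum.cong) (use zl in auto)
    also have "\<dots> = (\<Sum>i<d e. u e i \<odot> (v e i \<odot> (a \<odot> e)))"
      using e Ed(1) by (simp add: sum.delta)
    also have "\<dots> = a \<odot> e"
      using duv(2)[OF e, of "a \<odot> e"] generator Ed Cd(2) by (simp add: mul_assoc)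
    finally have l: "\<epsilon> \<odot> (a \<odot> e) = a \<odot> e" .
    have zr: "e \<odot> (b \<odot> u f i) = 0" if "f \<in> E" "f \<noteq> e" "i < d f" for f i
    proof -
      have "e \<odot> ((b \<odot> u f i) \<odot> f) = 0"
        using that e generator Cd(2) D by (intro Ed(6)) auto
      then show ?thesis by (simp add: mul_assoc D(3)[OF that(1,3)])
    qed
    have zr': "e \<odot> (b \<odot> (u f i \<odot> y)) = 0" if "f \<in> E" "f \<noteq> e" "i < d f" for f i y
      using mul_absorb[OF zr[OF that], of y] by (simp add: mul_assoc)
    have "(e \<odot> b) \<odot> \<epsilon> = (\<Sum>f\<in>E. \<Sum>i<d f. (e \<odot> b) \<odot> (u f i \<odot> v f i))"
      by (simp add: \<epsilon>_def mul_sum)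
    also have "\<dots> = (\<Sum>f\<in>E. if f = e then \<Sum>i<d e. (e \<odot> b) \<odot> (u e i \<odot> v e i) else 0)"
      by (rule sum.cong) (use zr' in \<open>auto simp: mul_assoc\<close>)
    also have "\<dots> = (\<Sum>i<d e. (e \<odot> b) \<odot> (u e i \<odot> v e i))"
      using e Ed(1) by (simp add: sum.delta)
    also have "\<dots> = e \<odot> b"
      using generator Ed Cd(2) mul_absorb[OF Ed(4)[OF e]] by (intro duv(3)[OF e]) auto
    finally have r: "(e \<odot> b) \<odot> \<epsilon> = e \<odot> b" .
    show ?case using mul_absorb[OF l, of b] r by (simp add: mul_assoc)
  qed (auto simp: mul_distribs)
  ultimately show ?thesis by blast
qed

text \<open>With the unit \<open>\<epsilon>\<close> of the ideal,
  \<open>z = one - \<epsilon>\<close> is a central idempotent, and \<open>C\<close> is the product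
  of the ideal and of the multiples of \<open>z\<close>. The complement \<open>B\<close> need not
  consist of multiples of \<open>z\<close>, but multiplication by \<open>z\<close> maps it
  isomorphically onto them; so the new family is \<open>E\<close> together with the images of
  \<open>F\<close>.\<close>

theorem split_algebra_extension:
  assumes C: "unital_subalgebra C one" and E: "primitive_family C E"
    and S: "finite S" "C \<subseteq> span S"
    and QL: "\<And>v. v \<in> generated_ideal C E \<Longrightarrow> (\<And>j. j \<in> generated_ideal C E \<Longrightarrow> j \<odot> v = 0) \<Longrightarrow> v = 0"
    and QR: "\<And>v. v \<in> generated_ideal C E \<Longrightarrow> (\<And>j. j \<in> generated_ideal C E \<Longrightarrow> v \<odot> j = 0) \<Longrightarrow> v = 0"
    and BC: "B \<subseteq> C" and B: "split_algebra B one F"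
    and sum: "\<And>c. c \<in> C \<Longrightarrow> \<exists>j\<in>generated_ideal C E. \<exists>b\<in>B. c = j + b"
    and int: "generated_ideal C E \<inter> B \<subseteq> {0}"
  shows "\<exists>E'. split_algebra C one E'"
proof -
  note Cd = unital_subalgebraD[OF C] and Ed = primitive_familyD[OF E]
  have Bu: "unital_subalgebra B one" and F: "primitive_family B F" and Fnd: "nondegenerate B F"
    and Fgen: "one \<in> generated_ideal B F" using B unfolding split_algebra_def by auto
  note Bd = unital_subalgebraD[OF Bu] and Fd = primitive_familyD[OF F]
  define J where "J = generated_ideal C E"
  have nd: "nondegenerate C E" using nondegenerate_if_ideal_faithful[OF C E QL QR] .
  have EC: "E \<subseteq> C" using Ed(2) by auto
  have Js: "subspace J" unfolding J_def by (rule subspace_generated_ideal)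
  have JC: "y \<in> C" and J1: "c \<in> C \<Longrightarrow> c \<odot> y \<in> J" and J2: "c \<in> C \<Longrightarrow> y \<odot> c \<in> J" if "y \<in> J" for y c
    using generated_ideal_mul[OF C EC] that unfolding J_def by auto
  obtain \<epsilon> where \<epsilon>J: "\<epsilon> \<in> J" and \<epsilon>: "\<And>y. y \<in> J \<Longrightarrow> \<epsilon> \<odot> y = y" "\<And>y. y \<in> J \<Longrightarrow> y \<odot> \<epsilon> = y"
    using generated_ideal_has_unit[OF C E nd S] unfolding J_def by blast
  define z where "z = one - \<epsilon>"
  have zC: "z \<in> C" unfolding z_def by (rule subspace_diff[OF Cd(1) Cd(3) JC[OF \<epsilon>J]])
  have zJ: "z \<odot> y = 0" "y \<odot> z = 0" if "y \<in> J" for y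
    unfolding z_def using that JC \<epsilon> Cd(4,5) by (auto simp: mul_distribs)
  \<comment> \<open>Both \<open>\<epsilon> \<odot> a\<close> and \<open>a \<odot> \<epsilon>\<close>
    lie in \<open>J\<close>, where \<open>\<epsilon>\<close> is the unit, so both equal
    \<open>\<epsilon> \<odot> (a \<odot> \<epsilon>)\<close>.\<close>
  have zc: "z \<odot> a = a \<odot> z" if "a \<in> C" for a
  proof -
    have "\<epsilon> \<odot> a = \<epsilon> \<odot> (a \<odot> \<epsilon>)" using \<epsilon>(2)[OF J2[OF \<epsilon>J that]] by (simp add: mul_assoc)
    also have "\<dots> = a \<odot> \<epsilon>" using \<epsilon>(1)[OF J1[OF \<epsilon>J that]] .
    finally show ?thesis unfolding z_def using Cd(4,5) that by (simp add: mul_distribs)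
  qed
  have zz: "z \<odot> z = z"
  proof -
    have "z \<odot> z = (one - \<epsilon>) \<odot> z" by (simp add: z_def)
    also have "\<dots> = one \<odot> z - \<epsilon> \<odot> z" by (rule diff_mul)
    also have "\<dots> = z" using Cd(4)[OF zC] zJ(2)[OF \<epsilon>J] by simp
    finally show ?thesis .
  qed
  \<comment> \<open>Multiplication by \<open>z\<close> is injective on \<open>B\<close>: what it
    kills equals \<open>\<epsilon> \<odot> b\<close>, so it lies in \<open>J\<close>, which meets
    \<open>B\<close> in zero.\<close>
  have zB0: "b = 0" if "b \<in> B" "z \<odot> b = 0" for b
  proof -
    have "b = \<epsilon> \<odot> b" using that(2) Bd(4)[OF that(1)] by (simp add: z_def diff_mul)
    then have "b \<in> J" using J2[OF \<epsilon>J, of b] that BC by auto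
    then show ?thesis using int that J_def by auto
  qed
  have FB: "f \<in> B" "f \<in> C" if "f \<in> F" for f using Fd(2) that BC by auto
  \<comment> \<open>A factor \<open>z\<close> makes the \<open>J\<close>-part of any element
    disappear, so statements about \<open>C\<close> reduce to the component in
    \<open>B\<close>.\<close>
  have zred: "\<exists>b\<in>B. \<forall>p\<in>C. \<forall>q\<in>C. z \<odot> (p \<odot> (a \<odot> q)) = z \<odot> (p \<odot> (b \<odot> q))" if "a \<in> C" for a
  proof -
    obtain j b where jb: "j \<in> J" "b \<in> B" "a = j + b" using sum[OF \<open>a \<in> C\<close>] J_def by blast
    have "z \<odot> (p \<odot> (j \<odot> q)) = 0" if "p \<in> C" "q \<in> C" for p q
      using that by (intro zJ J1 J2 jb)
    then show ?thesis using jb by (intro bexI[of _ b]) (auto simp: mul_distribs)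
  qed
  define E' where "E' = E \<union> (\<lambda>f. z \<odot> f) ` F"
  have "primitive_family C E'"
    unfolding primitive_family_def
  proof (intro conjI ballI impI)
    show "finite E'" "E' \<subseteq> C" using Ed Fd FB zC Cd(2) by (auto simp: E'_def)
    fix e assume eE': "e \<in> E'"
    have "z \<odot> f \<noteq> 0" if "f \<in> F" for f using zB0[OF FB(1)[OF that]] Fd(3)[OF that] by auto
    then show "e \<noteq> 0" using eE' Ed(3) by (auto simp: E'_def)
    have sq: "z \<odot> (f \<odot> (a \<odot> (z \<odot> g))) = z \<odot> (f \<odot> (a \<odot> g))" if "f \<in> F" "g \<in> F" "a \<in> C" for f g a
    proof -
      have "z \<odot> (f \<odot> (a \<odot> (z \<odot> g))) = z \<odot> ((f \<odot> (a \<odot> g)) \<odot> z)"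
        by (simp add: mul_assoc zc[OF FB(2)[OF that(2)]])
      also have "\<dots> = z \<odot> (z \<odot> (f \<odot> (a \<odot> g)))"
        using that FB Cd(2) by (subst zc) auto
      finally show ?thesis by (simp add: mul_absorb[OF zz])
    qed
    show "e \<odot> e = e"
    proof (cases "e \<in> E")
      case False
      then obtain f where f: "f \<in> F" "e = z \<odot> f" using eE' by (auto simp: E'_def)
      then have "e \<odot> e = z \<odot> (f \<odot> (one \<odot> (z \<odot> f)))"
        using FB zC Cd(2,4) by (simp add: mul_assoc)
      also have "\<dots> = e" using sq[OF f(1) f(1) Cd(3)] Cd(4) FB f Fd(4) by simp
      finally show ?thesis .
    qed (use Ed in auto)
    show "\<exists>r. e \<odot> (a \<odot> e) = r *s e" if aC: "a \<in> C" for a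
    proof (cases "e \<in> E")
      case False
      then obtain f where f: "f \<in> F" "e = z \<odot> f" using eE' by (auto simp: E'_def)
      obtain b where b: "b \<in> B" "z \<odot> (f \<odot> (a \<odot> f)) = z \<odot> (f \<odot> (b \<odot> f))"
        using zred[OF aC] FB f by blast
      obtain r where "f \<odot> (b \<odot> f) = r *s f" using Fd(5) f b by blast
      then show ?thesis using sq[OF f(1) f(1) aC] b f by (auto simp: mul_assoc)
    qed (use Ed(5) aC in auto)
    fix e2 a assume e2: "e2 \<in> E'" and ne: "e \<noteq> e2" and aC: "a \<in> C"
    have EJ: "e \<in> J" if "e \<in> E" for e
      using generated_idealI[OF Cd(3) that Cd(3)] Ed(2)[OF that] Cd(4,5) by (simp add: J_def)
    consider "e \<in> E" "e2 \<in> E" | f where "e \<in> E" "f \<in> F" "e2 = z \<odot> f"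
      | f where "f \<in> F" "e2 \<in> E" "e = z \<odot> f" | f g where "f \<in> F" "g \<in> F" "e = z \<odot> f" "e2 = z \<odot> g"
      using eE' e2 by (auto simp: E'_def)
    then show "e \<odot> (a \<odot> e2) = 0"
    proof cases
      case 1 then show ?thesis using Ed(6) ne aC by blast
    next
      case 2
      have "e \<odot> (a \<odot> e2) = (e \<odot> (a \<odot> f)) \<odot> z"
        using 2 zc[OF FB(2)] by (simp add: mul_assoc)
      also have "\<dots> = 0" using 2 EJ J2 aC FB Cd(2) by (intro zJ) auto
      finally show ?thesis .
    next
      case 3
      have "e \<odot> (a \<odot> e2) = z \<odot> (f \<odot> (a \<odot> e2))" using 3 by (simp add: mul_assoc)
      also have "\<dots> = 0" using 3 EJ aC FB by (intro zJ J1) auto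
      finally show ?thesis .
    next
      case 4
      obtain b where b: "b \<in> B" "z \<odot> (f \<odot> (a \<odot> g)) = z \<odot> (f \<odot> (b \<odot> g))"
        using zred[OF aC] FB 4 by blast
      have "f \<noteq> g" using ne 4 by auto
      then have "f \<odot> (b \<odot> g) = 0" using Fd(6) 4 b by blast
      then show ?thesis using sq[OF 4(1,2) aC] b 4 by (simp add: mul_assoc)
    qed
  qed
  moreover have "nondegenerate C E'"
    unfolding nondegenerate_def
  proof (intro ballI)
    fix e v assume e: "e \<in> E'" and v: "v \<in> C"
    show "(v \<odot> e = v \<and> (\<forall>a\<in>C. e \<odot> (a \<odot> v) = 0) \<longrightarrow> v = 0) \<and>
      (e \<odot> v = v \<and> (\<forall>a\<in>C. v \<odot> (a \<odot> e) = 0) \<longrightarrow> v = 0)"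
    proof (cases "e \<in> E")
      case True then show ?thesis using nd v unfolding nondegenerate_def by blast
    next
      case False
      then obtain f where f: "f \<in> F" "e = z \<odot> f" using e by (auto simp: E'_def)
      note fC = FB(2)[OF f(1)] and fB = FB(1)[OF f(1)]
      obtain j b where jb: "j \<in> J" "b \<in> B" "v = j + b" using sum[OF v] J_def by blast
      have bC: "b \<in> C" using jb BC by auto
      have zv: "z \<odot> v = z \<odot> b" using jb zJ by (simp add: mul_distribs)
      show ?thesis
      proof (intro conjI impI; elim conjE)
        assume ve: "v \<odot> e = v" and h: "\<forall>a\<in>C. e \<odot> (a \<odot> v) = 0"
        have "v = (z \<odot> b) \<odot> f" using ve f zc[OF v] zv by (simp flip: mul_assoc)
        then have v': "v = z \<odot> (b \<odot> f)" by (simp add: mul_assoc)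
        have "b \<odot> f = 0"
        proof (rule nondegenerateD(1)[OF Fnd f(1)])
          show bfB: "b \<odot> f \<in> B" using jb fB Bd(2) by auto
          show "(b \<odot> f) \<odot> f = b \<odot> f" using Fd(4) f by (simp add: mul_assoc)
          fix a assume a: "a \<in> B"
          have aC: "a \<in> C" using a BC by auto
          have "0 = z \<odot> (f \<odot> (a \<odot> (z \<odot> (b \<odot> f))))"
            using h aC f v' by (simp add: mul_assoc)
          also have "\<dots> = z \<odot> ((f \<odot> (a \<odot> (b \<odot> f))) \<odot> z)"
            using zc[of "b \<odot> f"] bfB BC by (auto simp: mul_assoc)
          also have "\<dots> = z \<odot> (z \<odot> (f \<odot> (a \<odot> (b \<odot> f))))"
            using fC aC bC Cd(2) by (subst zc) auto
          also have "\<dots> = z \<odot> (f \<odot> (a \<odot> (b \<odot> f)))" by (simp add: mul_absorb[OF zz])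
          finally have "z \<odot> (f \<odot> (a \<odot> (b \<odot> f))) = 0" by (rule sym)
          then show "f \<odot> (a \<odot> (b \<odot> f)) = 0" by (rule zB0[rotated]) (intro Bd(2) fB a jb(2))
        qed
        then show "v = 0" using v' by simp
      next
        assume ev: "e \<odot> v = v" and h: "\<forall>a\<in>C. v \<odot> (a \<odot> e) = 0"
        have "v = f \<odot> (z \<odot> b)" using ev f zc[OF fC] zv by (simp add: mul_assoc)
        also have "\<dots> = z \<odot> (f \<odot> b)" using zc[OF fC] by (simp flip: mul_assoc)
        finally have v': "v = z \<odot> (f \<odot> b)" .
        have "f \<odot> b = 0"
        proof (rule nondegenerateD(2)[OF Fnd f(1)])
          show fbB: "f \<odot> b \<in> B" using jb fB Bd(2) by auto
          show "f \<odot> (f \<odot> b) = f \<odot> b" using Fd(4) f by (simp add: mul_absorb)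
          fix a assume a: "a \<in> B"
          have aC: "a \<in> C" using a BC by auto
          have "0 = z \<odot> (((f \<odot> b) \<odot> a) \<odot> (z \<odot> f))"
            using h aC f v' by (simp add: mul_assoc)
          also have "\<dots> = z \<odot> (((f \<odot> b) \<odot> (a \<odot> f)) \<odot> z)"
            using zc[OF fC] by (auto simp: mul_assoc)
          also have "\<dots> = z \<odot> (z \<odot> ((f \<odot> b) \<odot> (a \<odot> f)))"
            using fC aC bC Cd(2) by (subst zc) auto
          also have "\<dots> = z \<odot> ((f \<odot> b) \<odot> (a \<odot> f))" by (simp add: mul_absorb[OF zz])
          finally have "z \<odot> ((f \<odot> b) \<odot> (a \<odot> f)) = 0" by (rule sym)
          then show "(f \<odot> b) \<odot> (a \<odot> f) = 0" by (rule zB0[rotated]) (intro Bd(2) fB a jb(2))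
        qed
        then show "v = 0" using v' by simp
      qed
    qed
  qed
  moreover have "one \<in> generated_ideal C E'"
  proof -
    have "generated_ideal C E \<subseteq> generated_ideal C E'"
      unfolding generated_ideal_def by (rule span_mono) (auto simp: E'_def)
    then have "\<epsilon> \<in> generated_ideal C E'" using \<epsilon>J J_def by auto
    moreover have "z \<odot> y \<in> generated_ideal C E'" if "y \<in> generated_ideal B F" for y
      using that
    proof (induction rule: generated_ideal_induct)
      case (generator a f b)
      have "z \<odot> (a \<odot> (f \<odot> b)) = a \<odot> ((z \<odot> f) \<odot> b)"
        using mul_absorb[OF zc, of a "f \<odot> b"] generator BC by (auto simp: mul_assoc)
      then show ?case using generator BC by (auto simp: E'_def intro!: generated_idealI)
    qed (auto simp: mul_add intro: subspace_add[OF subspace_generated_ideal]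
        subspace_scale[OF subspace_generated_ideal] subspace_0[OF subspace_generated_ideal])
    then have "z \<odot> one \<in> generated_ideal C E'" using Fgen by blast
    ultimately have "\<epsilon> + z \<odot> one \<in> generated_ideal C E'"
      by (rule subspace_add[OF subspace_generated_ideal])
    then show ?thesis using Cd(5)[OF zC] by (simp add: z_def)
  qed
  ultimately have "split_algebra C one E'" unfolding split_algebra_def using C by blast
  then show ?thesis by blast
qed

end

section \<open>The group algebra of the symmetric group\<close>

text \<open>The group algebra is taken as it sits in a larger algebra, spanned by the
  \<open>G w\<close>. The adjoint \<open>star\<close> inverts permutations and \<open>tr\<close>
  reads the coefficient of the identity; the trace law also forces the \<open>G w\<close> to be
  linearly independent.\<close>

locale perm_algebra = assoc_algebra scale mul
  for scale :: "'a::field_char_0 \<Rightarrow> 'v::ab_group_add \<Rightarrow> 'v" (infixr "*s" 75)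
    and mul :: "'v \<Rightarrow> 'v \<Rightarrow> 'v" (infixl "\<odot>" 70) +
  fixes n :: nat and G :: "(nat \<Rightarrow> nat) \<Rightarrow> 'v" and star :: "'v \<Rightarrow> 'v" and tr :: "'v \<Rightarrow> 'a"
  assumes G_mul: "v permutes {..<n} \<Longrightarrow> w permutes {..<n} \<Longrightarrow> G v \<odot> G w = G (v \<circ> w)"
    and star_mul: "star (a \<odot> b) = star b \<odot> star a"
    and star_add: "star (a + b) = star a + star b"
    and star_scale: "star (r *s a) = r *s star a"
    and star_G: "w permutes {..<n} \<Longrightarrow> star (G w) = G (inv w)"
    and tr_add: "tr (a + b) = tr a + tr b"
    and tr_scale: "tr (r *s a) = r * tr a"
    and tr_G: "w permutes {..<n} \<Longrightarrow> tr (G w) = (if w = id then 1 else 0)"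
begin

abbreviation "perms \<equiv> {w. w permutes {..<n}}"

definition "one = G id"
definition "B = span (G ` perms)"

text \<open>The span over the rationals. The base field need not be ordered, so the argument that a
  sum of squares is positive can only be made for rational coefficients.\<close>

inductive_set rational_elements :: "'v set" where
  G: "w permutes {..<n} \<Longrightarrow> G w \<in> rational_elements"
| zero: "0 \<in> rational_elements"
| add: "a \<in> rational_elements \<Longrightarrow> b \<in> rational_elements \<Longrightarrow> a + b \<in> rational_elements"
| scale: "r \<in> \<rat> \<Longrightarrow> a \<in> rational_elements \<Longrightarrow> r *s a \<in> rational_elements"

section \<open>Adjoint, trace and rational form of the group algebra\<close>

lemma finite_perms: "finite perms"
  by (rule finite_permutations) simp

lemma star_0: "star 0 = 0"
  using star_scale[of 0 0] by simp

lemma star_diff: "star (a - b) = star a - star b"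
  using star_add[of "a - b" b] by (simp add: algebra_simps)

lemma star_sum: "star (sum f I) = (\<Sum>i\<in>I. star (f i))"
  by (induction I rule: infinite_finite_induct) (auto simp: star_0 star_add)

lemma tr_0: "tr 0 = 0"
  using tr_scale[of 0 0] by simp

lemma tr_sum: "tr (sum f I) = (\<Sum>i\<in>I. tr (f i))"
  by (induction I rule: infinite_finite_induct) (auto simp: tr_0 tr_add)

lemma subspace_B: "subspace B"
  unfolding B_def by (rule subspace_span)

lemmas B_add = subspace_add[OF subspace_B]
lemmas B_diff = subspace_diff[OF subspace_B]
lemmas B_scale = subspace_scale[OF subspace_B]
lemmas B_sum = subspace_sum[OF subspace_B]
lemmas B_0 = subspace_0[OF subspace_B]

lemma G_in_B: "w permutes {..<n} \<Longrightarrow> G w \<in> B"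
  unfolding B_def by (rule span_base) auto

lemma one_in_B: "one \<in> B"
  unfolding one_def by (rule G_in_B[OF permutes_id])

lemma B_induct [consumes 1, case_names G zero add scale]:
  assumes "a \<in> B" and "\<And>w. w permutes {..<n} \<Longrightarrow> P (G w)" and "P 0"
    and "\<And>a b. a \<in> B \<Longrightarrow> b \<in> B \<Longrightarrow> P a \<Longrightarrow> P b \<Longrightarrow> P (a + b)"
    and "\<And>r a. a \<in> B \<Longrightarrow> P a \<Longrightarrow> P (r *s a)"
  shows "P a"
proof -
  have "a \<in> B \<and> P a"
    using assms(1) unfolding B_def
  proof (induction rule: span_induct_alt)
    case base then show ?case using assms(3) span_zero by blast
  next
    case (step c x y)
    then obtain w where w: "w permutes {..<n}" "x = G w" by auto
    have "c *s x \<in> B" using w G_in_B B_scale by auto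
    then show ?case using step assms(2)[OF w(1)] assms(4)[of "c *s x" y] assms(5)[of x c] G_in_B[OF w(1)] w B_add
      by (auto simp: B_def)
  qed
  then show ?thesis by simp
qed

lemma B_mul: "a \<in> B \<Longrightarrow> b \<in> B \<Longrightarrow> a \<odot> b \<in> B"
proof (induction rule: B_induct)
  case (G v)
  show ?case using \<open>b \<in> B\<close>
  proof (induction rule: B_induct)
    case (G w)
    then show ?case using G_mul[OF \<open>v permutes {..<n}\<close> G] G_in_B permutes_compose[OF G \<open>v permutes {..<n}\<close>] by simp
  qed (auto simp: mul_add intro: B_add B_scale B_0)
qed (auto simp: add_mul intro: B_add B_scale B_0)

lemma one_mul: "a \<in> B \<Longrightarrow> one \<odot> a = a" and mul_one: "a \<in> B \<Longrightarrow> a \<odot> one = a"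
  by (induction rule: B_induct; simp add: one_def G_mul permutes_id mul_distribs)+

lemma unital_B: "unital_subalgebra B one"
  unfolding unital_subalgebra_def using subspace_B B_mul one_in_B one_mul mul_one by blast

lemma star_in_B: "a \<in> B \<Longrightarrow> star a \<in> B"
  by (induction rule: B_induct)
    (auto simp: star_G star_0 star_add star_scale intro: G_in_B permutes_inv B_add B_scale B_0)

lemma star_star: "a \<in> B \<Longrightarrow> star (star a) = a"
  by (induction rule: B_induct)
    (auto simp: star_G star_0 star_add star_scale permutes_inv permutes_inv_inv)

lemma star_one: "star one = one"
  unfolding one_def by (simp add: star_G permutes_id)

lemma rational_in_B: "a \<in> rational_elements \<Longrightarrow> a \<in> B"
  by (induction rule: rational_elements.induct) (auto intro: G_in_B B_add B_scale B_0)

lemma rational_one: "one \<in> rational_elements"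
  unfolding one_def by (rule rational_elements.G[OF permutes_id])

lemma rational_mul: "a \<in> rational_elements \<Longrightarrow> b \<in> rational_elements \<Longrightarrow> a \<odot> b \<in> rational_elements"
proof (induction rule: rational_elements.induct)
  case (G v)
  show ?case using \<open>b \<in> rational_elements\<close>
  proof (induction rule: rational_elements.induct)
    case (G w)
    then show ?case using G_mul[OF \<open>v permutes {..<n}\<close> G] rational_elements.G permutes_compose[OF G \<open>v permutes {..<n}\<close>] by simp
  qed (auto simp: mul_add intro: rational_elements.intros)
qed (auto simp: add_mul intro: rational_elements.intros)

lemma rational_diff: "a \<in> rational_elements \<Longrightarrow> b \<in> rational_elements \<Longrightarrow> a - b \<in> rational_elements"
  using rational_elements.add[of a "(-1) *s b"] rational_elements.scale[of "-1" b] by simp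

lemma rational_sum: "(\<And>i. i \<in> I \<Longrightarrow> f i \<in> rational_elements) \<Longrightarrow> sum f I \<in> rational_elements"
  by (induction I rule: infinite_finite_induct) (auto intro: rational_elements.intros)

lemma rational_coefficients:
  "a \<in> rational_elements \<Longrightarrow> \<exists>c. (\<forall>w. c w \<in> \<rat>) \<and> a = (\<Sum>w\<in>perms. c w *s G w)"
proof (induction rule: rational_elements.induct)
  case (G w)
  show ?case
    by (rule exI[of _ "\<lambda>v. if v = w then 1 else 0"])
      (use G in \<open>simp add: if_distrib[where f = "\<lambda>r. r *s a" for a] sum.delta finite_perms cong: if_cong\<close>)
next
  case zero then show ?case by (intro exI[of _ "\<lambda>_. 0"]) simp
next
  case (add a b)
  then obtain c d where "\<forall>w. c w \<in> \<rat>" "a = (\<Sum>w\<in>perms. c w *s G w)"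
    "\<forall>w. d w \<in> \<rat>" "b = (\<Sum>w\<in>perms. d w *s G w)" by auto
  then show ?case
    by (intro exI[of _ "\<lambda>w. c w + d w"]) (simp add: scale_left_distrib sum.distrib)
next
  case (scale r a)
  then obtain c where "\<forall>w. c w \<in> \<rat>" "a = (\<Sum>w\<in>perms. c w *s G w)" by auto
  then show ?case using scale
    by (intro exI[of _ "\<lambda>w. r * c w"]) (simp add: scale_sum_right)
qed

text \<open>The coefficients come from \<open>rat\<close>, which is ordered and embeds because the
  characteristic is zero.\<close>

lemma sum_squares_rational_zero:
  fixes c :: "'b \<Rightarrow> 'a"
  assumes "finite I" "\<And>i. c i \<in> \<rat>" "(\<Sum>i\<in>I. c i * c i) = 0" "i \<in> I"
  shows "c i = 0"
proof -
  have "\<forall>i. \<exists>q. c i = of_rat q" using assms(2) Rats_cases by metis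
  then obtain q where q: "\<And>i. c i = of_rat (q i)" by metis
  have "of_rat (\<Sum>i\<in>I. q i * q i) = (0 :: 'a)"
    using assms(3) by (simp add: q of_rat_sum of_rat_mult)
  then have "(\<Sum>i\<in>I. q i * q i) = 0" by simp
  then have "q i * q i = 0" using assms(1,4) by (subst (asm) sum_nonneg_eq_0_iff) auto
  then show ?thesis by (simp add: q)
qed

text \<open>
  Positivity replaces Maschke's theorem: the trace of \<open>u \<odot> star u\<close> is a sum of squares of rationals.
\<close>

lemma rational_mul_star_zero:
  assumes u: "u \<in> rational_elements" and z: "u \<odot> star u = 0"
  shows "u = 0"
proof -
  obtain c where c: "\<And>w. c w \<in> \<rat>" "u = (\<Sum>w\<in>perms. c w *s G w)"
    using rational_coefficients[OF u] by auto
  have "tr (u \<odot> star u) = (\<Sum>v\<in>perms. \<Sum>w\<in>perms. c v * (c w * tr (G v \<odot> G (inv w))))"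
    unfolding c(2) star_sum
    by (simp add: sum_mul mul_sum star_scale star_G tr_sum tr_scale sum_distrib_left,
        subst sum.swap, simp add: mult.left_commute)
  \<comment> \<open>The permutations are orthonormal for the form sending \<open>a\<close> and
    \<open>b\<close> to \<open>tr (a \<odot> star b)\<close>.\<close>
  also have "\<dots> = (\<Sum>v\<in>perms. \<Sum>w\<in>perms. if w = v then c v * c v else 0)"
  proof (intro sum.cong refl)
    fix v w assume vw: "v \<in> perms" "w \<in> perms"
    have p: "v \<circ> inv w permutes {..<n}" using vw permutes_compose permutes_inv by blast
    have "v \<circ> inv w = id \<longleftrightarrow> w = v"
    proof
      assume "v \<circ> inv w = id"
      then have "v \<circ> inv w \<circ> w = w" by simp
      then show "w = v" using permutes_inv_o(2)[of w "{..<n}"] vw by (simp add: o_assoc[symmetric])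
    qed (use vw permutes_inv_o in auto)
    then show "c v * (c w * tr (G v \<odot> G (inv w))) = (if w = v then c v * c v else 0)"
      using vw p by (simp add: G_mul permutes_inv tr_G)
  qed
  also have "\<dots> = (\<Sum>v\<in>perms. c v * c v)" by (simp add: sum.delta finite_perms)
  finally have "(\<Sum>v\<in>perms. c v * c v) = 0" using z tr_0 by simp
  then have "c v = 0" if "v \<in> perms" for v
    using sum_squares_rational_zero[OF finite_perms, of c v] c(1) that by simp
  then show ?thesis unfolding c(2) by simp
qed

text \<open>The Jucys-Murphy elements and the adjacent transpositions.\<close>

definition X :: "nat \<Rightarrow> 'v" where "X k = (\<Sum>l<k. G (transpose l k))"
definition s :: "nat \<Rightarrow> 'v" where "s k = G (transpose k (Suc k))"

lemma transpose_perm: "a < n \<Longrightarrow> b < n \<Longrightarrow> transpose a b permutes {..<n}"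
  by (rule permutes_swap_id) auto

lemma permutes_mono: "w permutes {..<k} \<Longrightarrow> k \<le> n \<Longrightarrow> w permutes {..<n}"
  by (rule permutes_subset) auto

lemma X_rational: "k < n \<Longrightarrow> X k \<in> rational_elements"
  unfolding X_def by (intro rational_sum rational_elements.G transpose_perm) auto

lemma s_rational: "Suc k < n \<Longrightarrow> s k \<in> rational_elements"
  unfolding s_def by (intro rational_elements.G transpose_perm) auto

lemma X_in_B: "k < n \<Longrightarrow> X k \<in> B" and s_in_B: "Suc k < n \<Longrightarrow> s k \<in> B"
  using rational_in_B X_rational s_rational by auto

lemma star_X: "k < n \<Longrightarrow> star (X k) = X k"
  unfolding X_def by (auto simp: star_sum star_G transpose_perm intro!: sum.cong)

lemma s_s: "Suc k < n \<Longrightarrow> v \<in> B \<Longrightarrow> s k \<odot> (s k \<odot> v) = v"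
  using mul_absorb[of "s k" "s k" one v] one_mul
  by (simp add: s_def G_mul transpose_perm one_def)

text \<open>Conjugation by \<open>s k\<close> moves the end \<open>k\<close> of each transposition
  to \<open>Suc k\<close>. The summand \<open>s k\<close> is the transposition with
  \<open>l = k\<close>, which conjugation does not reach.\<close>

lemma X_Suc:
  assumes "Suc k < n"
  shows "X (Suc k) = s k \<odot> (X k \<odot> s k) + s k"
proof -
  have *: "s k \<odot> (G (transpose l k) \<odot> s k) = G (transpose l (Suc k))" if "l < k" for l
  proof -
    have "transpose k (Suc k) \<circ> (transpose l k \<circ> transpose k (Suc k)) = transpose l (Suc k)"
      using that by (auto simp: fun_eq_iff transpose_def)
    then show ?thesis using assms that
      by (simp add: s_def G_mul transpose_perm permutes_compose)
  qed
  show ?thesis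
    unfolding X_def lessThan_Suc
    by (simp add: mul_sum sum_mul * s_def[symmetric] add.commute)
qed

text \<open>A permutation that fixes \<open>k\<close> and everything above it permutes the summands
  \<open>transpose l k\<close> among themselves by conjugation.\<close>

lemma G_X_commute:
  assumes w: "w permutes {..<k}" and k: "k < n"
  shows "G w \<odot> X k = X k \<odot> G w"
proof -
  have wn: "w permutes {..<n}" using permutes_mono[OF w] k by simp
  have wk: "w k = k" using w by (simp add: permutes_not_in)
  have *: "G w \<odot> G (transpose l k) = G (transpose (w l) k) \<odot> G w" if "l < k" for l
  proof -
    have wl: "w l < k" using permutes_in_image[OF w, of l] that by simp
    have "w \<circ> transpose l k = transpose (w l) k \<circ> w"
    proof
      fix y show "(w \<circ> transpose l k) y = (transpose (w l) k \<circ> w) y"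
        using permutes_inj[OF w] wk that wl by (auto simp: transpose_def inj_def)
    qed
    then show ?thesis using wn wl that k by (simp add: G_mul transpose_perm)
  qed
  have "G w \<odot> X k = (\<Sum>l<k. G (transpose (w l) k) \<odot> G w)"
    unfolding X_def by (simp add: mul_sum *)
  also have "\<dots> = (\<Sum>l<k. G (transpose l k) \<odot> G w)"
    using sum.permute[OF w, of "\<lambda>l. G (transpose l k) \<odot> G w"] by (simp add: o_def)
  finally show ?thesis by (simp add: X_def sum_mul)
qed

lemma X_commute: "j < n \<Longrightarrow> k < n \<Longrightarrow> X j \<odot> X k = X k \<odot> X j"
proof (induction j k rule: linorder_wlog)
  case (le j k)
  show ?case
  proof (cases "j = k")
    case False
    then have jk: "j < k" using le by simp
    have "G (transpose l j) \<odot> X k = X k \<odot> G (transpose l j)" if "l < j" for l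
      using jk le that by (intro G_X_commute permutes_swap_id) auto
    then show ?thesis by (simp add: X_def[of j] sum_mul mul_sum)
  qed simp
next
  case (sym a b) then show ?case by simp
qed

lemma s_X_commute:
  assumes "Suc k < n" "j < n" "j \<noteq> k" "j \<noteq> Suc k"
  shows "s k \<odot> X j = X j \<odot> s k"
proof (cases "Suc k < j")
  case True
  then show ?thesis unfolding s_def using assms by (intro G_X_commute permutes_swap_id) auto
next
  case False
  then have jk: "j < k" using assms by auto
  have "s k \<odot> G (transpose l j) = G (transpose l j) \<odot> s k" if "l < j" for l
  proof -
    have "transpose k (Suc k) \<circ> transpose l j = transpose l j \<circ> transpose k (Suc k)"
      using that jk by (auto simp: fun_eq_iff transpose_def)
    then show ?thesis using that jk assms by (simp add: s_def G_mul transpose_perm)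
  qed
  then show ?thesis by (simp add: X_def mul_sum sum_mul)
qed

text \<open>The intertwiners: \<open>phi k\<close> exchanges the eigenvalues of \<open>X k\<close> and \<open>X (Suc k)\<close>.\<close>

definition phi :: "nat \<Rightarrow> 'v \<Rightarrow> 'v" where
  "phi k v = s k \<odot> (X k \<odot> v - X (Suc k) \<odot> v) + v"

context
  fixes k assumes k: "Suc k < n"
begin

lemma s_X_Suc: "v \<in> B \<Longrightarrow> s k \<odot> (X (Suc k) \<odot> v) = X k \<odot> (s k \<odot> v) + v"
  using k by (simp add: X_Suc mul_distribs mul_assoc s_s B_mul X_in_B s_in_B)

lemma X_Suc_s: "v \<in> B \<Longrightarrow> X (Suc k) \<odot> (s k \<odot> v) = s k \<odot> (X k \<odot> v) + v"
  using k by (simp add: X_Suc mul_distribs mul_assoc s_s B_mul X_in_B s_in_B)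

lemma phi_in_B: "v \<in> B \<Longrightarrow> phi k v \<in> B"
  unfolding phi_def using k by (intro B_add B_mul B_diff s_in_B X_in_B) auto

lemma phi_0: "phi k 0 = 0"
  by (simp add: phi_def)

lemma XX: "X k \<odot> (X (Suc k) \<odot> v) = X (Suc k) \<odot> (X k \<odot> v)"
  using X_commute[of k "Suc k"] k by (simp flip: mul_assoc)

lemma X_Suc_phi: "v \<in> B \<Longrightarrow> X (Suc k) \<odot> phi k v = phi k (X k \<odot> v)"
  using k by (simp add: phi_def mul_distribs X_Suc_s B_diff B_mul X_in_B XX)

lemma X_phi: 
  assumes "v \<in> B" shows "X k \<odot> phi k v = phi k (X (Suc k) \<odot> v)"
proof -
  have "X k \<odot> (s k \<odot> u) = s k \<odot> (X (Suc k) \<odot> u) - u" if "u \<in> B" for u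
    using s_X_Suc[OF that] by simp
  then show ?thesis using k assms by (simp add: phi_def mul_distribs B_mul X_in_B XX)
qed

lemma X_other_phi:
  assumes "j < n" "j \<noteq> k" "j \<noteq> Suc k"
  shows "X j \<odot> phi k v = phi k (X j \<odot> v)"
proof -
  have c: "X j \<odot> (X i \<odot> v) = X i \<odot> (X j \<odot> v)" if "i < n" for i
    using X_commute[OF assms(1) that] by (simp flip: mul_assoc)
  have "X j \<odot> (s k \<odot> u) = s k \<odot> (X j \<odot> u)" for u
    using s_X_commute[OF k assms] by (simp flip: mul_assoc)
  then show ?thesis using k by (simp add: phi_def mul_distribs c)
qed

text \<open>The operator on the right is 1 minus the square of \<open>X k - X (Suc k)\<close>. On a
  common eigenvector it vanishes exactly when the two eigenvalues differ by one; this is what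
  restricts the eigenvalues of \<open>X (Suc k)\<close>.\<close>

lemma phi_phi:
  assumes v: "v \<in> B"
  shows "phi k (phi k v) = v - (X k \<odot> (X k \<odot> v) - X k \<odot> (X (Suc k) \<odot> v)
     - X (Suc k) \<odot> (X k \<odot> v) + X (Suc k) \<odot> (X (Suc k) \<odot> v))"
proof -
  have B: "X k \<odot> v \<in> B" "X (Suc k) \<odot> v \<in> B" using v k by (auto intro: B_mul X_in_B Suc_lessD)
  have "phi k (phi k v) = s k \<odot> (phi k (X (Suc k) \<odot> v) - phi k (X k \<odot> v)) + phi k v"
    unfolding phi_def[of k "phi k v"] by (simp add: X_phi X_Suc_phi v)
  also have "\<dots> = v - (X k \<odot> (X k \<odot> v) - X k \<odot> (X (Suc k) \<odot> v)
     - X (Suc k) \<odot> (X k \<odot> v) + X (Suc k) \<odot> (X (Suc k) \<odot> v))"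
    using B v k by (simp add: phi_def mul_distribs s_s B_mul X_in_B)
  finally show ?thesis .
qed

end


section \<open>Eigenvector decompositions for elements with integer eigenvalues\<close>

definition poly_op :: "'v \<Rightarrow> int list \<Rightarrow> 'v \<Rightarrow> 'v" where
  "poly_op Y cs v = foldr (\<lambda>c u. Y \<odot> u - of_int c *s u) cs v"

lemma poly_op_Nil [simp]: "poly_op Y [] v = v"
  and poly_op_Cons [simp]: "poly_op Y (c # cs) v = Y \<odot> poly_op Y cs v - of_int c *s poly_op Y cs v"
  by (simp_all add: poly_op_def)

lemma poly_op_0 [simp]: "poly_op Y cs 0 = 0"
  by (induction cs) auto

lemma poly_op_add: "poly_op Y cs (u + v) = poly_op Y cs u + poly_op Y cs v"
  by (induction cs) (auto simp: mul_distribs scale_right_distrib)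

lemma poly_op_scale: "poly_op Y cs (r *s v) = r *s poly_op Y cs v"
  by (induction cs) (auto simp: scale_right_diff_distrib scale_left_commute)

lemma poly_op_diff: "poly_op Y cs (u - v) = poly_op Y cs u - poly_op Y cs v"
  by (induction cs) (auto simp: mul_distribs scale_right_diff_distrib)

lemma poly_op_sum: "poly_op Y cs (sum f I) = (\<Sum>i\<in>I. poly_op Y cs (f i))"
  by (induction I rule: infinite_finite_induct) (auto simp: poly_op_add)

lemma poly_op_mul: "poly_op Y cs (v \<odot> w) = poly_op Y cs v \<odot> w"
  by (induction cs) (auto simp: mul_distribs mul_assoc)

lemma poly_op_shift: "poly_op Y cs (Y \<odot> v) = Y \<odot> poly_op Y cs v"
  by (induction cs) (auto simp: mul_distribs)

lemma poly_op_commute: "poly_op Y cs (poly_op Y ds v) = poly_op Y ds (poly_op Y cs v)"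
  by (induction ds) (auto simp: poly_op_diff poly_op_shift poly_op_scale)

lemma poly_op_eigen:
  assumes "Y \<odot> v = of_int c *s v" "c \<in> set cs"
  shows "poly_op Y cs v = 0"
proof -
  have 1: "Y \<odot> poly_op Y cs v = of_int c *s poly_op Y cs v" for cs
    using assms(1) by (metis poly_op_shift poly_op_scale)
  show ?thesis using assms(2)
    by (induction cs) (auto simp: 1)
qed

lemma poly_op_in_B: "Y \<in> B \<Longrightarrow> v \<in> B \<Longrightarrow> poly_op Y cs v \<in> B"
  by (induction cs) (auto intro: B_diff B_mul B_scale)

lemma poly_op_rational:
  "Y \<in> rational_elements \<Longrightarrow> v \<in> rational_elements \<Longrightarrow> poly_op Y cs v \<in> rational_elements"
  by (induction cs) (auto intro!: rational_diff rational_mul rational_elements.scale)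

lemma poly_op_one_commute: "Y \<in> B \<Longrightarrow> poly_op Y cs one \<odot> Y = Y \<odot> poly_op Y cs one"
  by (metis mul_one one_mul poly_op_mul poly_op_shift)

lemma star_poly_op: "Y \<in> B \<Longrightarrow> star Y = Y \<Longrightarrow> star (poly_op Y cs one) = poly_op Y cs one"
  by (induction cs) (auto simp: star_one star_diff star_mul star_scale poly_op_one_commute)

lemma poly_op_intertwine:
  assumes "\<And>u. u \<in> B \<Longrightarrow> Y \<odot> T u = T (Y' \<odot> u)" "Y' \<in> B" "v \<in> B"
    "\<And>u w c. u \<in> B \<Longrightarrow> w \<in> B \<Longrightarrow> T (u - c *s w) = T u - c *s T w"
  shows "poly_op Y cs (T v) = T (poly_op Y' cs v)"
  by (induction cs) (auto simp: assms poly_op_in_B B_mul)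

text \<open>Subtracting \<open>d\<close> from \<open>Y\<close> acts on the part of \<open>v\<close>
  with eigenvalue \<open>c\<close> as \<open>c - d\<close>. Dividing the components of the resulting
  vector \<open>u\<close> by these nonzero integers recovers all parts of \<open>v\<close> except
  the one for \<open>d\<close>, which is the remainder. The set \<open>W\<close> lets the components
  inherit rationality and earlier eigenvalues.\<close>

lemma eigen_decomposition:
  assumes "distinct cs" "poly_op Y cs v = 0" "v \<in> W"
    and W: "0 \<in> W" "\<And>a b. a \<in> W \<Longrightarrow> b \<in> W \<Longrightarrow> a + b \<in> W"
      "\<And>r a. r \<in> \<rat> \<Longrightarrow> a \<in> W \<Longrightarrow> r *s a \<in> W" "\<And>a. a \<in> W \<Longrightarrow> Y \<odot> a \<in> W"
  shows "\<exists>w. (\<forall>c\<in>set cs. w c \<in> W \<and> Y \<odot> w c = of_int c *s w c) \<and> v = (\<Sum>c\<in>set cs. w c)"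
  using assms(1-3)
proof (induction cs arbitrary: v)
  case Nil then show ?case by simp
next
  case (Cons d cs)
  have Wd: "a - b \<in> W" if "a \<in> W" "b \<in> W" for a b
    using W(2)[OF that(1) W(3)[of "-1" b]] that by simp
  have Ws: "sum f I \<in> W" if "\<And>i. i \<in> I \<Longrightarrow> f i \<in> W" for f :: "int \<Rightarrow> 'v" and I
    using that by (induction I rule: infinite_finite_induct) (auto intro: W)
  define u where "u = Y \<odot> v - of_int d *s v"
  have "poly_op Y cs u = 0"
    using Cons.prems(2) by (simp add: u_def poly_op_diff poly_op_shift poly_op_scale)
  moreover have "u \<in> W" using Cons.prems(3) by (auto simp: u_def intro!: Wd W)
  ultimately obtain w where w: "\<And>c. c \<in> set cs \<Longrightarrow> w c \<in> W"
      "\<And>c. c \<in> set cs \<Longrightarrow> Y \<odot> w c = of_int c *s w c" "u = (\<Sum>c\<in>set cs. w c)"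
    using Cons.IH Cons.prems(1) by auto
  have dn: "d \<notin> set cs" using Cons.prems(1) by simp
  define w' where "w' c = inverse (of_int (c - d)) *s w c" for c
  define vd where "vd = v - (\<Sum>c\<in>set cs. w' c)"
  have w'W: "w' c \<in> W" if "c \<in> set cs" for c
    unfolding w'_def using w(1)[OF that] by (intro W) auto
  have w'e: "Y \<odot> w' c = of_int c *s w' c" if "c \<in> set cs" for c
    using w(2)[OF that] by (simp add: w'_def mult.commute)
  have "Y \<odot> vd - of_int d *s vd = u - (\<Sum>c\<in>set cs. of_int c *s w' c - of_int d *s w' c)"
    by (simp add: vd_def u_def mul_distribs mul_sum scale_right_diff_distrib scale_sum_right w'e
        sum_subtractf cong: sum.cong)
  also have "(\<Sum>c\<in>set cs. of_int c *s w' c - of_int d *s w' c) = (\<Sum>c\<in>set cs. w c)"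
  proof (intro sum.cong refl)
    fix c assume "c \<in> set cs"
    then have "(of_int (c - d) :: 'a) \<noteq> 0" using dn by (auto simp del: of_int_diff)
    then have "of_int (c - d) *s w' c = w c" by (simp add: w'_def del: of_int_diff)
    then show "of_int c *s w' c - of_int d *s w' c = w c" by (simp add: scale_left_diff_distrib)
  qed
  finally have vd: "Y \<odot> vd = of_int d *s vd" using w(3) by simp
  have vdW: "vd \<in> W" unfolding vd_def using Cons.prems(3) w'W by (intro Wd Ws) auto
  show ?case
  proof (intro exI conjI ballI)
    fix c assume "c \<in> set (d # cs)"
    then show "(w'(d := vd)) c \<in> W" "Y \<odot> (w'(d := vd)) c = of_int c *s (w'(d := vd)) c"
      using vd vdW w'W w'e by auto
  next
    have "(\<Sum>c\<in>set cs. (w'(d := vd)) c) = (\<Sum>c\<in>set cs. w' c)"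
      using dn by (intro sum.cong) auto
    then show "v = (\<Sum>c\<in>set (d # cs). (w'(d := vd)) c)"
      using dn by (simp add: vd_def)
  qed
qed

text \<open>Take the component of \<open>one\<close> with eigenvalue \<open>a\<close> of
  \<open>X k\<close>. On it, \<open>phi k\<close> applied twice is minus the polynomial in
  \<open>X (Suc k)\<close> with roots \<open>a + 1\<close> and \<open>a - 1\<close>. The inductive
  polynomial in \<open>X (Suc k)\<close> moves past an intertwiner, becomes a polynomial in
  \<open>X k\<close> and gives zero. Both sets of roots lie in the wider range, so the claimed
  polynomial annihilates \<open>one\<close> when applied twice, and positivity removes the
  multiplicity.\<close>

lemma X_annihilated: "k < n \<Longrightarrow> poly_op (X k) [- int k..int k] one = 0"
proof (induction k)
  case 0 then show ?case by (simp add: X_def)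
next
  case (Suc k)
  let ?X = "X k" and ?Y = "X (Suc k)" and ?C = "[- int k..int k]" and ?C' = "[- int (Suc k)..int (Suc k)]"
  have k: "Suc k < n" "k < n" using Suc by auto
  have XB: "?X \<in> B" "?Y \<in> B" and XQ: "?X \<in> rational_elements" "?Y \<in> rational_elements"
    using k X_in_B X_rational by auto
  have ann: "poly_op ?X ?C u = 0" if "u \<in> B" for u
    using Suc.IH[OF k(2)] poly_op_mul[of ?X ?C one u] one_mul[OF that] by simp
  have phi_lin: "phi k (u - c *s w) = phi k u - c *s phi k w" for u w c
    by (simp add: phi_def mul_distribs algebra_simps)
  have "\<exists>w. (\<forall>a\<in>set ?C. w a \<in> rational_elements \<and> ?X \<odot> w a = of_int a *s w a) \<and>
      one = (\<Sum>a\<in>set ?C. w a)"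
    by (intro eigen_decomposition Suc.IH[OF k(2)] rational_elements.intros rational_one rational_mul XQ) auto
  then obtain w where w: "\<And>a. a \<in> set ?C \<Longrightarrow> w a \<in> rational_elements"
      "\<And>a. a \<in> set ?C \<Longrightarrow> ?X \<odot> w a = of_int a *s w a" "one = (\<Sum>a\<in>set ?C. w a)"
    by blast
  \<comment> \<open>A vector killed by some polynomial with distinct roots in the range is a sum of
    eigenvectors, hence killed by the full polynomial.\<close>
  have kill: "poly_op ?Y ?C' u = 0" if h: "poly_op ?Y cs u = 0" "distinct cs" "set cs \<subseteq> set ?C'" for cs u
  proof -
    obtain y where y: "\<And>c. c \<in> set cs \<Longrightarrow> ?Y \<odot> y c = of_int c *s y c" "u = (\<Sum>c\<in>set cs. y c)"
      using eigen_decomposition[of cs ?Y u UNIV] h by auto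
    have "poly_op ?Y ?C' (y c) = 0" if "c \<in> set cs" for c
      using y(1)[OF that] \<open>c \<in> set cs\<close> \<open>set cs \<subseteq> set ?C'\<close> by (intro poly_op_eigen) auto
    then show ?thesis by (simp add: y(2) poly_op_sum)
  qed
  have "poly_op ?Y ?C' (poly_op ?Y ?C' (w a)) = 0" if a: "a \<in> set ?C" for a
  proof -
    let ?v = "w a"
    have vB: "?v \<in> B" using w(1)[OF a] rational_in_B by auto
    have "poly_op ?Y ?C (phi k (phi k ?v)) = phi k (poly_op ?X ?C (phi k ?v))"
      using vB XB k by (intro poly_op_intertwine phi_lin X_Suc_phi phi_in_B) auto
    also have "\<dots> = 0" using ann[OF phi_in_B[OF k(1) vB]] phi_0[OF k(1)] by simp
    also have "phi k (phi k ?v) = - poly_op ?Y [a + 1, a - 1] ?v"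
      using phi_phi[OF k(1) vB] XX[OF k(1), of ?v] w(2)[OF a]
      by (simp add: mul_distribs algebra_simps)
    finally have "poly_op ?Y ?C (poly_op ?Y [a + 1, a - 1] ?v) = 0"
      using poly_op_diff[of ?Y ?C 0 "poly_op ?Y [a + 1, a - 1] ?v"] by (simp del: poly_op_Cons)
    then have "poly_op ?Y ?C' (poly_op ?Y [a + 1, a - 1] ?v) = 0"
      by (rule kill) auto
    then have "poly_op ?Y [a + 1, a - 1] (poly_op ?Y ?C' ?v) = 0"
      using poly_op_commute by metis
    then show ?thesis by (rule kill) (use a in auto)
  qed
  then have 0: "poly_op ?Y ?C' (poly_op ?Y ?C' one) = 0"
    unfolding w(3) poly_op_sum by simp
  let ?u = "poly_op ?Y ?C' one"
  \<comment> \<open>Self-adjointness turns this product into the polynomial applied twice to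
    \<open>one\<close>.\<close>
  have "?u \<odot> star ?u = poly_op ?Y ?C' (one \<odot> ?u)"
    using star_poly_op[OF XB(2) star_X[OF k(1)]] by (simp add: poly_op_mul)
  also have "\<dots> = 0" using one_mul[OF poly_op_in_B[OF XB(2) one_in_B]] 0 by simp
  finally show ?case
    by (rule rational_mul_star_zero[rotated]) (intro poly_op_rational XQ rational_one)
qed

text \<open>The components of \<open>one\<close> are refined by one \<open>X k\<close> at a time;
  the \<open>X j\<close> commute, so earlier eigenvalues persist. Weights are normalised to zero
  from \<open>k\<close> on, which makes their extension by a new value at \<open>k\<close>
  injective.\<close>

lemma joint_eigen_decomposition:
  "k \<le> n \<Longrightarrow> \<exists>\<Lambda> e. finite \<Lambda> \<and> (\<forall>\<alpha>\<in>\<Lambda>. \<forall>j\<ge>k. \<alpha> j = (0::int)) \<and> one = (\<Sum>\<alpha>\<in>\<Lambda>. e \<alpha>) \<and>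
     (\<forall>\<alpha>\<in>\<Lambda>. e \<alpha> \<in> rational_elements \<and> (\<forall>j<k. X j \<odot> e \<alpha> = of_int (\<alpha> j) *s e \<alpha>))"
proof (induction k)
  case 0
  show ?case by (intro exI[of _ "{\<lambda>_. 0}"] exI[of _ "\<lambda>_. one"]) (simp add: rational_one)
next
  case (Suc k)
  then obtain \<Lambda> e where L: "finite \<Lambda>" "\<And>\<alpha> j. \<alpha> \<in> \<Lambda> \<Longrightarrow> j \<ge> k \<Longrightarrow> \<alpha> j = (0::int)"
    "one = (\<Sum>\<alpha>\<in>\<Lambda>. e \<alpha>)" "\<And>\<alpha>. \<alpha> \<in> \<Lambda> \<Longrightarrow> e \<alpha> \<in> rational_elements"
    "\<And>\<alpha> j. \<alpha> \<in> \<Lambda> \<Longrightarrow> j < k \<Longrightarrow> X j \<odot> e \<alpha> = of_int (\<alpha> j) *s e \<alpha>"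
    by auto
  have k: "k < n" using Suc by simp
  let ?C = "[- int k..int k]"
  define W where "W \<alpha> = {u \<in> rational_elements. \<forall>j<k. X j \<odot> u = of_int (\<alpha> j) *s u}" for \<alpha> :: "nat \<Rightarrow> int"
  have "\<forall>\<alpha>\<in>\<Lambda>. \<exists>w. (\<forall>c\<in>set ?C. w c \<in> W \<alpha> \<and> X k \<odot> w c = of_int c *s w c) \<and> e \<alpha> = (\<Sum>c\<in>set ?C. w c)"
  proof (intro ballI eigen_decomposition)
    fix \<alpha> assume a: "\<alpha> \<in> \<Lambda>"
    have "poly_op (X k) ?C (one \<odot> e \<alpha>) = 0"
      using X_annihilated[OF k] by (simp add: poly_op_mul)
    then show "poly_op (X k) ?C (e \<alpha>) = 0" using one_mul[OF rational_in_B[OF L(4)[OF a]]] by simp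
    show "e \<alpha> \<in> W \<alpha>" using L a by (simp add: W_def)
    show "0 \<in> W \<alpha>" by (simp add: W_def rational_elements.zero)
    show "a + b \<in> W \<alpha>" if "a \<in> W \<alpha>" "b \<in> W \<alpha>" for a b
      using that by (simp add: W_def rational_elements.add mul_add scale_right_distrib)
    show "r *s a \<in> W \<alpha>" if "r \<in> \<rat>" "a \<in> W \<alpha>" for r a
      using that by (simp add: W_def rational_elements.scale mult.commute)
    show "X k \<odot> a \<in> W \<alpha>" if "a \<in> W \<alpha>" for a
    proof -
      have "X j \<odot> (X k \<odot> a) = of_int (\<alpha> j) *s (X k \<odot> a)" if "j < k" for j
      proof -
        have "X j \<odot> (X k \<odot> a) = X k \<odot> (X j \<odot> a)"
          using X_commute[of j k] that k by (simp flip: mul_assoc)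
        then show ?thesis using \<open>a \<in> W \<alpha>\<close> that by (simp add: W_def)
      qed
      then show ?thesis using that X_rational[OF k] by (simp add: W_def rational_mul)
    qed
  qed simp
  from bchoice[OF this] obtain w where w:
    "\<And>\<alpha> c. \<alpha> \<in> \<Lambda> \<Longrightarrow> c \<in> set ?C \<Longrightarrow> w \<alpha> c \<in> W \<alpha> \<and> X k \<odot> w \<alpha> c = of_int c *s w \<alpha> c"
    "\<And>\<alpha>. \<alpha> \<in> \<Lambda> \<Longrightarrow> e \<alpha> = (\<Sum>c\<in>set ?C. w \<alpha> c)" by blast
  define h where "h = (\<lambda>(\<alpha>, c). \<alpha>(k := c) :: nat \<Rightarrow> int)"
  define e' where "e' \<beta> = w (\<beta>(k := 0)) (\<beta> k)" for \<beta> :: "nat \<Rightarrow> int"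
  have ak: "\<alpha>(k := 0) = \<alpha>" if "\<alpha> \<in> \<Lambda>" for \<alpha> using L(2)[OF that] by auto
  have e'h: "e' (h (\<alpha>, c)) = w \<alpha> c" if "\<alpha> \<in> \<Lambda>" for \<alpha> c using ak[OF that] by (simp add: e'_def h_def)
  have inj: "inj_on h (\<Lambda> \<times> set ?C)"
  proof (rule inj_onI, clarify)
    fix \<alpha> c \<beta> d assume ab: "\<alpha> \<in> \<Lambda>" "\<beta> \<in> \<Lambda>" and eq: "h (\<alpha>, c) = h (\<beta>, d)"
    have "(h (\<alpha>, c))(k := 0) = (h (\<beta>, d))(k := 0)" using eq by simp
    then have "\<alpha> = \<beta>" using ak[OF ab(1)] ak[OF ab(2)] by (simp add: h_def)
    moreover have "c = d" using fun_cong[OF eq, of k] by (simp add: h_def)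
    ultimately show "\<alpha> = \<beta> \<and> c = d" by simp
  qed
  show ?case
  proof (intro exI conjI ballI allI impI)
    show "finite (h ` (\<Lambda> \<times> set ?C))" using L(1) by blast
    have "one = (\<Sum>\<alpha>\<in>\<Lambda>. \<Sum>c\<in>set ?C. w \<alpha> c)" using L(3) w(2) by simp
    also have "\<dots> = (\<Sum>p\<in>\<Lambda> \<times> set ?C. w (fst p) (snd p))" by (simp add: sum.cartesian_product case_prod_beta)
    also have "\<dots> = (\<Sum>p\<in>\<Lambda> \<times> set ?C. e' (h p))" by (intro sum.cong) (auto simp: e'h)
    also have "\<dots> = (\<Sum>\<beta>\<in>h ` (\<Lambda> \<times> set ?C). e' \<beta>)" by (simp only: sum.reindex[OF inj] o_def)
    finally show "one = (\<Sum>\<beta>\<in>h ` (\<Lambda> \<times> set ?C). e' \<beta>)" .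
    fix \<beta> assume "\<beta> \<in> h ` (\<Lambda> \<times> set ?C)"
    then obtain \<alpha> c where ac: "\<alpha> \<in> \<Lambda>" "c \<in> set ?C" "\<beta> = h (\<alpha>, c)" by auto
    show "\<beta> j = 0" if "j \<ge> Suc k" for j using L(2)[OF ac(1), of j] that by (simp add: ac(3) h_def)
    show "e' \<beta> \<in> rational_elements" using w(1)[OF ac(1,2)] by (simp add: ac(3) e'h[OF ac(1)] W_def)
    show "X j \<odot> e' \<beta> = of_int (\<beta> j) *s e' \<beta>" if "j < Suc k" for j
      using w(1)[OF ac(1,2)] that unfolding ac(3) e'h[OF ac(1)]
      by (cases "j = k") (auto simp: W_def h_def)
  qed
qed

text \<open>These are Young's seminormal idempotents. The members of \<open>\<Lambda>\<close> are
  the content vectors of standard tableaux, here known only as the joint eigenvalues that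
  occur.\<close>

definition jm_decomposition :: "(nat \<Rightarrow> int) set \<Rightarrow> ((nat \<Rightarrow> int) \<Rightarrow> 'v) \<Rightarrow> bool" where
  "jm_decomposition \<Lambda> e \<longleftrightarrow> finite \<Lambda> \<and> one = (\<Sum>\<alpha>\<in>\<Lambda>. e \<alpha>) \<and>
     (\<forall>\<alpha>\<in>\<Lambda>. e \<alpha> \<in> rational_elements \<and> e \<alpha> \<noteq> 0 \<and> star (e \<alpha>) = e \<alpha> \<and> e \<alpha> \<odot> e \<alpha> = e \<alpha> \<and>
       (\<forall>j<n. X j \<odot> e \<alpha> = of_int (\<alpha> j) *s e \<alpha> \<and> e \<alpha> \<odot> X j = of_int (\<alpha> j) *s e \<alpha>))"

text \<open>Eigenvectors of the self-adjoint \<open>X j\<close> for different weights are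
  orthogonal: \<open>star (e \<beta>) \<odot> e \<alpha> = 0\<close>. Multiplying the expansion of
  \<open>star one\<close> by \<open>e \<alpha>\<close> therefore leaves
  \<open>star (e \<alpha>) \<odot> e \<alpha> = e \<alpha>\<close>, so \<open>e \<alpha>\<close> is
  self-adjoint and then idempotent.\<close>

lemma exists_jm_decomposition: "\<exists>\<Lambda> e. jm_decomposition \<Lambda> e"
proof -
  obtain \<Lambda> e where L: "finite \<Lambda>" "\<And>\<alpha> j. \<alpha> \<in> \<Lambda> \<Longrightarrow> j \<ge> n \<Longrightarrow> \<alpha> j = (0::int)"
    "one = (\<Sum>\<alpha>\<in>\<Lambda>. e \<alpha>)" "\<And>\<alpha>. \<alpha> \<in> \<Lambda> \<Longrightarrow> e \<alpha> \<in> rational_elements"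
    "\<And>\<alpha> j. \<alpha> \<in> \<Lambda> \<Longrightarrow> j < n \<Longrightarrow> X j \<odot> e \<alpha> = of_int (\<alpha> j) *s e \<alpha>"
    using joint_eigen_decomposition[of n] by auto
  have eB: "e \<alpha> \<in> B" if "\<alpha> \<in> \<Lambda>" for \<alpha> using L(4)[OF that] rational_in_B by auto
  have sX: "star (e \<alpha>) \<odot> X j = of_int (\<alpha> j) *s star (e \<alpha>)" if "\<alpha> \<in> \<Lambda>" "j < n" for \<alpha> j
    using arg_cong[OF L(5)[OF that], of star] that by (simp add: star_mul star_scale star_X)
  have orth: "star (e \<beta>) \<odot> e \<alpha> = 0" if ab: "\<alpha> \<in> \<Lambda>" "\<beta> \<in> \<Lambda>" "\<beta> \<noteq> \<alpha>" for \<alpha> \<beta>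
  proof -
    obtain j where j: "\<beta> j \<noteq> \<alpha> j" using ab(3) by auto
    then have jn: "j < n" using L(2) ab by (metis not_le)
    have "of_int (\<beta> j) *s (star (e \<beta>) \<odot> e \<alpha>) = star (e \<beta>) \<odot> (X j \<odot> e \<alpha>)"
      using sX[OF ab(2) jn] by (simp flip: mul_assoc)
    also have "\<dots> = of_int (\<alpha> j) *s (star (e \<beta>) \<odot> e \<alpha>)" using L(5)[OF ab(1) jn] by simp
    finally show ?thesis using j by (simp add: scale_cancel_right)
  qed
  have sq: "star (e \<alpha>) \<odot> e \<alpha> = e \<alpha>" if "\<alpha> \<in> \<Lambda>" for \<alpha>
  proof -
    have "e \<alpha> = star one \<odot> e \<alpha>" using one_mul[OF eB[OF that]] star_one by simp
    also have "\<dots> = (\<Sum>\<beta>\<in>\<Lambda>. star (e \<beta>) \<odot> e \<alpha>)" by (simp add: L(3) star_sum sum_mul)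
    also have "\<dots> = (\<Sum>\<beta>\<in>\<Lambda>. if \<beta> = \<alpha> then star (e \<alpha>) \<odot> e \<alpha> else 0)"
      by (rule sum.cong) (use orth that in auto)
    also have "\<dots> = star (e \<alpha>) \<odot> e \<alpha>" using that L(1) by (simp add: sum.delta)
    finally show ?thesis by simp
  qed
  have st: "star (e \<alpha>) = e \<alpha>" if "\<alpha> \<in> \<Lambda>" for \<alpha>
  proof -
    have "star (star (e \<alpha>) \<odot> e \<alpha>) = star (e \<alpha>) \<odot> e \<alpha>" by (simp add: star_mul star_star[OF eB[OF that]])
    then show ?thesis using sq[OF that] by simp
  qed
  show ?thesis
  proof (intro exI[of _ "{\<alpha> \<in> \<Lambda>. e \<alpha> \<noteq> 0}"] exI[of _ e])
    have "(\<Sum>\<alpha>\<in>\<Lambda>. e \<alpha>) = (\<Sum>\<alpha>\<in>{\<alpha> \<in> \<Lambda>. e \<alpha> \<noteq> 0}. e \<alpha>)"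
      using L(1) by (intro sum.mono_neutral_right) auto
    then show "jm_decomposition {\<alpha> \<in> \<Lambda>. e \<alpha> \<noteq> 0} e"
      using L st sq sX unfolding jm_decomposition_def by auto
  qed
qed

lemma jm_decompositionD:
  assumes "jm_decomposition \<Lambda> e"
  shows "finite \<Lambda>" "one = (\<Sum>\<alpha>\<in>\<Lambda>. e \<alpha>)"
    "\<alpha> \<in> \<Lambda> \<Longrightarrow> e \<alpha> \<in> rational_elements" "\<alpha> \<in> \<Lambda> \<Longrightarrow> e \<alpha> \<in> B"
    "\<alpha> \<in> \<Lambda> \<Longrightarrow> e \<alpha> \<noteq> 0" "\<alpha> \<in> \<Lambda> \<Longrightarrow> star (e \<alpha>) = e \<alpha>" "\<alpha> \<in> \<Lambda> \<Longrightarrow> e \<alpha> \<odot> e \<alpha> = e \<alpha>"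
    "\<alpha> \<in> \<Lambda> \<Longrightarrow> j < n \<Longrightarrow> X j \<odot> e \<alpha> = of_int (\<alpha> j) *s e \<alpha>"
    "\<alpha> \<in> \<Lambda> \<Longrightarrow> j < n \<Longrightarrow> e \<alpha> \<odot> X j = of_int (\<alpha> j) *s e \<alpha>"
  using assms rational_in_B unfolding jm_decomposition_def by auto

section \<open>Weight vectors under the intertwiners\<close>

definition weight :: "(nat \<Rightarrow> int) \<Rightarrow> 'v \<Rightarrow> bool" where
  "weight \<beta> v \<longleftrightarrow> v \<in> B \<and> (\<forall>j<n. X j \<odot> v = of_int (\<beta> j) *s v)"

lemma weight_phi:
  assumes k: "Suc k < n" and w: "weight \<beta> v"
  shows "weight (\<beta> \<circ> transpose k (Suc k)) (phi k v)"
  unfolding weight_def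
proof (intro conjI allI impI)
  have vB: "v \<in> B" and ev: "\<And>j. j < n \<Longrightarrow> X j \<odot> v = of_int (\<beta> j) *s v" using w by (auto simp: weight_def)
  have sc: "phi k (r *s v) = r *s phi k v" for r
    by (simp add: phi_def scale_right_distrib scale_right_diff_distrib mul_distribs)
  show "phi k v \<in> B" using phi_in_B[OF k vB] .
  fix j assume j: "j < n"
  show "X j \<odot> phi k v = of_int ((\<beta> \<circ> transpose k (Suc k)) j) *s phi k v"
  proof -
    consider "j = k" | "j = Suc k" | "j \<noteq> k" "j \<noteq> Suc k" by blast
    then show ?thesis
    proof cases
      case 1 then show ?thesis using X_phi[OF k vB] ev[OF k] sc by simp
    next
      case 2 then show ?thesis using X_Suc_phi[OF k vB] ev[of k] sc k by simp
    next
      case 3 then show ?thesis using X_other_phi[OF k j 3] ev[OF j] sc by simp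
    qed
  qed
qed

lemma weight_phi_eq:
  assumes k: "Suc k < n" and w: "weight \<beta> v"
  shows "phi k v = of_int (\<beta> k - \<beta> (Suc k)) *s (s k \<odot> v) + v"
  using assms by (simp add: weight_def phi_def mul_distribs scale_left_diff_distrib)

context
  fixes \<Lambda> e assumes jm: "jm_decomposition \<Lambda> e"
begin

lemmas jmD = jm_decompositionD[OF jm]

lemma idem_mul_weight: 
  assumes "\<alpha> \<in> \<Lambda>" "weight \<beta> v" "j < n" "\<alpha> j \<noteq> \<beta> j"
  shows "e \<alpha> \<odot> v = 0"
proof -
  have "of_int (\<alpha> j) *s (e \<alpha> \<odot> v) = e \<alpha> \<odot> (X j \<odot> v)"
    using jmD(9)[OF assms(1,3)] by (simp flip: mul_assoc)
  also have "\<dots> = of_int (\<beta> j) *s (e \<alpha> \<odot> v)" using assms by (simp add: weight_def)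
  finally show ?thesis using assms(4) by (simp add: scale_cancel_right)
qed

lemma sum_idem_mul: "v \<in> B \<Longrightarrow> (\<Sum>\<alpha>\<in>\<Lambda>. e \<alpha> \<odot> v) = v"
  using one_mul[of v] by (simp add: jmD(2) sum_mul)

text \<open>For equal values, \<open>X k \<odot> (s k \<odot> e \<alpha>)\<close> differs from
  \<open>\<alpha> k\<close> times \<open>s k \<odot> e \<alpha>\<close> exactly by
  \<open>e \<alpha>\<close>. Multiplication by \<open>e \<alpha>\<close> from the left makes the
  difference zero, so the idempotent would vanish.\<close>

lemma weights_adjacent_distinct:
  assumes "\<alpha> \<in> \<Lambda>" and k: "Suc k < n"
  shows "\<alpha> k \<noteq> \<alpha> (Suc k)"
proof
  assume eq: "\<alpha> k = \<alpha> (Suc k)"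
  let ?v = "e \<alpha>"
  have vB: "?v \<in> B" using jmD(4)[OF assms(1)] .
  have "X k \<odot> (s k \<odot> ?v) = of_int (\<alpha> k) *s (s k \<odot> ?v) - ?v"
    using s_X_Suc[OF k vB] jmD(8)[OF assms(1) k] eq by (simp add: eq_diff_eq)
  then have "?v \<odot> (X k \<odot> (s k \<odot> ?v)) = ?v \<odot> (of_int (\<alpha> k) *s (s k \<odot> ?v) - ?v)" by simp
  moreover have "?v \<odot> (X k \<odot> (s k \<odot> ?v)) = of_int (\<alpha> k) *s (?v \<odot> (s k \<odot> ?v))"
    using mul_absorb[OF jmD(9)[OF assms(1), of k]] k by simp
  ultimately have "?v \<odot> ?v = 0" by (simp add: mul_diff)
  then show False using jmD(5,7)[OF assms(1)] by simp
qed

text \<open>Every \<open>e \<alpha>\<close> kills \<open>v\<close>, because no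
  \<open>\<alpha>\<close> in \<open>\<Lambda>\<close> takes equal values at \<open>k\<close> and
  \<open>Suc k\<close>; and the \<open>e \<alpha>\<close> sum to \<open>one\<close>.\<close>

lemma weight_adjacent_zero:
  assumes "weight \<beta> v" "Suc k < n" "\<beta> k = \<beta> (Suc k)"
  shows "v = 0"
proof -
  have "e \<alpha> \<odot> v = 0" if "\<alpha> \<in> \<Lambda>" for \<alpha>
  proof -
    have "\<alpha> k \<noteq> \<beta> k \<or> \<alpha> (Suc k) \<noteq> \<beta> (Suc k)"
      using weights_adjacent_distinct[OF that assms(2)] assms(3) by auto
    then show ?thesis using idem_mul_weight[OF that assms(1), of k]
        idem_mul_weight[OF that assms(1), of "Suc k"] assms(2) by auto
  qed
  then show ?thesis using sum_idem_mul[of v] assms(1) by (simp add: weight_def)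
qed

end

section \<open>Words in the adjacent transpositions and their triangularity\<close>

definition valid_word :: "nat list \<Rightarrow> bool" where
  "valid_word ks \<longleftrightarrow> (\<forall>k\<in>set ks. Suc k < n)"

definition word_perm :: "nat list \<Rightarrow> nat \<Rightarrow> nat" where
  "word_perm ks = foldr (\<lambda>k w. transpose k (Suc k) \<circ> w) ks id"

definition s_word :: "nat list \<Rightarrow> 'v \<Rightarrow> 'v" where
  "s_word ks v = foldr (\<lambda>k u. s k \<odot> u) ks v"

definition phi_word :: "nat list \<Rightarrow> 'v \<Rightarrow> 'v" where
  "phi_word ks v = foldr phi ks v"

lemma word_simps [simp]:
  "valid_word []" "valid_word (k # ks) \<longleftrightarrow> Suc k < n \<and> valid_word ks"
  "s_word [] v = v" "s_word (k # ks) v = s k \<odot> s_word ks v"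
  "phi_word [] v = v" "phi_word (k # ks) v = phi k (phi_word ks v)"
  by (auto simp: valid_word_def s_word_def phi_word_def)

lemma word_perm_Nil: "word_perm [] = id"
  and word_perm_Cons: "word_perm (k # ks) = transpose k (Suc k) \<circ> word_perm ks"
  by (auto simp: word_perm_def)

lemma word_perm_permutes: "valid_word ks \<Longrightarrow> word_perm ks permutes {..<n}"
proof (induction ks)
  case Nil show ?case unfolding word_perm_Nil by (rule permutes_id)
next
  case (Cons k ks)
  then show ?case unfolding word_perm_Cons by (intro permutes_compose transpose_perm) auto
qed

lemma s_word_eq: "valid_word ks \<Longrightarrow> v \<in> B \<Longrightarrow> s_word ks v = G (word_perm ks) \<odot> v"
proof (induction ks)
  case Nil then show ?case using one_mul[of v] unfolding word_perm_Nil by (simp add: one_def id_def)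
next
  case (Cons k ks)
  have "G (transpose k (Suc k)) \<odot> G (word_perm ks) = G (word_perm (k # ks))"
    unfolding word_perm_Cons using Cons.prems by (intro G_mul word_perm_permutes transpose_perm) auto
  then show ?case using Cons by (simp add: s_def mul_absorb)
qed

lemma word_perm_append: "word_perm (ks @ ls) = word_perm ks \<circ> word_perm ls"
  by (induction ks) (simp_all only: append.simps word_perm_Nil word_perm_Cons o_assoc id_comp)

lemma valid_word_append: "valid_word (ks @ ls) \<longleftrightarrow> valid_word ks \<and> valid_word ls"
  by (auto simp: valid_word_def)

lemma transpose_word: "a < b \<Longrightarrow> b < n \<Longrightarrow> \<exists>ks. valid_word ks \<and> word_perm ks = transpose a b"
proof (induction b)
  case (Suc b)
  show ?case
  proof (cases "a = b")
    case True
    then show ?thesis using Suc by (intro exI[of _ "[b]"]) (auto simp: word_perm_Cons word_perm_Nil)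
  next
    case False
    then obtain ks where ks: "valid_word ks" "word_perm ks = transpose a b" using Suc by auto
    have "word_perm (b # (ks @ [b])) = transpose b (Suc b) \<circ> (transpose a b \<circ> transpose b (Suc b))"
      unfolding word_perm_Cons word_perm_append word_perm_Nil ks(2) by simp
    also have "\<dots> = transpose a (Suc b)"
      using False Suc.prems by (auto simp: fun_eq_iff transpose_def)
    finally show ?thesis using ks Suc.prems
      by (intro exI[of _ "b # (ks @ [b])"] conjI) (auto simp: valid_word_append)
  qed
qed simp

lemma perm_word:
  assumes "w permutes {..<n}"
  shows "\<exists>ks. valid_word ks \<and> word_perm ks = w"
  using assms finite_lessThan[of n]
proof (induction w rule: permutes_induct)
  case id show ?case by (intro exI[of _ "[]"]) (simp add: word_perm_Nil)
next
  case (swap a b p)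
  then obtain ks where ks: "valid_word ks" "word_perm ks = p" by auto
  have "\<exists>ls. valid_word ls \<and> word_perm ls = transpose a b"
  proof (cases "a < b")
    case True then show ?thesis using transpose_word[of a b] swap by auto
  next
    case False then show ?thesis using transpose_word[of b a] swap by (auto simp: transpose_commute)
  qed
  then show ?case using ks by (metis word_perm_append valid_word_append)
qed

lemma weight_phi_word:
  "valid_word ks \<Longrightarrow> weight \<beta> v \<Longrightarrow> weight (\<beta> \<circ> inv (word_perm ks)) (phi_word ks v)"
proof (induction ks)
  case Nil then show ?case unfolding word_perm_Nil by simp
next
  case (Cons k ks)
  have "weight ((\<beta> \<circ> inv (word_perm ks)) \<circ> transpose k (Suc k)) (phi k (phi_word ks v))"
    by (intro weight_phi Cons.IH) (use Cons.prems in simp_all)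
  moreover have "inv (word_perm (k # ks)) = inv (word_perm ks) \<circ> transpose k (Suc k)"
    unfolding word_perm_Cons
    using o_inv_distrib[of "transpose k (Suc k)" "word_perm ks"]
      permutes_bij[OF word_perm_permutes, of ks] Cons.prems by simp
  ultimately show ?case by (simp only: word_simps o_assoc)
qed

text \<open>A filtration by word length, over all words and not only reduced ones. Words in the
  \<open>s k\<close> are triangular to words in the intertwiners with respect to it.\<close>

definition short_words :: "nat \<Rightarrow> 'v \<Rightarrow> 'v set" where
  "short_words N v = span {s_word ks v | ks. valid_word ks \<and> length ks < N}"

lemma subspace_short_words: "subspace (short_words N v)"
  unfolding short_words_def by (rule subspace_span)

lemma short_words_mono: "y \<in> short_words N v \<Longrightarrow> N \<le> M \<Longrightarrow> y \<in> short_words M v"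
  unfolding short_words_def by (rule set_mp[OF span_mono]) auto

lemma s_short_words:
  assumes "y \<in> short_words N v" "Suc k < n"
  shows "s k \<odot> y \<in> short_words (Suc N) v"
  using assms(1) unfolding short_words_def
proof (induction rule: span_induct_alt)
  case base show ?case by (simp add: span_zero)
next
  case (step c x y)
  then obtain ks where ks: "valid_word ks" "length ks < N" "x = s_word ks v" by auto
  have "s k \<odot> x \<in> span {s_word ks v | ks. valid_word ks \<and> length ks < Suc N}"
    using ks assms(2) by (intro span_base) (auto intro!: exI[of _ "k # ks"])
  then show ?case using step by (simp add: mul_add span_add span_scale)
qed

lemma phi_word_short:
  "valid_word ks \<Longrightarrow> weight \<beta> v \<Longrightarrow> phi_word ks v \<in> short_words (Suc (length ks)) v"
proof (induction ks)
  case Nil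
  show ?case unfolding short_words_def by (intro span_base) (auto intro!: exI[of _ "[]"])
next
  case (Cons k ks)
  have "phi_word (k # ks) v = of_int ((\<beta> \<circ> inv (word_perm ks)) k - (\<beta> \<circ> inv (word_perm ks)) (Suc k))
      *s (s k \<odot> phi_word ks v) + phi_word ks v"
    using weight_phi_eq[OF _ weight_phi_word[of ks \<beta> v], of k] Cons.prems by simp
  moreover have "s k \<odot> phi_word ks v \<in> short_words (Suc (Suc (length ks))) v"
    using Cons by (simp add: s_short_words)
  moreover have "phi_word ks v \<in> short_words (Suc (Suc (length ks))) v"
    using Cons by (auto intro: short_words_mono[of _ "Suc (length ks)"])
  ultimately show ?case
    by (simp add: subspace_add[OF subspace_short_words] subspace_scale[OF subspace_short_words]
        del: of_int_diff)
qed

text \<open>The permutation preserves each level set of \<open>\<alpha>\<close> and is increasing on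
  it. The least moved point \<open>p\<close> and its preimage \<open>q\<close> share a level set
  with \<open>p < q\<close>, but \<open>w q = p\<close> lies below \<open>w p\<close>.\<close>

lemma perm_preserving_weight_order_eq_id:
  fixes \<alpha> :: "nat \<Rightarrow> int"
  assumes w: "w permutes {..<n}" and inv: "\<And>j. j < n \<Longrightarrow> \<alpha> (inv w j) = \<alpha> j"
    and ord: "\<And>p q. p < q \<Longrightarrow> q < n \<Longrightarrow> \<alpha> p = \<alpha> q \<Longrightarrow> w p < w q"
  shows "w = id"
proof (rule ccontr)
  assume "w \<noteq> id"
  then have ex: "\<exists>p. w p \<noteq> p" by auto
  define p where "p = (LEAST p. w p \<noteq> p)"
  have p: "w p \<noteq> p" unfolding p_def by (rule LeastI_ex[OF ex])
  have below: "w q = q" if "q < p" for q using not_less_Least[of q] that unfolding p_def by auto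
  have pn: "p < n" using p w by (metis permutes_not_in lessThan_iff)
  define q where "q = inv w p"
  have wq: "w q = p" unfolding q_def using permutes_inverses(1)[OF w] by simp
  have "q \<noteq> p" using wq p by auto
  moreover have "\<not> q < p" using below wq by force
  ultimately have "p < q" by simp
  have "q < n" using wq pn permutes_in_image[OF w, of q] by simp
  have "\<not> w p < p"
  proof
    assume lt: "w p < p"
    then have "w (w p) = w p" using below by blast
    then show False using p permutes_inj[OF w] by (metis injD)
  qed
  then have "w q < w p" using p wq by simp
  moreover have "w p < w q" using ord[OF \<open>p < q\<close> \<open>q < n\<close>] inv[OF pn] by (simp add: q_def)
  ultimately show False by simp
qed

context
  fixes \<Lambda> e assumes jm: "jm_decomposition \<Lambda> e"
begin

lemmas jmD' = jm_decompositionD[OF jm]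

text \<open>On a weight vector \<open>phi k\<close> acts as \<open>c\<close> times
  \<open>s k\<close> plus the identity, and \<open>c\<close>, a difference of adjacent eigenvalues,
  is nonzero if the vector is. So \<open>s k\<close> may be traded for a multiple of
  \<open>phi k\<close> up to shorter words. If the product of intertwiners is already zero, the word
  is itself a combination of shorter ones and \<open>r = 0\<close> serves.\<close>

lemma s_word_modulo_short:
  "valid_word ks \<Longrightarrow> weight \<beta> v \<Longrightarrow>
     \<exists>r. s_word ks v - r *s phi_word ks v \<in> short_words (length ks) v"
proof (induction ks)
  case Nil
  show ?case by (intro exI[of _ 1]) (simp add: subspace_0[OF subspace_short_words])
next
  case (Cons k ks)
  then obtain r where r: "s_word ks v - r *s phi_word ks v \<in> short_words (length ks) v" by auto
  have k: "Suc k < n" and ks: "valid_word ks" using Cons.prems by auto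
  let ?y = "phi_word ks v"
  have 1: "s k \<odot> (s_word ks v - r *s ?y) \<in> short_words (Suc (length ks)) v"
    by (rule s_short_words[OF r k])
  have y: "?y \<in> short_words (Suc (length ks)) v" using phi_word_short[OF ks Cons.prems(2)] .
  show ?case
  proof (cases "?y = 0")
    case True
    then show ?thesis using 1 by (intro exI[of _ 0]) simp
  next
    case False
    let ?\<gamma> = "\<beta> \<circ> inv (word_perm ks)"
    have wt: "weight ?\<gamma> ?y" by (rule weight_phi_word[OF ks Cons.prems(2)])
    define c :: 'a where "c = of_int (?\<gamma> k - ?\<gamma> (Suc k))"
    have c0: "c \<noteq> 0" using weight_adjacent_zero[OF jm wt k] False by (auto simp: c_def simp del: of_int_diff)
    have "s k \<odot> ?y = inverse c *s (phi k ?y - ?y)"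
      using weight_phi_eq[OF k wt] c0 by (simp add: c_def del: of_int_diff)
    then have "s_word (k # ks) v - (r * inverse c) *s phi_word (k # ks) v =
        s k \<odot> (s_word ks v - r *s ?y) - (r * inverse c) *s ?y"
      by (simp add: mul_diff scale_right_diff_distrib)
    also have "\<dots> \<in> short_words (Suc (length ks)) v"
      by (intro subspace_diff[OF subspace_short_words] subspace_scale[OF subspace_short_words] 1 y)
    finally show ?thesis by auto
  qed
qed

text \<open>
  Two equal eigenvalues can never sit at adjacent positions, so a nonzero product of intertwiners
  cannot move one past the other.
\<close>

lemma phi_word_preserves_order:
  assumes "weight \<beta> v" "p < q" "q < n" "\<beta> p = \<beta> q"
  shows "valid_word ks \<Longrightarrow> phi_word ks v \<noteq> 0 \<Longrightarrow> word_perm ks p < word_perm ks q"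
proof (induction ks)
  case Nil then show ?case unfolding word_perm_Nil using assms by simp
next
  case (Cons k ks)
  have k: "Suc k < n" and ks: "valid_word ks" using Cons.prems by auto
  have y: "phi_word ks v \<noteq> 0" using Cons.prems phi_0[OF k] by auto
  let ?w = "word_perm ks"
  have lt: "?w p < ?w q" using Cons.IH ks y by simp
  have "\<not> (?w p = k \<and> ?w q = Suc k)"
  proof
    assume "?w p = k \<and> ?w q = Suc k"
    then have "inv ?w k = p" "inv ?w (Suc k) = q"
      using permutes_inverses(2)[OF word_perm_permutes[OF ks]] by metis+
    then have "phi_word ks v = 0"
      using weight_adjacent_zero[OF jm weight_phi_word[OF ks assms(1)] k] assms(4) by simp
    then show False using y by simp
  qed
  then show ?case unfolding word_perm_Cons using lt by (auto simp: transpose_def)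
qed

text \<open>Modulo shorter words the word is a multiple of a product of intertwiners, which carries
  \<open>e \<alpha>\<close> to the permuted weight. If that weight differs from
  \<open>\<alpha>\<close>, multiplication by \<open>e \<alpha>\<close> gives zero. If not, a nonzero
  product keeps equal eigenvalues in order, so its permutation is the identity, a case settled
  separately for words of any length.\<close>

lemma idem_s_word_idem:
  assumes a: "\<alpha> \<in> \<Lambda>"
  shows "valid_word ks \<Longrightarrow> \<exists>r. e \<alpha> \<odot> s_word ks (e \<alpha>) = r *s e \<alpha>"
proof (induction "length ks" arbitrary: ks rule: less_induct)
  case less
  let ?e = "e \<alpha>" and ?w = "word_perm ks"
  have eB: "?e \<in> B" using jmD'(4)[OF a] .
  have wt: "weight \<alpha> ?e" using jmD'(4,8)[OF a] by (simp add: weight_def)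
  have wp: "?w permutes {..<n}" using word_perm_permutes[OF less.prems] .
  show ?case
  proof (cases "?w = id")
    case True
    then have "s_word ks ?e = ?e"
      using s_word_eq[OF less.prems eB] one_mul[OF eB] by (simp add: one_def)
    then show ?thesis using jmD'(7)[OF a] by (intro exI[of _ 1]) simp
  next
    case False
    obtain r where r: "s_word ks ?e - r *s phi_word ks ?e \<in> short_words (length ks) ?e"
      using s_word_modulo_short[OF less.prems wt] by auto
    have "?e \<odot> phi_word ks ?e = 0"
    proof (cases "\<exists>j<n. \<alpha> j \<noteq> \<alpha> (inv ?w j)")
      case True
      then show ?thesis using idem_mul_weight[OF jm a weight_phi_word[OF less.prems wt]] by auto
    next
      case same: False
      have "phi_word ks ?e = 0"
      proof (rule ccontr)
        assume nz: "phi_word ks ?e \<noteq> 0"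
        have "?w = id"
          by (rule perm_preserving_weight_order_eq_id[OF wp, of \<alpha>])
            (use same phi_word_preserves_order[OF wt _ _ _ less.prems nz] in auto)
        then show False using False by simp
      qed
      then show ?thesis by simp
    qed
    moreover have "\<exists>r. ?e \<odot> y = r *s ?e" if "y \<in> short_words (length ks) ?e" for y
      using that unfolding short_words_def
    proof (induction rule: span_induct_alt)
      case base show ?case by (intro exI[of _ 0]) simp
    next
      case (step c x y)
      then obtain ls where ls: "valid_word ls" "length ls < length ks" "x = s_word ls ?e" by auto
      obtain r1 r2 where "?e \<odot> x = r1 *s ?e" "?e \<odot> y = r2 *s ?e"
        using less.hyps[OF ls(2,1)] ls(3) step by auto
      then show ?case by (intro exI[of _ "c * r1 + r2"]) (simp add: mul_add scale_left_distrib)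
    qed
    then obtain r' where "?e \<odot> (s_word ks ?e - r *s phi_word ks ?e) = r' *s ?e" using r by auto
    ultimately show ?thesis by (auto simp: mul_diff)
  qed
qed

lemma idem_primitive:
  assumes a: "\<alpha> \<in> \<Lambda>" and "b \<in> B"
  shows "\<exists>r. e \<alpha> \<odot> (b \<odot> e \<alpha>) = r *s e \<alpha>"
  using assms(2)
proof (induction rule: B_induct)
  case (G w)
  then obtain ks where "valid_word ks" "word_perm ks = w" using perm_word by auto
  then show ?case using idem_s_word_idem[OF a, of ks] s_word_eq[of ks "e \<alpha>"] jmD'(4)[OF a] by auto
next
  case zero show ?case by (intro exI[of _ 0]) simp
next
  case (add a b)
  then obtain r1 r2 where "e \<alpha> \<odot> (a \<odot> e \<alpha>) = r1 *s e \<alpha>" "e \<alpha> \<odot> (b \<odot> e \<alpha>) = r2 *s e \<alpha>" by auto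
  then show ?case by (intro exI[of _ "r1 + r2"]) (simp add: mul_distribs scale_left_distrib)
next
  case (scale r a)
  then obtain r1 where "e \<alpha> \<odot> (a \<odot> e \<alpha>) = r1 *s e \<alpha>" by auto
  then show ?case by (intro exI[of _ "r * r1"]) simp
qed

text \<open>Some permutation gives a nonzero
  \<open>u = e \<alpha> \<odot> (G w \<odot> e \<beta>)\<close>, and this element is rational even
  if \<open>b\<close> is not. By primitivity \<open>u \<odot> star u\<close> and
  \<open>star u \<odot> u\<close> are multiples of \<open>e \<alpha>\<close> and
  \<open>e \<beta>\<close>; positivity makes the scalars nonzero.\<close>

lemma linking_element:
  assumes ab: "\<alpha> \<in> \<Lambda>" "\<beta> \<in> \<Lambda>" and b: "b \<in> B" and nz: "e \<alpha> \<odot> (b \<odot> e \<beta>) \<noteq> 0"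
  shows "\<exists>w r r'. w permutes {..<n} \<and> r \<noteq> 0 \<and> r' \<noteq> 0 \<and>
    e \<alpha> \<odot> (G w \<odot> (e \<beta> \<odot> (G (inv w) \<odot> e \<alpha>))) = r *s e \<alpha> \<and>
    e \<beta> \<odot> (G (inv w) \<odot> (e \<alpha> \<odot> (G w \<odot> e \<beta>))) = r' *s e \<beta>"
proof -
  have "\<exists>w. w permutes {..<n} \<and> e \<alpha> \<odot> (G w \<odot> e \<beta>) \<noteq> 0"
  proof (rule ccontr)
    assume h: "\<not> (\<exists>w. w permutes {..<n} \<and> e \<alpha> \<odot> (G w \<odot> e \<beta>) \<noteq> 0)"
    have "e \<alpha> \<odot> (b \<odot> e \<beta>) = 0" using b by (induction rule: B_induct) (use h in \<open>auto simp: mul_distribs\<close>)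
    then show False using nz by simp
  qed
  then obtain w where w: "w permutes {..<n}" and u0: "e \<alpha> \<odot> (G w \<odot> e \<beta>) \<noteq> 0" by auto
  define u where "u = e \<alpha> \<odot> (G w \<odot> e \<beta>)"
  have uQ: "u \<in> rational_elements" unfolding u_def
    using jmD'(3) ab w by (intro rational_mul rational_elements.G) auto
  have su: "star u = e \<beta> \<odot> (G (inv w) \<odot> e \<alpha>)"
    using jmD'(6) ab w by (simp add: u_def star_mul star_G mul_assoc)
  have suQ: "star u \<in> rational_elements" unfolding su
    using jmD'(3) ab permutes_inv[OF w] by (intro rational_mul rational_elements.G) auto
  have su0: "star u \<noteq> 0" using star_star[OF rational_in_B[OF uQ]] u0 star_0 by (auto simp: u_def)
  have w1: "G w \<odot> (e \<beta> \<odot> G (inv w)) \<in> B" "G (inv w) \<odot> (e \<alpha> \<odot> G w) \<in> B"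
    using w permutes_inv[OF w] jmD'(4) ab by (auto intro!: B_mul G_in_B)
  have l: "u \<odot> star u = e \<alpha> \<odot> (G w \<odot> (e \<beta> \<odot> (G (inv w) \<odot> e \<alpha>)))"
    unfolding su by (simp add: u_def mul_assoc mul_absorb[OF jmD'(7)[OF ab(2)]])
  have r: "star u \<odot> u = e \<beta> \<odot> (G (inv w) \<odot> (e \<alpha> \<odot> (G w \<odot> e \<beta>)))"
    unfolding su by (simp add: u_def mul_assoc mul_absorb[OF jmD'(7)[OF ab(1)]])
  obtain r1 where r1: "u \<odot> star u = r1 *s e \<alpha>"
    using idem_primitive[OF ab(1) w1(1)] l by (auto simp: mul_assoc)
  obtain r2 where r2: "star u \<odot> u = r2 *s e \<beta>"
    using idem_primitive[OF ab(2) w1(2)] r by (auto simp: mul_assoc)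
  have "r1 \<noteq> 0" using rational_mul_star_zero[OF uQ] u0 r1 by (auto simp: u_def)
  moreover have "r2 \<noteq> 0"
    using rational_mul_star_zero[OF suQ] su0 r2 star_star[OF rational_in_B[OF uQ]] by auto
  ultimately show ?thesis using w l r r1 r2 by (intro exI[of _ w] exI[of _ r1] exI[of _ r2]) simp
qed

text \<open>A maximal pairwise unlinked set of the \<open>e \<alpha>\<close> has one member per
  block. Every other \<open>e \<alpha>\<close> is linked to a member and lies in the ideal generated
  by it, and therefore so does the sum \<open>one\<close>.\<close>

lemma exists_split_family: "\<exists>F. split_algebra B one F"
proof -
  define \<F> where "\<F> = {F. F \<subseteq> e ` \<Lambda> \<and> (\<forall>f\<in>F. \<forall>g\<in>F. f \<noteq> g \<longrightarrow> (\<forall>b\<in>B. f \<odot> (b \<odot> g) = 0))}"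
  have "finite \<F>" unfolding \<F>_def using jmD'(1) by (intro finite_subset[OF _ finite_Pow_iff[THEN iffD2, of "e ` \<Lambda>"]]) auto
  moreover have "{} \<in> \<F>" by (simp add: \<F>_def)
  ultimately obtain F where F: "F \<in> \<F>" and max: "\<And>F'. F' \<in> \<F> \<Longrightarrow> F \<subseteq> F' \<Longrightarrow> F = F'"
    using finite_has_maximal[of \<F>] by (metis empty_iff)
  have FL: "\<exists>\<beta>\<in>\<Lambda>. f = e \<beta>" if "f \<in> F" for f using F that by (auto simp: \<F>_def)
  have prim: "primitive_family B F"
    unfolding primitive_family_def
  proof (intro conjI ballI impI)
    show "finite F" using F jmD'(1) finite_subset unfolding \<F>_def by blast
    show "F \<subseteq> B" using FL jmD'(4) by auto
    fix f assume f: "f \<in> F"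
    show "f \<noteq> 0" "f \<odot> f = f" using FL[OF f] jmD'(5,7) by auto
    show "\<exists>r. f \<odot> (a \<odot> f) = r *s f" if "a \<in> B" for a using FL[OF f] idem_primitive that by auto
    show "f \<odot> (a \<odot> g) = 0" if "g \<in> F" "f \<noteq> g" "a \<in> B" for g a
      using F f that unfolding \<F>_def by blast
  qed
  have link: "e \<alpha> \<in> generated_ideal B F" if a: "\<alpha> \<in> \<Lambda>" for \<alpha>
  proof (cases "e \<alpha> \<in> F")
    case True
    then show ?thesis using generated_idealI[OF one_in_B True one_in_B] jmD'(4)[OF a] one_mul mul_one by simp
  next
    case False
    have "insert (e \<alpha>) F \<notin> \<F>" using max[of "insert (e \<alpha>) F"] False by auto
    then obtain g b where g: "g \<in> F" "b \<in> B" "e \<alpha> \<odot> (b \<odot> g) \<noteq> 0 \<or> g \<odot> (b \<odot> e \<alpha>) \<noteq> 0"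
      using F a unfolding \<F>_def by auto
    obtain \<beta> where \<beta>: "\<beta> \<in> \<Lambda>" "g = e \<beta>" using FL g by auto
    have gB: "g \<in> B" using \<beta> jmD'(4) by auto
    have "\<exists>c\<in>B. \<exists>c'\<in>B. \<exists>r. r \<noteq> 0 \<and> c \<odot> (g \<odot> c') = r *s e \<alpha>"
    proof (cases "e \<alpha> \<odot> (b \<odot> g) = 0")
      case False
      then obtain w r where "w permutes {..<n}" "r \<noteq> 0"
          "e \<alpha> \<odot> (G w \<odot> (e \<beta> \<odot> (G (inv w) \<odot> e \<alpha>))) = r *s e \<alpha>"
        using linking_element[OF a \<beta>(1) g(2)] \<beta>(2) by auto
      then show ?thesis using jmD'(4)[OF a] \<beta>(2)
        by (intro bexI[of _ "e \<alpha> \<odot> G w"] bexI[of _ "G (inv w) \<odot> e \<alpha>"] exI[of _ r])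
          (auto simp: mul_assoc intro!: B_mul G_in_B permutes_inv)
    next
      case True
      then obtain w r where "w permutes {..<n}" "r \<noteq> 0"
          "e \<alpha> \<odot> (G (inv w) \<odot> (e \<beta> \<odot> (G w \<odot> e \<alpha>))) = r *s e \<alpha>"
        using linking_element[OF \<beta>(1) a g(2)] g(3) \<beta>(2) by auto
      then show ?thesis using jmD'(4)[OF a] \<beta>(2)
        by (intro bexI[of _ "e \<alpha> \<odot> G (inv w)"] bexI[of _ "G w \<odot> e \<alpha>"] exI[of _ r])
          (auto simp: mul_assoc intro!: B_mul G_in_B permutes_inv)
    qed
    then obtain c c' r where c: "c \<in> B" "c' \<in> B" "r \<noteq> 0" "c \<odot> (g \<odot> c') = r *s e \<alpha>" by auto
    then have "inverse r *s (c \<odot> (g \<odot> c')) \<in> generated_ideal B F"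
      using g by (intro subspace_scale[OF subspace_generated_ideal] generated_idealI) auto
    then show ?thesis using c by simp
  qed
  have gen: "one \<in> generated_ideal B F"
    using link by (subst jmD'(2)) (intro subspace_sum[OF subspace_generated_ideal])
  have left: "v = 0" if f: "f \<in> F" and v: "v \<in> B" "v \<odot> f = v" "\<And>a. a \<in> B \<Longrightarrow> f \<odot> (a \<odot> v) = 0" for f v
  proof -
    obtain \<beta> where \<beta>: "\<beta> \<in> \<Lambda>" "f = e \<beta>" using FL f by auto
    have "e \<alpha> \<odot> v = 0" if a: "\<alpha> \<in> \<Lambda>" for \<alpha>
    proof (rule ccontr)
      assume nz: "e \<alpha> \<odot> v \<noteq> 0"
      then have "e \<alpha> \<odot> (v \<odot> e \<beta>) \<noteq> 0" using v \<beta> by simp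
      then obtain w r r' where w: "w permutes {..<n}" "r' \<noteq> 0"
        "e \<beta> \<odot> (G (inv w) \<odot> (e \<alpha> \<odot> (G w \<odot> e \<beta>))) = r' *s e \<beta>"
        using linking_element[OF a \<beta>(1) v(1)] by auto
      note Gs = G_in_B[OF w(1)] G_in_B[OF permutes_inv[OF w(1)]]
      have eB: "e \<alpha> \<in> B" "e \<beta> \<in> B" using jmD'(4) a \<beta> by auto
      \<comment> \<open>Primitivity of \<open>e \<alpha>\<close> makes
        \<open>e \<alpha> \<odot> v\<close> a multiple of the linking element, with factor
        \<open>t / r'\<close>; pairing with \<open>e \<beta>\<close> then forces
        \<open>t = 0\<close>.\<close>
      obtain t where t: "e \<alpha> \<odot> ((v \<odot> (e \<beta> \<odot> G (inv w))) \<odot> e \<alpha>) = t *s e \<alpha>"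
        using idem_primitive[OF a, of "v \<odot> (e \<beta> \<odot> G (inv w))"] v(1) eB Gs by (auto intro!: B_mul)
      have "r' *s (e \<alpha> \<odot> v) = e \<alpha> \<odot> (v \<odot> (r' *s e \<beta>))" using v(2) \<beta> by simp
      also have "\<dots> = e \<alpha> \<odot> (v \<odot> (e \<beta> \<odot> (G (inv w) \<odot> (e \<alpha> \<odot> (G w \<odot> e \<beta>)))))" by (simp add: w(3))
      also have "\<dots> = t *s (e \<alpha> \<odot> (G w \<odot> e \<beta>))"
        using arg_cong[OF t, of "\<lambda>y. y \<odot> (G w \<odot> e \<beta>)"] by (simp add: mul_assoc)
      finally have 1: "r' *s (e \<alpha> \<odot> v) = t *s (e \<alpha> \<odot> (G w \<odot> e \<beta>))" .
      have "r' *s (e \<beta> \<odot> ((G (inv w) \<odot> e \<alpha>) \<odot> v)) = e \<beta> \<odot> (G (inv w) \<odot> (r' *s (e \<alpha> \<odot> v)))"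
        by (simp add: mul_assoc)
      also have "\<dots> = (t * r') *s e \<beta>" unfolding 1 by (simp add: w(3))
      finally have "(t * r') *s e \<beta> = 0" using v(3)[of "G (inv w) \<odot> e \<alpha>"] \<beta>(2) eB Gs by (simp add: B_mul)
      then have "t = 0" using w(2) jmD'(5)[OF \<beta>(1)] by simp
      then show False using 1 nz w(2) by simp
    qed
    then show ?thesis using sum_idem_mul[OF jm v(1)] by simp
  qed
  have "nondegenerate B F"
    unfolding nondegenerate_def
  proof (intro ballI conjI impI; elim conjE)
    fix f v assume f: "f \<in> F" and v: "v \<in> B"
    show "v = 0" if "v \<odot> f = v" "\<forall>a\<in>B. f \<odot> (a \<odot> v) = 0" using left[OF f v] that by blast
    assume fv: "f \<odot> v = v" and h: "\<forall>a\<in>B. v \<odot> (a \<odot> f) = 0"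
    have sf: "star f = f" using FL[OF f] jmD'(6) by auto
    \<comment> \<open>The adjoint exchanges left and right and fixes \<open>f\<close>, so this half
      follows from the other one.\<close>
    have "star v = 0"
    proof (rule left[OF f star_in_B[OF v]])
      show "star v \<odot> f = star v" using arg_cong[OF fv, of star] sf by (simp add: star_mul)
      show "f \<odot> (a \<odot> star v) = 0" if "a \<in> B" for a
        using arg_cong[OF bspec[OF h star_in_B[OF that]], of star] sf star_star[OF that]
        by (simp add: star_mul star_0 mul_assoc)
    qed
    then show "v = 0" using star_star[OF v] star_0 by simp
  qed
  then show ?thesis using prim gen unital_B unfolding split_algebra_def by blast
qed

end

theorem split_algebra_B: "\<exists>F. split_algebra B one F"
  using exists_jm_decomposition exists_split_family by blast

end

section \<open>Products of diagrams\<close>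

text \<open>Two involutions define a graph of paths and cycles, in which fixed points are the ends
  of paths. Walking from \<open>u\<close> with \<open>f\<close> and \<open>g\<close> in turn, the
  vertices up to the first further end form a closed set, so the component contains no other
  end.\<close>

lemma involution_walk_unique_end:
  assumes ff: "\<And>y. f (f y) = y" and gg: "\<And>y. g (g y) = y" and gu: "g u = u"
    and v: "(u, v) \<in> {(y, y'). y' = f y \<or> y' = g y}\<^sup>*" "f v = v \<or> g v = v" "v \<noteq> u"
    and w: "(u, w) \<in> {(y, y'). y' = f y \<or> y' = g y}\<^sup>*" "f w = w \<or> g w = w" "w \<noteq> u"
  shows "v = w"
proof -
  \<comment> \<open>The walk starts with \<open>f\<close> because \<open>g\<close> fixes
    \<open>u\<close>.\<close>
  define z where "z = rec_nat u (\<lambda>k y. if even k then f y else g y)"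
  have z0: "z 0 = u" by (simp add: z_def)
  have zS: "z (Suc k) = (if even k then f (z k) else g (z k))" for k by (simp add: z_def)
  define P where "P y \<longleftrightarrow> f y = y \<or> g y = y" for y
  have pred_f: "f (z k) = z (k - 1)" if "odd k" for k
    using that ff zS[of "k - 1"] by (cases k) auto
  have pred_g: "g (z k) = z (k - 1)" if "even k" for k
    using that gg gu z0 zS[of "k - 1"] by (cases k) auto
  have reach: "y \<in> Z" if "(u, y) \<in> {(y, y'). y' = f y \<or> y' = g y}\<^sup>*" "u \<in> Z"
    "\<And>y. y \<in> Z \<Longrightarrow> f y \<in> Z \<and> g y \<in> Z" for Z y
    using that(1) by (induction rule: rtrancl_induct) (use that(2,3) in auto)
  have "v \<in> range z"
  proof (rule reach[OF v(1)])
    show "u \<in> range z" using z0 by (metis rangeI)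
    show "f y \<in> range z \<and> g y \<in> range z" if y: "y \<in> range z" for y
    proof -
      obtain k where "y = z k" using y by auto
      then show ?thesis using pred_f[of k] pred_g[of k] zS[of k] by (cases "even k") (metis rangeI)+
    qed
  qed
  then have ex: "\<exists>k. z k \<noteq> u \<and> P (z k)" using v by (auto simp: P_def)
  define k where "k = (LEAST k. z k \<noteq> u \<and> P (z k))"
  have k: "z k \<noteq> u" "P (z k)" using LeastI_ex[OF ex] unfolding k_def by auto
  have least: "\<not> (z i \<noteq> u \<and> P (z i))" if "i < k" for i
    using not_less_Least[of i "\<lambda>k. z k \<noteq> u \<and> P (z k)"] that unfolding k_def by blast
  have k0: "k > 0" using k z0 by (cases k) auto
  then have ne: "z (k - 1) \<noteq> z k" using least[of "k - 1"] k by auto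
  \<comment> \<open>The involution that led to \<open>z k\<close> moved a point, so the one fixing
    \<open>z k\<close> is the one that would be applied next.\<close>
  have last: "f (z k) = z k" if "even k" using pred_g[OF that] ne k(2) by (auto simp: P_def)
  have last': "g (z k) = z k" if "odd k" using pred_f[OF that] ne k(2) by (auto simp: P_def)
  let ?Z = "z ` {..k}"
  have closed: "f y \<in> ?Z \<and> g y \<in> ?Z" if y: "y \<in> ?Z" for y
  proof -
    obtain i where i: "y = z i" "i \<le> k" using y by auto
    have suc: "z (Suc i) \<in> ?Z" if "i \<noteq> k" using i that by auto
    have pre: "z (i - 1) \<in> ?Z" using i by auto
    show ?thesis
    proof (cases "even i")
      case True
      then show ?thesis using suc pre pred_g[OF True] zS[of i] last i by (cases "i = k") auto
    next
      case False
      then show ?thesis using suc pre pred_f[OF False] zS[of i] last' i by (cases "i = k") auto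
    qed
  qed
  have end_eq: "y = z k" if "(u, y) \<in> {(y, y'). y' = f y \<or> y' = g y}\<^sup>*" "P y" "y \<noteq> u" for y
  proof -
    have "y \<in> ?Z" by (rule reach[OF that(1) _ closed]) (use z0 in \<open>auto intro: image_eqI[of _ _ 0]\<close>)
    then obtain i where i: "y = z i" "i \<le> k" by auto
    then show ?thesis using least[of i] that by (cases "i = k") auto
  qed
  show ?thesis using end_eq[OF v(1)] end_eq[OF w(1)] v w by (auto simp: P_def)
qed

section \<open>Matchings and diagrams\<close>

definition matching :: "'v set set \<Rightarrow> bool" where
  "matching E \<longleftrightarrow> (\<forall>e\<in>E. \<exists>u v. e = {u, v} \<and> u \<noteq> v) \<and> (\<forall>e\<in>E. \<forall>e'\<in>E. e \<noteq> e' \<longrightarrow> e \<inter> e' = {})"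

text \<open>Unmatched vertices are their own partners, so a matching becomes an involution of the
  whole type with the unmatched vertices as fixed points.\<close>

definition partner :: "'v set set \<Rightarrow> 'v \<Rightarrow> 'v" where
  "partner E u = (if \<exists>v. {u, v} \<in> E then SOME v. {u, v} \<in> E else u)"

lemma matching_edge: "matching E \<Longrightarrow> e \<in> E \<Longrightarrow> \<exists>u v. e = {u, v} \<and> u \<noteq> v"
  by (simp add: matching_def)

lemma matching_disjoint: "matching E \<Longrightarrow> e \<in> E \<Longrightarrow> e' \<in> E \<Longrightarrow> e \<noteq> e' \<Longrightarrow> e \<inter> e' = {}"
  by (simp add: matching_def)

lemma matching_unique:
  assumes "matching E" "{u, v} \<in> E" "{u, w} \<in> E"
  shows "v = w"
proof -
  have "{u, v} = {u, w}" using matching_disjoint[OF assms] by auto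
  then show ?thesis by (auto simp: doubleton_eq_iff)
qed

lemma matching_irrefl:
  assumes "matching E"
  shows "{u, u} \<notin> E"
proof
  assume "{u, u} \<in> E"
  then obtain v w where "{u, u} = {v, w}" "v \<noteq> w" using matching_edge[OF assms] by auto
  then show False by (auto simp: doubleton_eq_iff)
qed

lemma partner_edge: "partner E u \<noteq> u \<Longrightarrow> {u, partner E u} \<in> E"
  unfolding partner_def using someI_ex[of "\<lambda>v. {u, v} \<in> E"] by (auto split: if_splits)

lemma partner_eq:
  assumes "matching E" "{u, v} \<in> E"
  shows "partner E u = v"
proof -
  have "{u, SOME v. {u, v} \<in> E} \<in> E" using assms(2) by (rule someI)
  then show ?thesis using assms matching_unique unfolding partner_def by auto
qed

lemma partner_partner:
  assumes "matching E"
  shows "partner E (partner E u) = u"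
proof (cases "partner E u = u")
  case False
  then have "{partner E u, u} \<in> E" using partner_edge[of E u] by (simp add: insert_commute)
  then show ?thesis by (rule partner_eq[OF assms])
qed simp

lemma diagram_edge:
  "D \<in> diagrams n \<Longrightarrow> e \<in> D \<Longrightarrow> \<exists>u v. e = {u, v} \<and> u \<in> verts n \<and> v \<in> verts n \<and> u \<noteq> v"
  by (simp add: diagrams_def is_diagram_def)

lemma diagram_edgeE:
  assumes "D \<in> diagrams n" "e \<in> D"
  obtains u v where "e = {u, v}" "u \<noteq> v" "u \<in> verts n" "v \<in> verts n"
  using diagram_edge[OF assms] by auto

lemma diagram_matching:
  assumes "D \<in> diagrams n"
  shows "matching D"
  unfolding matching_def
proof (intro conjI ballI)
  fix e assume "e \<in> D" show "\<exists>u v. e = {u, v} \<and> u \<noteq> v" using diagram_edge[OF assms \<open>e \<in> D\<close>] by blast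
qed (use assms in \<open>simp add: diagrams_def is_diagram_def\<close>)

lemma diagramI:
  assumes "matching D" "\<And>u v. {u, v} \<in> D \<Longrightarrow> u \<in> verts n"
  shows "D \<in> diagrams n"
  unfolding diagrams_def is_diagram_def mem_Collect_eq
proof (intro conjI ballI)
  fix e assume e: "e \<in> D"
  obtain u v where uv: "e = {u, v}" "u \<noteq> v" using matching_edge[OF assms(1) e] by blast
  have "{u, v} \<in> D" "{v, u} \<in> D" using uv e by (auto simp: insert_commute)
  then show "\<exists>u v. e = {u, v} \<and> u \<in> verts n \<and> v \<in> verts n \<and> u \<noteq> v"
    using assms(2) uv by blast
next
  fix e e' assume "e \<in> D" "e' \<in> D" then show "e \<noteq> e' \<longrightarrow> e \<inter> e' = {}"
    using matching_disjoint[OF assms(1)] by simp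
qed

lemma diagram_verts:
  assumes "D \<in> diagrams n" "{u, v} \<in> D"
  shows "u \<in> verts n"
proof -
  obtain u' v' where "{u, v} = {u', v'}" "u' \<in> verts n" "v' \<in> verts n"
    using diagram_edgeE[OF assms] by metis
  then show ?thesis by (auto simp: doubleton_eq_iff)
qed

lemma finite_diagrams: "finite (diagrams n)"
proof (rule finite_subset)
  show "diagrams n \<subseteq> Pow (Pow (verts n))"
  proof (intro subsetI PowI)
    fix D e x assume "D \<in> diagrams n" "e \<in> D" "x \<in> e"
    then show "x \<in> verts n" using diagram_edge[of D n e] by auto
  qed
  show "finite (Pow (Pow (verts n)))" by (simp add: verts_def)
qed

lemma matchingI:
  assumes "\<And>e. e \<in> E \<Longrightarrow> \<exists>u v. e = {u, v} \<and> u \<noteq> v"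
    and "\<And>u v w. {u, v} \<in> E \<Longrightarrow> {u, w} \<in> E \<Longrightarrow> v = w"
  shows "matching E"
  unfolding matching_def
proof (intro conjI ballI impI)
  fix e e' assume e: "e \<in> E" "e' \<in> E" "e \<noteq> e'"
  show "e \<inter> e' = {}"
  proof (rule ccontr)
    assume "e \<inter> e' \<noteq> {}"
    then obtain u where u: "u \<in> e" "u \<in> e'" by auto
    obtain v where v: "e = {u, v}" using assms(1)[OF e(1)] u by (auto simp: insert_commute)
    obtain w where w: "e' = {u, w}" using assms(1)[OF e(2)] u by (auto simp: insert_commute)
    show False using assms(2)[of u v w] e v w by auto
  qed
qed (use assms(1) in auto)

lemma matching_image:
  assumes "matching E" "inj f"
  shows "matching ((`) f ` E)"
  unfolding matching_def
proof (intro conjI ballI impI)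
  fix e assume "e \<in> (`) f ` E"
  then obtain e0 where e0: "e0 \<in> E" "e = f ` e0" by auto
  then obtain u v where "e0 = {u, v}" "u \<noteq> v" using matching_edge[OF assms(1) e0(1)] by blast
  then show "\<exists>u v. e = {u, v} \<and> u \<noteq> v" using e0 assms(2) by (intro exI[of _ "f u"] exI[of _ "f v"]) (auto dest: injD)
next
  fix e e' assume "e \<in> (`) f ` E" "e' \<in> (`) f ` E" "e \<noteq> e'"
  then obtain e0 e0' where e0: "e0 \<in> E" "e = f ` e0" "e0' \<in> E" "e' = f ` e0'" "e0 \<noteq> e0'" by auto
  then have "e0 \<inter> e0' = {}" using matching_disjoint[OF assms(1)] by simp
  then show "e \<inter> e' = {}" using e0 assms(2) by (simp flip: image_Int)
qed

definition compat :: "'v set set \<Rightarrow> 'v set \<Rightarrow> bool" where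
  "compat D S \<longleftrightarrow> (\<forall>u v. {u, v} \<in> D \<longrightarrow> (u \<in> S \<longleftrightarrow> v \<in> S))"

definition colouring :: "nat set \<Rightarrow> nat set \<Rightarrow> vert set" where
  "colouring I J = {v. if fst v then snd v \<in> J else snd v \<in> I}"

text \<open>
  Two-colourings of the vertices that are constant on edges turn a diagram into a 0/1 matrix indexed
  by the colourings of its two rows. Summing over the colourings of the middle row multiplies these
  matrices, and each component inside the middle row contributes a factor 2. The matrices determine
  the diagrams, so identities between products of diagrams can be checked on matrices.
\<close>

definition dmat :: "diagram \<Rightarrow> nat set \<Rightarrow> nat set \<Rightarrow> nat" where
  "dmat D I J = of_bool (compat D (colouring I J))"

lemma colouring_simps [simp]:
  "(False, i) \<in> colouring I J \<longleftrightarrow> i \<in> I" "(True, i) \<in> colouring I J \<longleftrightarrow> i \<in> J"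
  by (auto simp: colouring_def)

lemma inj_emb: "inj emb_top" "inj emb_bot" "inj lift_outer"
  by (auto simp: inj_def emb_top_def emb_bot_def lift_outer_def split: if_splits)

context
  fixes n :: nat and a b :: diagram
  assumes a: "a \<in> diagrams n" and b: "b \<in> diagrams n"
begin

definition stack_rel :: "((nat \<times> nat) \<times> (nat \<times> nat)) set" where
  "stack_rel = {(u, v). {u, v} \<in> stack_edges a b}"

lemma stack_conn_eq: "stack_conn a b = stack_rel\<^sup>*"
  by (simp add: stack_conn_def stack_rel_def)

lemma sym_stack_rel: "sym stack_rel"
  by (auto simp: stack_rel_def sym_def insert_commute)

lemma stack_conn_sym: "(u, v) \<in> stack_conn a b \<Longrightarrow> (v, u) \<in> stack_conn a b"
  unfolding stack_conn_eq using sym_rtrancl[OF sym_stack_rel] by (auto dest: symD)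

lemma stack_conn_trans: "(u, v) \<in> stack_conn a b \<Longrightarrow> (v, w) \<in> stack_conn a b \<Longrightarrow> (u, w) \<in> stack_conn a b"
  unfolding stack_conn_eq by (rule rtrancl_trans)

lemma stack_rel_cases:
  assumes "(u, v) \<in> stack_rel"
  obtains p q where "{p, q} \<in> a" "u = emb_top p" "v = emb_top q"
    | p q where "{p, q} \<in> b" "u = emb_bot p" "v = emb_bot q"
proof -
  have "(\<exists>e\<in>a. {u, v} = emb_top ` e) \<or> (\<exists>e\<in>b. {u, v} = emb_bot ` e)"
    using assms by (auto simp: stack_rel_def stack_edges_def)
  then show ?thesis
  proof (elim disjE bexE)
    fix e assume e: "e \<in> a" "{u, v} = emb_top ` e"
    from e obtain p q where "e = {p, q}" using diagram_edgeE[OF a] by metis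
    then show ?thesis using e that(1)[of p q] that(1)[of q p] by (auto simp: doubleton_eq_iff insert_commute)
  next
    fix e assume e: "e \<in> b" "{u, v} = emb_bot ` e"
    from e obtain p q where "e = {p, q}" using diagram_edgeE[OF b] by metis
    then show ?thesis using e that(2)[of p q] that(2)[of q p] by (auto simp: doubleton_eq_iff insert_commute)
  qed
qed

lemma stack_relI:
  "{p, q} \<in> a \<Longrightarrow> (emb_top p, emb_top q) \<in> stack_rel"
  "{p, q} \<in> b \<Longrightarrow> (emb_bot p, emb_bot q) \<in> stack_rel"
  unfolding stack_rel_def stack_edges_def
  using imageI[of "{p, q}" a "(`) emb_top"] imageI[of "{p, q}" b "(`) emb_bot"] by auto

lemma emb_in_stack_verts: "v \<in> verts n \<Longrightarrow> emb_top v \<in> stack_verts n \<and> emb_bot v \<in> stack_verts n"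
  by (auto simp: verts_def stack_verts_def emb_top_def emb_bot_def)

lemma stack_conn_verts: "(u, v) \<in> stack_conn a b \<Longrightarrow> u \<in> stack_verts n \<Longrightarrow> v \<in> stack_verts n"
  unfolding stack_conn_eq
proof (induction rule: rtrancl_induct)
  case (step y z)
  from step.hyps(2) show ?case
  proof (cases rule: stack_rel_cases)
    case (1 p q)
    then show ?thesis using diagram_verts[OF a, of q p] emb_in_stack_verts by (simp add: insert_commute)
  next
    case (2 p q)
    then show ?thesis using diagram_verts[OF b, of q p] emb_in_stack_verts by (simp add: insert_commute)
  qed
qed

lemma Gprime_edge:
  "{p, q} \<in> Gprime n a b \<longleftrightarrow> p \<in> verts n \<and> q \<in> verts n \<and> p \<noteq> q \<and>
     (lift_outer p, lift_outer q) \<in> stack_conn a b"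
proof
  assume "{p, q} \<in> Gprime n a b"
  then obtain p' q' where "{p, q} = {p', q'}" "p' \<in> verts n" "q' \<in> verts n" "p' \<noteq> q'"
    "(lift_outer p', lift_outer q') \<in> stack_conn a b" unfolding Gprime_def by blast
  then show "p \<in> verts n \<and> q \<in> verts n \<and> p \<noteq> q \<and> (lift_outer p, lift_outer q) \<in> stack_conn a b"
    by (auto simp: doubleton_eq_iff intro: stack_conn_sym)
qed (unfold Gprime_def, blast)

text \<open>The stack graph is the union of two matchings; no edge of \<open>b\<close> touches the
  top row and no edge of \<open>a\<close> the bottom row. Outer vertices are thus ends of paths, and
  a path has only two ends.\<close>

lemma outer_connected_unique:
  assumes "(lift_outer r, lift_outer p) \<in> stack_conn a b" "(lift_outer r, lift_outer q) \<in> stack_conn a b"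
    "p \<noteq> r" "q \<noteq> r"
  shows "p = q"
proof -
  define f where "f = partner ((`) emb_top ` a)"
  define g where "g = partner ((`) emb_bot ` b)"
  have ma: "matching ((`) emb_top ` a)" and mb: "matching ((`) emb_bot ` b)"
    using matching_image diagram_matching a b inj_emb by blast+
  have ff: "f (f y) = y" and gg: "g (g y) = y" for y
    unfolding f_def g_def using partner_partner ma mb by auto
  have sub: "stack_rel \<subseteq> {(y, y'). y' = f y \<or> y' = g y}"
  proof (rule subrelI)
    fix y y' assume "(y, y') \<in> stack_rel"
    then have "{y, y'} \<in> (`) emb_top ` a \<or> {y, y'} \<in> (`) emb_bot ` b"
      by (simp add: stack_rel_def stack_edges_def)
    then show "(y, y') \<in> {(y, y'). y' = f y \<or> y' = g y}"
      unfolding f_def g_def using partner_eq[OF ma, of y y'] partner_eq[OF mb, of y y'] by auto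
  qed
  have c: "(lift_outer r, y) \<in> {(y, y'). y' = f y \<or> y' = g y}\<^sup>*"
    if "(lift_outer r, y) \<in> stack_conn a b" for y
    using that rtrancl_mono[OF sub] unfolding stack_conn_eq by auto
  have gtop: "g (0, i) = (0, i)" for i
  proof (rule ccontr)
    assume "g (0, i) \<noteq> (0, i)"
    then have "{(0, i), g (0, i)} \<in> (`) emb_bot ` b" unfolding g_def by (rule partner_edge)
    then obtain e where "e \<in> b" "{(0, i), g (0, i)} = emb_bot ` e" by auto
    then have "(0, i) \<in> range emb_bot" by auto
    then show False by (auto simp: emb_bot_def split: if_splits)
  qed
  have fbot: "f (2, i) = (2, i)" for i
  proof (rule ccontr)
    assume "f (2, i) \<noteq> (2, i)"
    then have "{(2, i), f (2, i)} \<in> (`) emb_top ` a" unfolding f_def by (rule partner_edge)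
    then obtain e where "e \<in> a" "{(2, i), f (2, i)} = emb_top ` e" by auto
    then have "(2, i) \<in> range emb_top" by auto
    then show False by (auto simp: emb_top_def split: if_splits)
  qed
  have outer: "f (lift_outer v) = lift_outer v \<or> g (lift_outer v) = lift_outer v" for v
    using gtop fbot by (auto simp: lift_outer_def)
  have ne: "lift_outer p \<noteq> lift_outer r" "lift_outer q \<noteq> lift_outer r"
    using assms(3,4) inj_emb(3) by (auto dest: injD)
  have sw: "{(y, y'). y' = f y \<or> y' = g y} = {(y, y'). y' = g y \<or> y' = f y}" by auto
  have "lift_outer p = lift_outer q"
  proof (cases "g (lift_outer r) = lift_outer r")
    case True
    show ?thesis
      by (rule involution_walk_unique_end[of f g "lift_outer r", OF ff gg True c[OF assms(1)] outer ne(1) c[OF assms(2)] outer ne(2)])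
  next
    case False
    then have "f (lift_outer r) = lift_outer r" using outer by blast
    then show ?thesis
      using involution_walk_unique_end[of g f "lift_outer r", OF gg ff _ c[OF assms(1), unfolded sw] _ ne(1) c[OF assms(2), unfolded sw] _ ne(2)]
        outer by blast
  qed
  then show ?thesis using inj_emb(3) by (auto dest: injD)
qed

lemma Gprime_diagram: "Gprime n a b \<in> diagrams n"
proof (rule diagramI)
  show "u \<in> verts n" if "{u, v} \<in> Gprime n a b" for u v using that Gprime_edge by blast
  show "matching (Gprime n a b)"
  proof (rule matchingI)
    show "\<exists>u v. e = {u, v} \<and> u \<noteq> v" if "e \<in> Gprime n a b" for e using that unfolding Gprime_def by blast
    show "v = w" if "{u, v} \<in> Gprime n a b" "{u, w} \<in> Gprime n a b" for u v w
      using that outer_connected_unique[of u v w] unfolding Gprime_edge by auto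
  qed
qed

section \<open>Colourings of the three rows of a stack\<close>

definition rows :: "nat set \<Rightarrow> nat set \<Rightarrow> nat set \<Rightarrow> (nat \<times> nat) set" where
  "rows I J K = {0} \<times> I \<union> {1} \<times> J \<union> {2} \<times> K"

lemma rows_emb:
  "emb_top v \<in> rows I J K \<longleftrightarrow> v \<in> colouring I J"
  "emb_bot v \<in> rows I J K \<longleftrightarrow> v \<in> colouring J K"
  "lift_outer v \<in> rows I J K \<longleftrightarrow> v \<in> colouring I K"
  by (auto simp: rows_def emb_top_def emb_bot_def lift_outer_def colouring_def)

lemma compat_stack:
  "compat a (colouring I J) \<and> compat b (colouring J K) \<longleftrightarrow>
     (\<forall>u v. (u, v) \<in> stack_conn a b \<longrightarrow> (u \<in> rows I J K \<longleftrightarrow> v \<in> rows I J K))"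
proof (rule iffI; (intro allI impI)?)
  fix u v assume c: "compat a (colouring I J) \<and> compat b (colouring J K)"
  assume "(u, v) \<in> stack_conn a b"
  then show "u \<in> rows I J K \<longleftrightarrow> v \<in> rows I J K"
    unfolding stack_conn_eq
  proof (induction rule: rtrancl_induct)
    case (step y z)
    from step.hyps(2) show ?case
    proof (cases rule: stack_rel_cases)
      case (1 p q)
      then show ?thesis using c step.IH rows_emb(1) unfolding compat_def by blast
    next
      case (2 p q)
      then show ?thesis using c step.IH rows_emb(2) unfolding compat_def by blast
    qed
  qed simp
next
  assume h: "\<forall>u v. (u, v) \<in> stack_conn a b \<longrightarrow> (u \<in> rows I J K \<longleftrightarrow> v \<in> rows I J K)"
  have "emb_top p \<in> rows I J K \<longleftrightarrow> emb_top q \<in> rows I J K" if "{p, q} \<in> a" for p q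
    using h stack_relI(1)[OF that] unfolding stack_conn_eq by blast
  moreover have "emb_bot p \<in> rows I J K \<longleftrightarrow> emb_bot q \<in> rows I J K" if "{p, q} \<in> b" for p q
    using h stack_relI(2)[OF that] unfolding stack_conn_eq by blast
  ultimately show "compat a (colouring I J) \<and> compat b (colouring J K)"
    unfolding compat_def rows_emb by blast
qed

lemma component_eq:
  assumes "C \<in> stack_components n a b" "u \<in> C"
  shows "C = {v. (u, v) \<in> stack_conn a b}" "u \<in> stack_verts n"
proof -
  obtain w where w: "w \<in> stack_verts n" "C = (stack_conn a b \<inter> (stack_verts n \<times> stack_verts n)) `` {w}"
    using assms(1) unfolding stack_components_def by (rule quotientE)
  have C: "C = {v. (w, v) \<in> stack_conn a b}" using w(2) stack_conn_verts[OF _ w(1)] w(1) by auto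
  then have wu: "(w, u) \<in> stack_conn a b" using assms(2) by simp
  show "u \<in> stack_verts n" using stack_conn_verts[OF wu w(1)] .
  show "C = {v. (u, v) \<in> stack_conn a b}"
    unfolding C using wu stack_conn_sym stack_conn_trans by blast
qed

lemma component_mem:
  assumes "u \<in> stack_verts n"
  shows "{v. (u, v) \<in> stack_conn a b} \<in> stack_components n a b"
proof -
  have "(stack_conn a b \<inter> (stack_verts n \<times> stack_verts n)) `` {u} = {v. (u, v) \<in> stack_conn a b}"
    using stack_conn_verts[OF _ assms] assms by auto
  then show ?thesis unfolding stack_components_def using quotientI[OF assms] by metis
qed

lemma stack_conn_refl: "(u, u) \<in> stack_conn a b"
  by (simp add: stack_conn_eq)

text \<open>The colour of a middle vertex is forced if its component reaches an outer row,
  consistently because \<open>Gprime\<close> is compatible with the outer colours; each inner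
  component may be coloured freely. So the admissible \<open>J\<close> correspond to the sets of
  inner components.\<close>

lemma card_middle_colourings:
  assumes I: "I \<subseteq> {..<n}" and K: "K \<subseteq> {..<n}" and c: "compat (Gprime n a b) (colouring I K)"
  shows "card {J \<in> Pow {..<n}. compat a (colouring I J) \<and> compat b (colouring J K)} = 2 ^ ell n a b"
proof -
  let ?R = "stack_conn a b"
  define M where "M = {C \<in> stack_components n a b. C \<subseteq> {1} \<times> {..<n}}"
  define Q where "Q = {0} \<times> I \<union> {2::nat} \<times> K"
  define g where "g \<C> = {j. j < n \<and> ((\<exists>w\<in>Q. ((1, j), w) \<in> ?R) \<or> (1, j) \<in> \<Union>\<C>)}" for \<C> :: "(nat \<times> nat) set set"
  let ?\<J> = "{J \<in> Pow {..<n}. compat a (colouring I J) \<and> compat b (colouring J K)}"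
  have OL: "\<exists>p\<in>verts n. p \<in> colouring I K \<and> w = lift_outer p" if h: "w \<in> Q" for w
  proof -
    consider i where "i \<in> I" "w = (0, i)" | i where "i \<in> K" "w = (2, i)" using h by (auto simp: Q_def)
    then show ?thesis
    proof cases
      case 1
      then show ?thesis using I by (intro bexI[of _ "(False, i)"]) (auto simp: lift_outer_def verts_def)
    next
      case 2
      then show ?thesis using K by (intro bexI[of _ "(True, i)"]) (auto simp: lift_outer_def verts_def)
    qed
  qed
  have LO: "lift_outer p \<in> Q \<longleftrightarrow> p \<in> colouring I K" for p
    by (auto simp: Q_def lift_outer_def colouring_def)
  \<comment> \<open>Two connected outer vertices coincide or form an edge of \<open>Gprime\<close>,
    so compatibility carries the colour from one to the other.\<close>
  have Oclosed: "w' \<in> Q" if h: "w \<in> Q" "(w, w') \<in> ?R" "w' \<in> {0, 2} \<times> {..<n}" for w w'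
  proof -
    obtain p where p: "p \<in> verts n" "p \<in> colouring I K" "w = lift_outer p" using OL[OF h(1)] by auto
    have "\<exists>q\<in>verts n. w' = lift_outer q"
    proof (cases "fst w' = 0")
      case True
      then show ?thesis using h(3) by (intro bexI[of _ "(False, snd w')"]) (auto simp: lift_outer_def verts_def)
    next
      case False
      then show ?thesis using h(3) by (intro bexI[of _ "(True, snd w')"]) (auto simp: lift_outer_def verts_def)
    qed
    then obtain q where q: "q \<in> verts n" "w' = lift_outer q" by auto
    show ?thesis
    proof (cases "p = q")
      case False
      then have "{p, q} \<in> Gprime n a b" using Gprime_edge p q h(2) by simp
      then show ?thesis using c p q LO unfolding compat_def by blast
    qed (use p q h in simp)
  qed
  have MO: "(u, w) \<notin> ?R" if "C \<in> M" "u \<in> C" "w \<in> {0, 2} \<times> {..<n}" for C u w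
    using component_eq[of C u] that by (auto simp: M_def)
  have OO: "Q \<subseteq> {0, 2} \<times> {..<n}" using I K by (auto simp: Q_def)
  have inj: "inj_on g (Pow M)"
  \<comment> \<open>The chosen components are recovered as the inner components that are coloured
    throughout.\<close>
  proof (rule inj_on_inverseI[of _ "\<lambda>J. {C \<in> M. C \<subseteq> {1} \<times> J}"])
    fix \<C> assume \<C>: "\<C> \<in> Pow M"
    show "{C \<in> M. C \<subseteq> {1} \<times> g \<C>} = \<C>"
    proof (intro equalityI subsetI)
      fix C assume "C \<in> {C \<in> M. C \<subseteq> {1} \<times> g \<C>}"
      then have C: "C \<in> M" "C \<subseteq> {1} \<times> g \<C>" by auto
      obtain w where "w \<in> stack_verts n" "C = (?R \<inter> (stack_verts n \<times> stack_verts n)) `` {w}"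
        using C(1) unfolding M_def stack_components_def by (auto elim: quotientE)
      then have "w \<in> C" using stack_conn_refl by auto
      then obtain j where j: "(1, j) \<in> C" "j \<in> g \<C>" using C(2) by auto
      have "\<not> (\<exists>w\<in>Q. ((1, j), w) \<in> ?R)" using MO[OF C(1) j(1)] OO by blast
      then obtain C' where C': "C' \<in> \<C>" "(1, j) \<in> C'" using j(2) by (auto simp: g_def)
      then have "C' \<in> stack_components n a b" using \<C> by (auto simp: M_def)
      then have "C' = C" using component_eq(1) C' j C(1) M_def by (metis (no_types, lifting) mem_Collect_eq)
      then show "C \<in> \<C>" using C' by simp
    next
      fix C assume "C \<in> \<C>"
      then show "C \<in> {C \<in> M. C \<subseteq> {1} \<times> g \<C>}" using \<C> by (fastforce simp: M_def g_def)
    qed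
  qed
  have "g ` Pow M = ?\<J>"
  proof (intro equalityI subsetI)
    fix J assume "J \<in> g ` Pow M"
    then obtain \<C> where \<C>: "\<C> \<subseteq> M" "J = g \<C>" by auto
    define T where "T = {u \<in> stack_verts n. (\<exists>w\<in>Q. (u, w) \<in> ?R) \<or> u \<in> \<Union>\<C>}"
    have rT: "rows I J K = T"
    proof (intro set_eqI)
      fix u :: "nat \<times> nat"
      obtain r j where u: "u = (r, j)" by (cases u)
      show "u \<in> rows I J K \<longleftrightarrow> u \<in> T"
      proof (cases "r = 1")
        case True
        then show ?thesis by (auto simp: u rows_def T_def \<C>(2) g_def stack_verts_def)
      next
        case False
        have "u \<in> rows I J K \<longleftrightarrow> u \<in> Q" using False by (auto simp: u rows_def Q_def)
        moreover have "u \<in> Q" if uT: "u \<in> T"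
        proof -
          have u2: "u \<in> {0, 2} \<times> {..<n}" using that False by (auto simp: T_def u stack_verts_def)
          have "u \<notin> \<Union>\<C>" using \<C>(1) False by (auto simp: u M_def)
          then obtain w where "w \<in> Q" "(u, w) \<in> ?R" using uT by (auto simp: T_def)
          then show ?thesis using Oclosed[of w u] stack_conn_sym u2 by blast
        qed
        moreover have "u \<in> T" if "u \<in> Q"
        proof -
          have "u \<in> stack_verts n" using that OO by (auto simp: stack_verts_def)
          then show ?thesis unfolding T_def using that stack_conn_refl[of u] by blast
        qed
        ultimately show ?thesis by blast
      qed
    qed
    have Tclosed: "v \<in> T" if uv: "(u, v) \<in> ?R" and uT: "u \<in> T" for u v
    proof -
      have vV: "v \<in> stack_verts n" using stack_conn_verts[OF uv] uT by (simp add: T_def)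
      from uT consider w where "w \<in> Q" "(u, w) \<in> ?R" | C where "C \<in> \<C>" "u \<in> C" by (auto simp: T_def)
      then show ?thesis
      proof cases
        case 1
        then show ?thesis unfolding T_def using vV stack_conn_trans[OF stack_conn_sym[OF uv]] by blast
      next
        case 2
        then have "C = {v. (u, v) \<in> ?R}" using component_eq(1)[of C u] \<C>(1) by (auto simp: M_def)
        then show ?thesis using 2 vV uv by (auto simp: T_def)
      qed
    qed
    have "compat a (colouring I J) \<and> compat b (colouring J K)"
      unfolding compat_stack rT using Tclosed stack_conn_sym by blast
    then show "J \<in> ?\<J>" by (auto simp: \<C>(2) g_def)
  next
    fix J assume "J \<in> ?\<J>"
    then have J: "J \<subseteq> {..<n}"
      and cl: "\<And>u v. (u, v) \<in> ?R \<Longrightarrow> u \<in> rows I J K \<longleftrightarrow> v \<in> rows I J K"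
      using compat_stack by auto
    define \<C> where "\<C> = {C \<in> M. C \<subseteq> {1} \<times> J}"
    have OT: "Q \<subseteq> rows I J K" by (auto simp: Q_def rows_def)
    have T1: "(1, j) \<in> rows I J K \<longleftrightarrow> j \<in> J" for j by (auto simp: rows_def)
    have "g \<C> = J"
    proof (intro equalityI subsetI)
      fix j assume "j \<in> g \<C>"
      then consider w where "w \<in> Q" "((1, j), w) \<in> ?R" | C where "C \<in> \<C>" "(1, j) \<in> C" by (auto simp: g_def)
      then show "j \<in> J"
      proof cases
        case 1 then show ?thesis using cl OT T1 by blast
      next
        case 2 then show ?thesis by (auto simp: \<C>_def)
      qed
    next
      fix j assume j: "j \<in> J"
      then have jn: "j < n" using J by auto
      then have jV: "(1, j) \<in> stack_verts n" by (auto simp: stack_verts_def)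
      let ?C = "{v. ((1, j), v) \<in> ?R}"
      have CT: "?C \<subseteq> rows I J K" using cl T1 j by blast
      show "j \<in> g \<C>"
      proof (cases "?C \<subseteq> {1} \<times> {..<n}")
        case True
        then have "?C \<in> M" using component_mem[OF jV] by (simp add: M_def)
        moreover have "?C \<subseteq> {1} \<times> J"
        proof
          fix v assume v: "v \<in> ?C"
          then obtain i where "v = (1, i)" using True by auto
          then show "v \<in> {1} \<times> J" using CT v T1 by blast
        qed
        ultimately have "?C \<in> \<C>" by (simp add: \<C>_def)
        moreover have "(1, j) \<in> ?C" using stack_conn_refl by simp
        ultimately show ?thesis unfolding g_def using jn by blast
      next
        case False
        then obtain v where v: "((1, j), v) \<in> ?R" "v \<notin> {1} \<times> {..<n}" by auto
        have "v \<in> stack_verts n" using stack_conn_verts[OF v(1) jV] .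
        then have "v \<in> Q" using v CT by (auto simp: rows_def Q_def stack_verts_def)
        then show ?thesis unfolding g_def using v(1) jn by blast
      qed
    qed
    moreover have "\<C> \<in> Pow M" by (auto simp: \<C>_def)
    ultimately show "J \<in> g ` Pow M" by blast
  qed
  then have "card ?\<J> = card (Pow M)" using card_image[OF inj] by simp
  moreover have "finite M"
  proof -
    have "M \<subseteq> Pow ({1} \<times> {..<n})" by (auto simp: M_def)
    then show ?thesis by (rule finite_subset) simp
  qed
  ultimately show ?thesis by (simp add: card_Pow ell_def M_def)
qed

lemma no_middle_colouring:
  assumes "compat a (colouring I J)" "compat b (colouring J K)"
  shows "compat (Gprime n a b) (colouring I K)"
  unfolding compat_def Gprime_edge using compat_stack[of I J K] assms rows_emb(3) by blast

theorem dmat_product: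
  assumes "I \<subseteq> {..<n}" "K \<subseteq> {..<n}"
  shows "(\<Sum>J\<in>Pow {..<n}. dmat a I J * dmat b J K) = 2 ^ ell n a b * dmat (Gprime n a b) I K"
proof -
  have "(\<Sum>J\<in>Pow {..<n}. dmat a I J * dmat b J K) =
      (\<Sum>J\<in>Pow {..<n}. of_bool (compat a (colouring I J) \<and> compat b (colouring J K)))"
    by (intro sum.cong) (auto simp: dmat_def)
  also have "\<dots> = card {J \<in> Pow {..<n}. compat a (colouring I J) \<and> compat b (colouring J K)}"
    by (subst sum_of_bool_eq) (auto intro!: arg_cong[of _ _ card])
  also have "\<dots> = 2 ^ ell n a b * dmat (Gprime n a b) I K"
  proof (cases "compat (Gprime n a b) (colouring I K)")
    case True
    then show ?thesis using card_middle_colourings[OF assms True] by (simp add: dmat_def)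
  next
    case False
    then have "{J \<in> Pow {..<n}. compat a (colouring I J) \<and> compat b (colouring J K)} = {}"
      using no_middle_colouring by auto
    then show ?thesis using False by (simp add: dmat_def)
  qed
  finally show ?thesis .
qed

end

text \<open>The empty colouring is compatible with everything and compares the powers of two. For an
  edge \<open>{u, v}\<close> of one diagram, colour just \<open>u\<close> and its partner in the
  other: this is compatible with the other diagram, hence with the first, so the partner has to be
  \<open>v\<close>.\<close>

lemma dmat_inject:
  assumes d: "d \<in> diagrams n" and d': "d' \<in> diagrams n"
    and eq: "\<And>I K. I \<subseteq> {..<n} \<Longrightarrow> K \<subseteq> {..<n} \<Longrightarrow> 2 ^ k * dmat d I K = 2 ^ k' * dmat d' I K"
  shows "k = k'" "d = d'"
proof -
  have "compat D (colouring {} {})" for D by (auto simp: compat_def colouring_def)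
  then have "dmat D {} {} = 1" for D by (simp add: dmat_def)
  then have "(2::nat) ^ k = 2 ^ k'" using eq[of "{}" "{}"] by simp
  then show k: "k = k'" by simp
  have compat_eq: "compat d S \<longleftrightarrow> compat d' S" if S: "S \<subseteq> verts n" for S
  proof -
    let ?I = "{i. (False, i) \<in> S}" and ?K = "{i. (True, i) \<in> S}"
    have "colouring ?I ?K = S"
    proof (intro set_eqI)
      fix v :: vert show "v \<in> colouring ?I ?K \<longleftrightarrow> v \<in> S" by (cases v; cases "fst v") auto
    qed
    moreover have "?I \<subseteq> {..<n}" "?K \<subseteq> {..<n}" using S by (auto simp: verts_def)
    ultimately show ?thesis using eq[of ?I ?K] k by (simp add: dmat_def of_bool_def split: if_splits)
  qed
  have sub: "d1 \<subseteq> d2" if d1: "d1 \<in> diagrams n" and d2: "d2 \<in> diagrams n"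
    and ce: "\<And>S. S \<subseteq> verts n \<Longrightarrow> compat d2 S \<Longrightarrow> compat d1 S" for d1 d2
  proof
    fix e assume e: "e \<in> d1"
    obtain u v where uv: "e = {u, v}" "u \<noteq> v" "u \<in> verts n" "v \<in> verts n" using diagram_edgeE[OF d1 e] .
    note m2 = diagram_matching[OF d2]
    let ?S = "{u, partner d2 u}"
    have "?S \<subseteq> verts n"
      using uv partner_edge[of d2 u] diagram_verts[OF d2, of "partner d2 u" u]
      by (cases "partner d2 u = u") (auto simp: insert_commute)
    moreover have "compat d2 ?S"
      unfolding compat_def
    proof (intro allI impI)
      fix y z assume yz: "{y, z} \<in> d2"
      have p: "partner d2 y = z" "partner d2 z = y"
        using partner_eq[OF m2 yz] partner_eq[OF m2, of z y] yz by (auto simp: insert_commute)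
      have "partner d2 x \<in> ?S" if "x \<in> ?S" for x using that partner_partner[OF m2, of u] by auto
      from this[of y] this[of z] show "y \<in> ?S \<longleftrightarrow> z \<in> ?S" unfolding p by blast
    qed
    ultimately have "compat d1 ?S" using ce by blast
    then have "v \<in> ?S" using e uv unfolding compat_def by blast
    then have "partner d2 u = v" using uv by auto
    then show "e \<in> d2" using partner_edge[of d2 u] uv by auto
  qed
  show "d = d'" using sub[OF d d'] sub[OF d' d] compat_eq by blast
qed

lemma product_eqI:
  assumes "a \<in> diagrams n" "b \<in> diagrams n" "d \<in> diagrams n"
    and "\<And>I K. I \<subseteq> {..<n} \<Longrightarrow> K \<subseteq> {..<n} \<Longrightarrow>
      (\<Sum>J\<in>Pow {..<n}. dmat a I J * dmat b J K) = 2 ^ k * dmat d I K"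
  shows "Gprime n a b = d" "ell n a b = k"
  using dmat_inject[of "Gprime n a b" n d "ell n a b" k] Gprime_diagram[OF assms(1,2)] assms
    dmat_product[OF assms(1,2)] by auto

text \<open>Associativity of matrix multiplication, transported through \<open>dmat\<close>. The
  entries with their powers of two determine the diagram and also the exponent, which yields the
  identity for \<open>ell\<close>.\<close>

lemma product_assoc:
  assumes a: "a \<in> diagrams n" and b: "b \<in> diagrams n" and c: "c \<in> diagrams n"
  shows "Gprime n (Gprime n a b) c = Gprime n a (Gprime n b c)"
    and "ell n a b + ell n (Gprime n a b) c = ell n b c + ell n a (Gprime n b c)"
proof -
  have ab: "Gprime n a b \<in> diagrams n" and bc: "Gprime n b c \<in> diagrams n"
    using Gprime_diagram a b c by auto
  have eq: "2 ^ (ell n a b + ell n (Gprime n a b) c) * dmat (Gprime n (Gprime n a b) c) I L =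
      2 ^ (ell n b c + ell n a (Gprime n b c)) * dmat (Gprime n a (Gprime n b c)) I L"
    if I: "I \<subseteq> {..<n}" and L: "L \<subseteq> {..<n}" for I L
  proof -
    let ?P = "Pow {..<n}"
    have "2 ^ (ell n a b + ell n (Gprime n a b) c) * dmat (Gprime n (Gprime n a b) c) I L =
        2 ^ ell n a b * (\<Sum>K\<in>?P. dmat (Gprime n a b) I K * dmat c K L)"
      unfolding dmat_product[OF ab c I L] by (simp add: power_add)
    also have "\<dots> = (\<Sum>K\<in>?P. (\<Sum>J\<in>?P. dmat a I J * dmat b J K) * dmat c K L)"
      unfolding sum_distrib_left
      by (intro sum.cong refl) (use dmat_product[OF a b I] in auto)
    also have "\<dots> = (\<Sum>J\<in>?P. \<Sum>K\<in>?P. dmat a I J * (dmat b J K * dmat c K L))"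
      by (subst sum.swap) (simp add: sum_distrib_right mult.assoc)
    also have "\<dots> = (\<Sum>J\<in>?P. dmat a I J * (2 ^ ell n b c * dmat (Gprime n b c) J L))"
      unfolding sum_distrib_left[symmetric]
      by (intro sum.cong refl) (use dmat_product[OF b c _ L] in auto)
    also have "\<dots> = 2 ^ ell n b c * (\<Sum>J\<in>?P. dmat a I J * dmat (Gprime n b c) J L)"
      unfolding sum_distrib_left by (intro sum.cong refl) simp
    also have "\<dots> = 2 ^ (ell n b c + ell n a (Gprime n b c)) * dmat (Gprime n a (Gprime n b c)) I L"
      unfolding dmat_product[OF a bc I L] by (simp add: power_add)
    finally show ?thesis .
  qed
  show "Gprime n (Gprime n a b) c = Gprime n a (Gprime n b c)"
    "ell n a b + ell n (Gprime n a b) c = ell n b c + ell n a (Gprime n b c)"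
    using dmat_inject[OF Gprime_diagram[OF ab c] Gprime_diagram[OF a bc] eq] by auto
qed

section \<open>The diagram algebra\<close>

definition scl :: "'a::field \<Rightarrow> (diagram \<Rightarrow> 'a) \<Rightarrow> diagram \<Rightarrow> 'a" where
  "scl r f = (\<lambda>D. r * f D)"

definition delta :: "diagram \<Rightarrow> diagram \<Rightarrow> 'a::field" where
  "delta D = (\<lambda>c. if c = D then 1 else 0)"

lemma scl_apply [simp]: "scl r f D = r * f D"
  by (simp add: scl_def)

lemma delta_apply: "delta D c = (if c = D then 1 else 0)"
  by (simp add: delta_def)

lemma sum_fun_apply: "(sum f A) x = (\<Sum>i\<in>A. f i x)"
  by (induction A rule: infinite_finite_induct) auto

text \<open>Pairing a product with an arbitrary \<open>F\<close> removes the condition on the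
  resulting diagram. Associativity is obtained by taking for \<open>F\<close> the coefficient of a
  further product.\<close>

lemma An_mult_sum:
  "(\<Sum>d\<in>diagrams n. An_mult n x f g d * F d) =
     (\<Sum>a\<in>diagrams n. \<Sum>b\<in>diagrams n. f a * g b * x ^ ell n a b * F (Gprime n a b))"
proof -
  have "(\<Sum>d\<in>diagrams n. An_mult n x f g d * F d) =
      (\<Sum>d\<in>diagrams n. \<Sum>a\<in>diagrams n. \<Sum>b\<in>diagrams n.
        (if Gprime n a b = d then f a * g b * x ^ ell n a b * F d else 0))"
    by (auto simp: An_mult_def sum_distrib_right intro!: sum.cong)
  also have "\<dots> = (\<Sum>a\<in>diagrams n. \<Sum>d\<in>diagrams n. \<Sum>b\<in>diagrams n.
        (if Gprime n a b = d then f a * g b * x ^ ell n a b * F d else 0))"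
    by (rule sum.swap)
  also have "\<dots> = (\<Sum>a\<in>diagrams n. \<Sum>b\<in>diagrams n. \<Sum>d\<in>diagrams n.
        (if Gprime n a b = d then f a * g b * x ^ ell n a b * F d else 0))"
    by (rule sum.cong[OF refl], rule sum.swap)
  also have "\<dots> = (\<Sum>a\<in>diagrams n. \<Sum>b\<in>diagrams n. f a * g b * x ^ ell n a b * F (Gprime n a b))"
    by (intro sum.cong refl) (simp add: sum.delta' finite_diagrams Gprime_diagram)
  finally show ?thesis .
qed

lemma An_mult_assoc: "An_mult n x (An_mult n x f g) h = An_mult n x f (An_mult n x g h)"
proof
  fix c
  let ?D = "diagrams n" and ?A = "An_mult n x" and ?G = "Gprime n" and ?l = "ell n"
  have "?A (?A f g) h c = (\<Sum>d\<in>?D. ?A f g d * (\<Sum>e\<in>?D. if ?G d e = c then h e * x ^ ?l d e else 0))"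
    unfolding An_mult_def[of n x "An_mult n x f g" h]
    by (simp add: sum_distrib_left if_distrib[where f = "\<lambda>y. z * y" for z] mult.assoc cong: if_cong)
  also have "\<dots> = (\<Sum>a\<in>?D. \<Sum>b\<in>?D. f a * g b * x ^ ?l a b *
      (\<Sum>e\<in>?D. if ?G (?G a b) e = c then h e * x ^ ?l (?G a b) e else 0))"
    by (rule An_mult_sum)
  also have "\<dots> = (\<Sum>a\<in>?D. \<Sum>b\<in>?D. \<Sum>e\<in>?D.
      f a * (g b * h e * x ^ ?l b e * (if ?G a (?G b e) = c then x ^ ?l a (?G b e) else 0)))"
    unfolding sum_distrib_left
  proof (intro sum.cong refl)
    fix a b e assume "a \<in> ?D" "b \<in> ?D" "e \<in> ?D"
    note as = product_assoc[OF this]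
    have "x ^ ?l a b * x ^ ?l (?G a b) e = x ^ ?l b e * x ^ ?l a (?G b e)"
      using as(2) by (simp flip: power_add)
    then show "f a * g b * x ^ ?l a b * (if ?G (?G a b) e = c then h e * x ^ ?l (?G a b) e else 0) =
      f a * (g b * h e * x ^ ?l b e * (if ?G a (?G b e) = c then x ^ ?l a (?G b e) else 0))"
      using as(1) by (simp add: mult.left_commute mult.assoc)
  qed
  also have "\<dots> = (\<Sum>a\<in>?D. f a * (\<Sum>d\<in>?D. ?A g h d * (if ?G a d = c then x ^ ?l a d else 0)))"
    unfolding An_mult_sum by (simp add: sum_distrib_left)
  also have "\<dots> = ?A f (?A g h) c"
    unfolding An_mult_def[of n x f "An_mult n x g h"]
    by (simp add: sum_distrib_left if_distrib[where f = "\<lambda>y. z * y" for z] mult.assoc cong: if_cong)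
  finally show "?A (?A f g) h c = ?A f (?A g h) c" .
qed

lemma An_mult_add_left: "An_mult n x (f + g) h = An_mult n x f h + An_mult n x g h"
  by (rule ext) (auto simp: An_mult_def sum.distrib[symmetric] algebra_simps intro!: sum.cong)

lemma An_mult_add_right: "An_mult n x h (f + g) = An_mult n x h f + An_mult n x h g"
  by (rule ext) (auto simp: An_mult_def sum.distrib[symmetric] algebra_simps intro!: sum.cong)

lemma An_mult_scl_left: "An_mult n x (scl r f) g = scl r (An_mult n x f g)"
  by (rule ext) (auto simp: An_mult_def sum_distrib_left algebra_simps intro!: sum.cong)

lemma An_mult_scl_right: "An_mult n x f (scl r g) = scl r (An_mult n x f g)"
  by (rule ext) (auto simp: An_mult_def sum_distrib_left algebra_simps intro!: sum.cong)

lemma An_algebra: "assoc_algebra scl (An_mult n x)"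
proof
  show "An_mult n x (An_mult n x a b) c = An_mult n x a (An_mult n x b c)" for a b c
    by (rule An_mult_assoc)
qed (auto simp: An_mult_add_left An_mult_add_right An_mult_scl_left An_mult_scl_right
    fun_eq_iff algebra_simps)

lemma An_mult_delta_left:
  assumes "a \<in> diagrams n"
  shows "An_mult n x (delta a) g c = (\<Sum>b\<in>diagrams n. if Gprime n a b = c then g b * x ^ ell n a b else 0)"
proof -
  have "An_mult n x (delta a) g c = (\<Sum>a'\<in>diagrams n. if a' = a then (\<Sum>b\<in>diagrams n.
      if Gprime n a b = c then g b * x ^ ell n a b else 0) else 0)"
    unfolding An_mult_def by (intro sum.cong refl) (simp add: delta_apply cong: if_cong)
  then show ?thesis using assms by (simp add: sum.delta finite_diagrams)
qed

lemma An_mult_delta: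
  assumes "a \<in> diagrams n" "b \<in> diagrams n"
  shows "An_mult n x (delta a) (delta b) = scl (x ^ ell n a b) (delta (Gprime n a b))"
proof
  fix c
  have "An_mult n x (delta a) (delta b) c = (\<Sum>b'\<in>diagrams n.
      if b' = b then (if Gprime n a b = c then x ^ ell n a b else 0) else 0)"
    unfolding An_mult_delta_left[OF assms(1)] by (intro sum.cong refl) (auto simp: delta_apply)
  then show "An_mult n x (delta a) (delta b) c = scl (x ^ ell n a b) (delta (Gprime n a b)) c"
    using assms by (simp add: sum.delta finite_diagrams delta_apply)
qed

lemma An_mult_carrier: "An_mult n x f g \<in> An_carrier n"
  unfolding An_carrier_def An_mult_def using Gprime_diagram by (auto intro!: sum.neutral)

lemma delta_carrier: "D \<in> diagrams n \<Longrightarrow> delta D \<in> An_carrier n"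
  by (auto simp: An_carrier_def delta_apply)

lemma An_expand:
  assumes "f \<in> An_carrier n"
  shows "f = (\<Sum>D\<in>diagrams n. scl (f D) (delta D))"
proof
  fix c
  have "(\<Sum>D\<in>diagrams n. scl (f D) (delta D)) c = (\<Sum>D\<in>diagrams n. if c = D then f D else 0)"
    by (simp add: sum_fun_apply delta_apply if_distrib[where f = "\<lambda>y. z * y" for z] cong: if_cong)
  also have "\<dots> = f c" using assms by (simp add: sum.delta finite_diagrams An_carrier_def)
  finally show "f c = (\<Sum>D\<in>diagrams n. scl (f D) (delta D)) c" by simp
qed

section \<open>Flips, permutation diagrams and their action on top vertices\<close>

lemma compat_image:
  assumes "matching D"
  shows "compat ((`) f ` D) S \<longleftrightarrow> compat D (f -` S)"
proof
  assume c: "compat ((`) f ` D) S"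
  show "compat D (f -` S)" unfolding compat_def
  proof (intro allI impI)
    fix u v assume "{u, v} \<in> D"
    then have "{f u, f v} \<in> (`) f ` D" using imageI[of "{u, v}" D "(`) f"] by simp
    then show "u \<in> f -` S \<longleftrightarrow> v \<in> f -` S" using c unfolding compat_def by auto
  qed
next
  assume c: "compat D (f -` S)"
  show "compat ((`) f ` D) S" unfolding compat_def
  proof (intro allI impI)
    fix u v assume "{u, v} \<in> (`) f ` D"
    then obtain e where e: "e \<in> D" "{u, v} = f ` e" by auto
    obtain p q where pq: "e = {p, q}" using matching_edge[OF assms e(1)] by blast
    then have "f p \<in> S \<longleftrightarrow> f q \<in> S" using c e unfolding compat_def by auto
    then show "u \<in> S \<longleftrightarrow> v \<in> S" using e(2) pq by (auto simp: doubleton_eq_iff)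
  qed
qed

lemma compat_cong:
  assumes "D \<in> diagrams n" "\<And>v. v \<in> verts n \<Longrightarrow> v \<in> S \<longleftrightarrow> v \<in> S'"
  shows "compat D S \<longleftrightarrow> compat D S'"
proof -
  have "(u \<in> S \<longleftrightarrow> v \<in> S) \<longleftrightarrow> (u \<in> S' \<longleftrightarrow> v \<in> S')" if "{u, v} \<in> D" for u v
    using assms(2) diagram_verts[OF assms(1), of u v] diagram_verts[OF assms(1), of v u] that
    by (simp add: insert_commute)
  then show ?thesis unfolding compat_def by blast
qed

lemma image_diagram:
  assumes "D \<in> diagrams n" "inj f" "\<And>v. v \<in> verts n \<Longrightarrow> f v \<in> verts n"
  shows "(`) f ` D \<in> diagrams n"
proof (rule diagramI)
  show "matching ((`) f ` D)" using assms matching_image diagram_matching by blast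
  fix u v assume "{u, v} \<in> (`) f ` D"
  then obtain e where e: "e \<in> D" "{u, v} = f ` e" by auto
  obtain p q where pq: "e = {p, q}" "p \<in> verts n" "q \<in> verts n" using diagram_edgeE[OF assms(1) e(1)] by metis
  then show "u \<in> verts n" using e(2) assms(3)[OF pq(2)] assms(3)[OF pq(3)] by (auto simp: doubleton_eq_iff)
qed

definition flip_vert :: "vert \<Rightarrow> vert" where "flip_vert v = (\<not> fst v, snd v)"
definition flip :: "diagram \<Rightarrow> diagram" where "flip D = (`) flip_vert ` D"
definition top_map :: "(nat \<Rightarrow> nat) \<Rightarrow> vert \<Rightarrow> vert" where
  "top_map w v = (fst v, if fst v then snd v else w (snd v))"
definition act :: "(nat \<Rightarrow> nat) \<Rightarrow> diagram \<Rightarrow> diagram" where "act w D = (`) (top_map w) ` D"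
text \<open>Indexed by the bottom vertex: in this orientation stacking \<open>v\<close> above
  \<open>w\<close> gives \<open>v \<circ> w\<close>.\<close>

definition perm_diag :: "nat \<Rightarrow> (nat \<Rightarrow> nat) \<Rightarrow> diagram" where
  "perm_diag n w = {{(False, w i), (True, i)} | i. i < n}"

lemma flip_vert_flip_vert: "flip_vert (flip_vert v) = v"
  by (simp add: flip_vert_def)

lemma flip_flip: "flip (flip D) = D"
  by (simp add: flip_def image_image flip_vert_flip_vert)

lemma flip_diagram: "D \<in> diagrams n \<Longrightarrow> flip D \<in> diagrams n"
  unfolding flip_def
  by (rule image_diagram) (auto simp: inj_def flip_vert_def verts_def prod_eq_iff)

lemma dmat_flip:
  assumes "D \<in> diagrams n"
  shows "dmat (flip D) I J = dmat D J I"
proof -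
  have "flip_vert -` colouring I J = colouring J I" by (auto simp: flip_vert_def colouring_def)
  then show ?thesis
    unfolding dmat_def flip_def compat_image[OF diagram_matching[OF assms]] by simp
qed

lemma flip_product:
  assumes a: "a \<in> diagrams n" and b: "b \<in> diagrams n"
  shows "Gprime n (flip b) (flip a) = flip (Gprime n a b)" "ell n (flip b) (flip a) = ell n a b"
proof -
  have "(\<Sum>J\<in>Pow {..<n}. dmat (flip b) I J * dmat (flip a) J K) =
      2 ^ ell n a b * dmat (flip (Gprime n a b)) I K" if "I \<subseteq> {..<n}" "K \<subseteq> {..<n}" for I K
    using dmat_product[OF a b that(2,1)] a b Gprime_diagram[OF a b]
    by (simp add: dmat_flip[of _ n] mult.commute)
  note product_eqI[OF flip_diagram[OF b] flip_diagram[OF a] flip_diagram[OF Gprime_diagram[OF a b]] this]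
  then show "Gprime n (flip b) (flip a) = flip (Gprime n a b)" "ell n (flip b) (flip a) = ell n a b" by auto
qed

definition flipf :: "(diagram \<Rightarrow> 'a) \<Rightarrow> diagram \<Rightarrow> 'a" where "flipf f = (\<lambda>D. f (flip D))"

lemma flipf_flipf: "flipf (flipf f) = f"
  by (simp add: flipf_def flip_flip)

lemma flipf_delta: "flipf (delta D) = delta (flip D)"
  by (rule ext) (auto simp: flipf_def delta_apply flip_flip)

lemma flipf_mult: "flipf (An_mult n (x::'a::field) f g) = An_mult n x (flipf g) (flipf f)"
proof
  fix c
  have bij: "bij_betw flip (diagrams n) (diagrams n)"
    by (rule bij_betw_byWitness[where f' = flip]) (auto simp: flip_flip flip_diagram)
  have r: "(\<Sum>a\<in>diagrams n. h (flip a)) = (\<Sum>a\<in>diagrams n. h a)" for h :: "diagram \<Rightarrow> 'a"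
    by (rule sum.reindex_bij_betw[OF bij])
  have "flipf (An_mult n x f g) c = (\<Sum>a\<in>diagrams n. \<Sum>b\<in>diagrams n.
      (if Gprime n a b = flip c then f a * g b * x ^ ell n a b else 0))"
    by (simp add: flipf_def An_mult_def)
  also have "\<dots> = (\<Sum>b\<in>diagrams n. \<Sum>a\<in>diagrams n.
      (if Gprime n a b = flip c then f a * g b * x ^ ell n a b else 0))"
    by (rule sum.swap)
  also have "\<dots> = (\<Sum>b\<in>diagrams n. \<Sum>a\<in>diagrams n.
      (if Gprime n (flip a) (flip b) = flip c then f (flip a) * g (flip b) * x ^ ell n (flip a) (flip b) else 0))"
    by (subst r[symmetric], rule sum.cong[OF refl], rule r[symmetric])
  also have "\<dots> = An_mult n x (flipf g) (flipf f) c"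
    unfolding An_mult_def flipf_def
  proof (intro sum.cong refl)
    fix a b assume "b \<in> diagrams n" "a \<in> diagrams n"
    note fp = flip_product[OF this]
    have "Gprime n (flip a) (flip b) = flip c \<longleftrightarrow> Gprime n b a = c"
      unfolding fp(1) using flip_flip by metis
    then show "(if Gprime n (flip a) (flip b) = flip c then f (flip a) * g (flip b) * x ^ ell n (flip a) (flip b) else 0) =
      (if Gprime n b a = c then g (flip b) * f (flip a) * x ^ ell n b a else 0)"
      using fp(2) by (simp add: mult.commute)
  qed
  finally show "flipf (An_mult n x f g) c = An_mult n x (flipf g) (flipf f) c" .
qed

lemma perm_diag_edge:
  "{u, v} \<in> perm_diag n w \<longleftrightarrow>
     (\<exists>i<n. u = (False, w i) \<and> v = (True, i) \<or> v = (False, w i) \<and> u = (True, i))"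
  unfolding perm_diag_def by (auto simp: doubleton_eq_iff)

lemma perm_diag_diagram:
  assumes "w permutes {..<n}"
  shows "perm_diag n w \<in> diagrams n"
proof (rule diagramI)
  have lt: "w i < n" if "i < n" for i using permutes_in_image[OF assms, of i] that by simp
  show "matching (perm_diag n w)"
  proof (rule matchingI)
    show "\<exists>u v. e = {u, v} \<and> u \<noteq> v" if e: "e \<in> perm_diag n w" for e
    proof -
      obtain i where "e = {(False, w i), (True, i)}" using e unfolding perm_diag_def by blast
      then show ?thesis by (intro exI[of _ "(False, w i)"] exI[of _ "(True, i)"]) simp
    qed
    show "v = y" if "{u, v} \<in> perm_diag n w" "{u, y} \<in> perm_diag n w" for u v y
      using that permutes_inj[OF assms] unfolding perm_diag_edge by (auto dest: injD)
  qed
  show "u \<in> verts n" if "{u, v} \<in> perm_diag n w" for u v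
    using that lt unfolding perm_diag_edge verts_def by auto
qed

lemma dmat_perm_diag: "dmat (perm_diag n w) I J = of_bool (\<forall>i<n. w i \<in> I \<longleftrightarrow> i \<in> J)"
proof -
  have "compat (perm_diag n w) (colouring I J) \<longleftrightarrow> (\<forall>i<n. w i \<in> I \<longleftrightarrow> i \<in> J)"
  proof
    assume c: "compat (perm_diag n w) (colouring I J)"
    show "\<forall>i<n. w i \<in> I \<longleftrightarrow> i \<in> J"
    proof (intro allI impI)
      fix i assume "i < n"
      then have "{(False, w i), (True, i)} \<in> perm_diag n w" unfolding perm_diag_def by blast
      then have "(False, w i) \<in> colouring I J \<longleftrightarrow> (True, i) \<in> colouring I J"
        using c unfolding compat_def by blast
      then show "w i \<in> I \<longleftrightarrow> i \<in> J" by simp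
    qed
  qed (auto simp: compat_def perm_diag_edge)
  then show ?thesis by (simp add: dmat_def)
qed

lemma act_diagram:
  assumes "D \<in> diagrams n" "w permutes {..<n}"
  shows "act w D \<in> diagrams n"
  unfolding act_def
proof (rule image_diagram[OF assms(1)])
  have "top_map (inv w) (top_map w v) = v" for v
    using permutes_inverses(2)[OF assms(2)] by (cases v) (simp add: top_map_def)
  then show "inj (top_map w)" by (rule inj_on_inverseI)
  show "top_map w v \<in> verts n" if "v \<in> verts n" for v
    using that permutes_in_image[OF assms(2), of "snd v"] by (cases v) (simp add: top_map_def verts_def)
qed

text \<open>Every middle colour is determined by a top colour, so only the preimage of
  \<open>I\<close> under \<open>w\<close> contributes to the sum over the middle row.\<close>

lemma perm_product:
  assumes D: "D \<in> diagrams n" and w: "w permutes {..<n}"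
  shows "Gprime n (perm_diag n w) D = act w D" "ell n (perm_diag n w) D = 0"
proof -
  have "(\<Sum>J\<in>Pow {..<n}. dmat (perm_diag n w) I J * dmat D J K) = 2 ^ 0 * dmat (act w D) I K"
    if I: "I \<subseteq> {..<n}" and K: "K \<subseteq> {..<n}" for I K
  proof -
    let ?J = "w -` I"
    have J: "?J \<subseteq> {..<n}" using I permutes_in_image[OF w] by fastforce
    have "(\<Sum>J\<in>Pow {..<n}. dmat (perm_diag n w) I J * dmat D J K) =
        (\<Sum>J\<in>Pow {..<n}. if J = ?J then dmat D ?J K else 0)"
    proof (rule sum.cong[OF refl])
      fix J assume "J \<in> Pow {..<n}"
      then have "(\<forall>i<n. w i \<in> I \<longleftrightarrow> i \<in> J) \<longleftrightarrow> J = ?J" using J by auto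
      then show "dmat (perm_diag n w) I J * dmat D J K = (if J = ?J then dmat D ?J K else 0)"
        by (simp add: dmat_perm_diag)
    qed
    also have "\<dots> = dmat D ?J K" using J by (simp add: sum.delta)
    also have "\<dots> = dmat (act w D) I K"
    proof -
      have "top_map w -` colouring I K = colouring ?J K" by (auto simp: top_map_def colouring_def)
      then show ?thesis unfolding dmat_def act_def compat_image[OF diagram_matching[OF D]] by simp
    qed
    finally show ?thesis by simp
  qed
  note product_eqI[OF perm_diag_diagram[OF w] D act_diagram[OF D w] this]
  then show "Gprime n (perm_diag n w) D = act w D" "ell n (perm_diag n w) D = 0" by auto
qed

lemma act_perm_diag: "act v (perm_diag n w) = perm_diag n (v \<circ> w)"
proof -
  have "perm_diag n w = (\<lambda>i. {(False, w i), (True, i)}) ` {..<n}" for w unfolding perm_diag_def by auto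
  then show ?thesis by (simp add: act_def image_image top_map_def)
qed

lemma flip_perm_diag:
  assumes "w permutes {..<n}"
  shows "flip (perm_diag n w) = perm_diag n (inv w)"
proof -
  have "perm_diag n w = (\<lambda>i. {(False, w i), (True, i)}) ` {..<n}" for w unfolding perm_diag_def by auto
  then have "flip (perm_diag n w) = (\<lambda>i. {(False, i), (True, w i)}) ` {..<n}"
    by (simp add: flip_def image_image flip_vert_def insert_commute)
  also have "\<dots> = (\<lambda>i. {(False, i), (True, w i)}) ` inv w ` {..<n}"
    using permutes_image[OF permutes_inv[OF assms]] by simp
  also have "\<dots> = perm_diag n (inv w)"
    unfolding perm_diag_def image_image using permutes_inverses(1)[OF assms] by auto
  finally show ?thesis .
qed

lemma perm_diag_inject:
  assumes "v permutes {..<n}" "w permutes {..<n}" "perm_diag n v = perm_diag n w"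
  shows "v = w"
proof
  fix i
  show "v i = w i"
  proof (cases "i < n")
    case True
    then have "{(False, v i), (True, i)} \<in> perm_diag n w" using assms(3) by (auto simp: perm_diag_def)
    then show ?thesis unfolding perm_diag_edge by auto
  next
    case False
    then show ?thesis using assms(1,2) by (simp add: permutes_not_in)
  qed
qed

lemma act_id: "act id D = D"
proof -
  have "top_map id = id" by (auto simp: top_map_def fun_eq_iff prod_eq_iff)
  then show ?thesis by (simp add: act_def)
qed

lemma An_perm_algebra:
  "perm_algebra scl (An_mult n (x::'a::field_char_0)) n (\<lambda>w. delta (perm_diag n w)) flipf
     (\<lambda>f. f (perm_diag n id))"
proof -
  interpret assoc_algebra scl "An_mult n x" by (rule An_algebra)
  show ?thesis
  proof
    fix v w assume vw: "v permutes {..<n}" "w permutes {..<n}"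
    show "An_mult n x (delta (perm_diag n v)) (delta (perm_diag n w)) = delta (perm_diag n (v \<circ> w))"
      using An_mult_delta[OF perm_diag_diagram[OF vw(1)] perm_diag_diagram[OF vw(2)], of x]
        perm_product[OF perm_diag_diagram[OF vw(2)] vw(1)] by (simp add: act_perm_diag fun_eq_iff)
  next
    fix w assume w: "w permutes {..<n}"
    show "flipf (delta (perm_diag n w)) = delta (perm_diag n (inv w))"
      by (simp add: flipf_delta flip_perm_diag[OF w])
    show "delta (perm_diag n w) (perm_diag n id) = (if w = id then 1 else (0::'a))"
      using perm_diag_inject[OF permutes_id w] by (auto simp: delta_apply)
  next
    show "flipf (An_mult n x f g) = An_mult n x (flipf g) (flipf f)" for f g by (rule flipf_mult)
  qed (auto simp: flipf_def fun_eq_iff)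
qed

lemma An_unital: "assoc_algebra.unital_subalgebra scl (An_mult n x) (An_carrier n) (delta (perm_diag n id))"
proof -
  interpret assoc_algebra scl "An_mult n x" by (rule An_algebra)
  note idD = perm_diag_diagram[OF permutes_id, of n]
  have left: "An_mult n x (delta (perm_diag n id)) f = f" if f: "f \<in> An_carrier n" for f
  proof
    fix c
    have "An_mult n x (delta (perm_diag n id)) f c = (\<Sum>b\<in>diagrams n. if b = c then f b else 0)"
      unfolding An_mult_delta_left[OF idD]
    proof (rule sum.cong[OF refl])
      fix b assume "b \<in> diagrams n"
      from perm_product[OF this permutes_id]
      show "(if Gprime n (perm_diag n id) b = c then f b * x ^ ell n (perm_diag n id) b else 0) =
          (if b = c then f b else 0)" by (simp only: act_id) simp
    qed
    then show "An_mult n x (delta (perm_diag n id)) f c = f c"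
      using f by (auto simp: sum.delta finite_diagrams An_carrier_def)
  qed
  have flipc: "flipf f \<in> An_carrier n" if "f \<in> An_carrier n" for f :: "diagram \<Rightarrow> 'a"
  proof -
    have "flip D \<notin> diagrams n" if "D \<notin> diagrams n" for D
      using that flip_diagram[of "flip D" n] by (auto simp: flip_flip)
    then show ?thesis using that by (simp add: An_carrier_def flipf_def)
  qed
  have right: "An_mult n x f (delta (perm_diag n id)) = f" if f: "f \<in> An_carrier n" for f
    using arg_cong[OF left[OF flipc[OF f]], of flipf]
    by (simp add: flipf_mult flipf_flipf flipf_delta flip_perm_diag[OF permutes_id])
  have "subspace (An_carrier n)" unfolding subspace_def by (auto simp: An_carrier_def)
  then show ?thesis unfolding unital_subalgebra_def
    using left right An_mult_carrier[of n x] delta_carrier[OF idD] by blast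
qed

section \<open>Multiplication by dots and hooks\<close>

definition dot :: "nat \<Rightarrow> nat \<Rightarrow> diagram" where
  "dot n i = {{(False, k), (True, k)} | k. k < n \<and> k \<noteq> i}"

text \<open>The cap-and-cup generator of the Brauer algebra. The analogue for loops is
  \<open>dot\<close>: as a left factor it detaches a top vertex, while a hook joins two of
  them.\<close>

definition hook :: "nat \<Rightarrow> nat \<Rightarrow> nat \<Rightarrow> diagram" where
  "hook n i j = {{(False, k), (True, k)} | k. k < n \<and> k \<noteq> i \<and> k \<noteq> j} \<union>
     {{(False, i), (False, j)}, {(True, i), (True, j)}}"

lemma subset_diagram: "D \<in> diagrams n \<Longrightarrow> D' \<subseteq> D \<Longrightarrow> D' \<in> diagrams n"
  unfolding diagrams_def is_diagram_def mem_Collect_eq by (intro conjI; simp add: subset_iff)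

lemma insert_diagram:
  assumes "D \<in> diagrams n" "u \<in> verts n" "v \<in> verts n" "u \<noteq> v" "u \<notin> \<Union>D" "v \<notin> \<Union>D"
  shows "insert {u, v} D \<in> diagrams n"
proof (rule diagramI)
  have dis: "{u, v} \<inter> e = {}" if "e \<in> D" for e using assms(5,6) that by auto
  show "matching (insert {u, v} D)"
    unfolding matching_def
  proof (intro conjI ballI impI)
    fix e assume e: "e \<in> insert {u, v} D"
    show "\<exists>u v. e = {u, v} \<and> u \<noteq> v"
    proof (cases "e = {u, v}")
      case True then show ?thesis using assms(4) by blast
    next
      case False then show ?thesis using e matching_edge[OF diagram_matching[OF assms(1)], of e] by simp
    qed
    fix e' assume e': "e' \<in> insert {u, v} D" and ne: "e \<noteq> e'"
    show "e \<inter> e' = {}"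
    proof (cases "e = {u, v} \<or> e' = {u, v}")
      case True then show ?thesis using e e' ne dis by (auto simp: Int_commute)
    next
      case False
      then show ?thesis using e e' ne matching_disjoint[OF diagram_matching[OF assms(1)], of e e'] by simp
    qed
  qed
  fix y z assume yz: "{y, z} \<in> insert {u, v} D"
  show "y \<in> verts n"
  proof (cases "{y, z} = {u, v}")
    case True then show ?thesis using assms(2,3) by (auto simp: doubleton_eq_iff)
  next
    case False then show ?thesis using yz diagram_verts[OF assms(1)] by simp
  qed
qed

lemma compat_insert: "compat (insert {u, v} D) S \<longleftrightarrow> (u \<in> S \<longleftrightarrow> v \<in> S) \<and> compat D S"
  unfolding compat_def by (auto simp: doubleton_eq_iff)

lemma compat_Un: "compat (D \<union> D') S \<longleftrightarrow> compat D S \<and> compat D' S"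
  unfolding compat_def by blast

lemma compat_empty [simp]: "compat {} S"
  by (simp add: compat_def)

lemma compat_cong_edges:
  assumes "\<And>v. v \<in> \<Union>D \<Longrightarrow> v \<in> S \<longleftrightarrow> v \<in> S'"
  shows "compat D S \<longleftrightarrow> compat D S'"
proof -
  have "u \<in> \<Union>D" "v \<in> \<Union>D" if "{u, v} \<in> D" for u v using that by auto
  then show ?thesis unfolding compat_def using assms by blast
qed

lemma vertical_edges_compat:
  "compat {{(False, k), (True, k)} | k. k < n \<and> P k} (colouring I J) \<longleftrightarrow>
     (\<forall>k<n. P k \<longrightarrow> (k \<in> I \<longleftrightarrow> k \<in> J))"
proof
  assume c: "compat {{(False, k), (True, k)} | k. k < n \<and> P k} (colouring I J)"
  show "\<forall>k<n. P k \<longrightarrow> (k \<in> I \<longleftrightarrow> k \<in> J)"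
  proof (intro allI impI)
    fix k assume "k < n" "P k"
    then have "{(False, k), (True, k)} \<in> {{(False, k), (True, k)} | k. k < n \<and> P k}" by blast
    then have "(False, k) \<in> colouring I J \<longleftrightarrow> (True, k) \<in> colouring I J" using c unfolding compat_def by blast
    then show "k \<in> I \<longleftrightarrow> k \<in> J" by simp
  qed
next
  assume h: "\<forall>k<n. P k \<longrightarrow> (k \<in> I \<longleftrightarrow> k \<in> J)"
  show "compat {{(False, k), (True, k)} | k. k < n \<and> P k} (colouring I J)"
    unfolding compat_def
  proof (intro allI impI)
    fix u v assume "{u, v} \<in> {{(False, k), (True, k)} | k. k < n \<and> P k}"
    then obtain k where "{u, v} = {(False, k), (True, k)}" "k < n" "P k" by blast
    then show "u \<in> colouring I J \<longleftrightarrow> v \<in> colouring I J" using h by (auto simp: doubleton_eq_iff)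
  qed
qed

lemma dmat_dot: "dmat (dot n i) I J = of_bool (\<forall>k<n. k \<noteq> i \<longrightarrow> (k \<in> I \<longleftrightarrow> k \<in> J))"
  unfolding dmat_def dot_def vertical_edges_compat ..

lemma dmat_hook:
  "dmat (hook n i j) I J = of_bool ((\<forall>k<n. k \<noteq> i \<and> k \<noteq> j \<longrightarrow> (k \<in> I \<longleftrightarrow> k \<in> J)) \<and>
     (i \<in> I \<longleftrightarrow> j \<in> I) \<and> (i \<in> J \<longleftrightarrow> j \<in> J))"
  unfolding dmat_def hook_def compat_Un vertical_edges_compat compat_insert
  by (simp add: conj_commute)

lemma vertical_edges_diagram: "{{(False, k), (True, k)} | k. k < n \<and> P k} \<in> diagrams n"
proof (rule subset_diagram)
  show "perm_diag n id \<in> diagrams n" by (rule perm_diag_diagram[OF permutes_id])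
  show "{{(False, k), (True, k)} | k. k < n \<and> P k} \<subseteq> perm_diag n id"
    unfolding perm_diag_def by auto
qed

lemma dot_diagram: "dot n i \<in> diagrams n"
  unfolding dot_def by (rule vertical_edges_diagram)

lemma hook_diagram:
  assumes "i < n" "j < n" "i \<noteq> j"
  shows "hook n i j \<in> diagrams n"
proof -
  let ?V = "{{(False, k), (True, k)} | k. k < n \<and> k \<noteq> i \<and> k \<noteq> j}"
  have "hook n i j = insert {(False, i), (False, j)} (insert {(True, i), (True, j)} ?V)"
    unfolding hook_def by blast
  also have "\<dots> \<in> diagrams n"
    using assms by (intro insert_diagram vertical_edges_diagram) (auto simp: verts_def)
  finally show ?thesis .
qed

lemma hook_commute: "hook n i j = hook n j i"
  unfolding hook_def by (simp add: insert_commute conj_commute)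

text \<open>The colour of the middle vertex \<open>i\<close> is free and all other middle vertices
  copy the top, so two terms survive.\<close>

lemma dot_sum:
  assumes "I \<subseteq> {..<n}" "i < n"
  shows "(\<Sum>J\<in>Pow {..<n}. dmat (dot n i) I J * g J) = g (insert i I) + g (I - {i})"
proof -
  have "(\<Sum>J\<in>Pow {..<n}. dmat (dot n i) I J * g J) =
      (\<Sum>J\<in>{insert i I, I - {i}}. dmat (dot n i) I J * g J)"
  proof (rule sum.mono_neutral_right)
    show "\<forall>J\<in>Pow {..<n} - {insert i I, I - {i}}. dmat (dot n i) I J * g J = 0"
    proof
      fix J assume J: "J \<in> Pow {..<n} - {insert i I, I - {i}}"
      have "\<not> (\<forall>k<n. k \<noteq> i \<longrightarrow> (k \<in> I \<longleftrightarrow> k \<in> J))"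
      proof
        assume h: "\<forall>k<n. k \<noteq> i \<longrightarrow> (k \<in> I \<longleftrightarrow> k \<in> J)"
        have "J = insert i I \<or> J = I - {i}"
        proof (cases "i \<in> J")
          case True
          then have "J = insert i I" using h J assms by auto
          then show ?thesis ..
        next
          case False
          then have "J = I - {i}" using h J assms by auto
          then show ?thesis ..
        qed
        then show False using J by auto
      qed
      then show "dmat (dot n i) I J * g J = 0" by (simp add: dmat_dot)
    qed
  qed (use assms in auto)
  also have "insert i I \<noteq> I - {i}" by auto
  then have "(\<Sum>J\<in>{insert i I, I - {i}}. dmat (dot n i) I J * g J) = g (insert i I) + g (I - {i})"
    by (simp add: dmat_dot)
  finally show ?thesis .
qed

lemma hook_sum:
  assumes "I \<subseteq> {..<n}" "i < n" "j < n" "i \<noteq> j"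
  shows "(\<Sum>J\<in>Pow {..<n}. dmat (hook n i j) I J * g J) =
    of_bool (i \<in> I \<longleftrightarrow> j \<in> I) * (g (I \<union> {i, j}) + g (I - {i, j}))"
proof -
  have "(\<Sum>J\<in>Pow {..<n}. dmat (hook n i j) I J * g J) =
      (\<Sum>J\<in>{I \<union> {i, j}, I - {i, j}}. dmat (hook n i j) I J * g J)"
  proof (rule sum.mono_neutral_right)
    show "\<forall>J\<in>Pow {..<n} - {I \<union> {i, j}, I - {i, j}}. dmat (hook n i j) I J * g J = 0"
    proof
      fix J assume J: "J \<in> Pow {..<n} - {I \<union> {i, j}, I - {i, j}}"
      have "\<not> ((\<forall>k<n. k \<noteq> i \<and> k \<noteq> j \<longrightarrow> (k \<in> I \<longleftrightarrow> k \<in> J)) \<and> (i \<in> I \<longleftrightarrow> j \<in> I) \<and> (i \<in> J \<longleftrightarrow> j \<in> J))"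
      proof
        assume h: "(\<forall>k<n. k \<noteq> i \<and> k \<noteq> j \<longrightarrow> (k \<in> I \<longleftrightarrow> k \<in> J)) \<and> (i \<in> I \<longleftrightarrow> j \<in> I) \<and> (i \<in> J \<longleftrightarrow> j \<in> J)"
        have "J = I \<union> {i, j} \<or> J = I - {i, j}"
        proof (cases "i \<in> J")
          case True
          then have "J = I \<union> {i, j}" using h J assms by auto
          then show ?thesis ..
        next
          case False
          then have "J = I - {i, j}" using h J assms by auto
          then show ?thesis ..
        qed
        then show False using J by auto
      qed
      then show "dmat (hook n i j) I J * g J = 0" by (simp add: dmat_hook)
    qed
  qed (use assms in auto)
  also have "I \<union> {i, j} \<noteq> I - {i, j}" by auto
  then have "(\<Sum>J\<in>{I \<union> {i, j}, I - {i, j}}. dmat (hook n i j) I J * g J) =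
      of_bool (i \<in> I \<longleftrightarrow> j \<in> I) * (g (I \<union> {i, j}) + g (I - {i, j}))"
    by (simp add: dmat_hook)
  finally show ?thesis .
qed

lemma matching_insert_eq:
  assumes "matching D" "{u, p} \<in> D"
  shows "D = insert {u, p} {e \<in> D. u \<notin> e}"
proof (intro equalityI subsetI)
  fix e assume e: "e \<in> D"
  show "e \<in> insert {u, p} {e \<in> D. u \<notin> e}"
    using matching_disjoint[OF assms(1) e assms(2)] e by auto
qed (use assms in auto)

lemma colouring_insert: "colouring (insert i I) K = insert (False, i) (colouring I K)"
  "colouring (I - {i}) K = colouring I K - {(False, i)}"
  "colouring (I \<union> {i, j}) K = colouring I K \<union> {(False, i), (False, j)}"
  "colouring (I - {i, j}) K = colouring I K - {(False, i), (False, j)}"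
  by (auto simp: colouring_def split: if_splits)

lemma dot_product_isolated:
  assumes D: "D \<in> diagrams n" and i: "i < n" and iso: "(False, i) \<notin> \<Union>D"
  shows "Gprime n (dot n i) D = D" "ell n (dot n i) D = 1"
proof -
  have "(\<Sum>J\<in>Pow {..<n}. dmat (dot n i) I J * dmat D J K) = 2 ^ 1 * dmat D I K"
    if "I \<subseteq> {..<n}" "K \<subseteq> {..<n}" for I K
  proof -
    have "compat D (insert (False, i) (colouring I K)) = compat D (colouring I K)"
      "compat D (colouring I K - {(False, i)}) = compat D (colouring I K)"
      using iso by (auto intro!: compat_cong_edges)
    then show ?thesis unfolding dot_sum[OF that(1) i] by (simp add: dmat_def colouring_insert)
  qed
  note product_eqI[OF dot_diagram D D this]
  then show "Gprime n (dot n i) D = D" "ell n (dot n i) D = 1" by auto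
qed

lemma dot_product_joined:
  assumes D: "D \<in> diagrams n" and i: "i < n" and e: "{(False, i), p} \<in> D"
  shows "Gprime n (dot n i) D = {e \<in> D. (False, i) \<notin> e}" "ell n (dot n i) D = 0"
proof -
  let ?t = "(False, i)"
  let ?D = "{e \<in> D. ?t \<notin> e}"
  have D': "?D \<in> diagrams n" by (rule subset_diagram[OF D]) auto
  have Deq: "D = insert {?t, p} ?D" by (rule matching_insert_eq[OF diagram_matching[OF D] e])
  have c: "compat D S \<longleftrightarrow> (?t \<in> S \<longleftrightarrow> p \<in> S) \<and> compat ?D S" for S
    by (subst Deq) (rule compat_insert)
  have pt: "p \<noteq> ?t" using matching_irrefl[OF diagram_matching[OF D], of p] e by auto
  have "(\<Sum>J\<in>Pow {..<n}. dmat (dot n i) I J * dmat D J K) = 2 ^ 0 * dmat ?D I K"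
    if "I \<subseteq> {..<n}" "K \<subseteq> {..<n}" for I K
  proof -
    have "compat D (insert ?t (colouring I K)) \<longleftrightarrow> p \<in> colouring I K \<and> compat ?D (insert ?t (colouring I K))"
      "compat D (colouring I K - {?t}) \<longleftrightarrow> p \<notin> colouring I K \<and> compat ?D (colouring I K - {?t})"
      using pt by (auto simp: c)
    moreover have "compat ?D (insert ?t (colouring I K)) = compat ?D (colouring I K)"
      "compat ?D (colouring I K - {?t}) = compat ?D (colouring I K)"
      by (auto intro!: compat_cong_edges)
    ultimately show ?thesis unfolding dot_sum[OF that(1) i] by (simp add: dmat_def colouring_insert)
  qed
  note product_eqI[OF dot_diagram D D' this]
  then show "Gprime n (dot n i) D = ?D" "ell n (dot n i) D = 0" by auto
qed

context
  fixes n i j :: nat and D :: diagram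
  assumes D: "D \<in> diagrams n" and i: "i < n" and j: "j < n" and ij: "i \<noteq> j"
begin

abbreviation (input) "ti \<equiv> (False, i)"
abbreviation (input) "tj \<equiv> (False, j)"

text \<open>The middle vertices \<open>i\<close> and \<open>j\<close> share a colour, which may be
  either one; the top pair must agree, and the rest copies the top. Products with a hook thus reduce
  to an identity for each colouring \<open>S\<close>.\<close>

lemma hook_product_eqI:
  assumes R: "R \<in> diagrams n"
    and h: "\<And>S. of_bool (ti \<in> S \<longleftrightarrow> tj \<in> S) *
       (of_bool (compat D (S \<union> {ti, tj})) + of_bool (compat D (S - {ti, tj}))) = (2 ^ k * of_bool (compat R S) :: nat)"
  shows "Gprime n (hook n i j) D = R" "ell n (hook n i j) D = k"
proof -
  have "(\<Sum>J\<in>Pow {..<n}. dmat (hook n i j) I J * dmat D J K) = 2 ^ k * dmat R I K"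
    if "I \<subseteq> {..<n}" "K \<subseteq> {..<n}" for I K
    unfolding hook_sum[OF that(1) i j ij] using h[of "colouring I K"] by (simp add: dmat_def colouring_insert)
  note product_eqI[OF hook_diagram[OF i j ij] D R this]
  then show "Gprime n (hook n i j) D = R" "ell n (hook n i j) D = k" by auto
qed

lemma compat_avoid:
  assumes "ti \<notin> \<Union>R" "tj \<notin> \<Union>R"
  shows "compat R (S \<union> {ti, tj}) = compat R S" "compat R (S - {ti, tj}) = compat R S"
    "compat R (insert ti (insert tj S)) = compat R S"
  using assms by (auto intro!: compat_cong_edges)

lemma hook_product_cap:
  assumes "{ti, tj} \<in> D"
  shows "Gprime n (hook n i j) D = D" "ell n (hook n i j) D = 1"
proof -
  let ?R = "{e \<in> D. ti \<notin> e}"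
  have Deq: "D = insert {ti, tj} ?R" by (rule matching_insert_eq[OF diagram_matching[OF D] assms])
  have "tj \<notin> \<Union>?R"
    using matching_disjoint[OF diagram_matching[OF D] _ assms] by auto
  then have c: "compat D S \<longleftrightarrow> (ti \<in> S \<longleftrightarrow> tj \<in> S) \<and> compat ?R S"
    "compat ?R (S \<union> {ti, tj}) = compat ?R S" "compat ?R (S - {ti, tj}) = compat ?R S" for S
    using compat_avoid[of ?R S] by (subst Deq, auto simp: compat_insert)
  have "of_bool (ti \<in> S \<longleftrightarrow> tj \<in> S) * (of_bool (compat D (S \<union> {ti, tj})) +
      of_bool (compat D (S - {ti, tj}))) = (2 ^ 1 * of_bool (compat D S) :: nat)" for S
    unfolding c(1) c(2,3) by simp
  note hook_product_eqI[OF D this]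
  then show "Gprime n (hook n i j) D = D" "ell n (hook n i j) D = 1" by auto
qed

lemma verts_ti_tj: "ti \<in> verts n" "tj \<in> verts n" "ti \<noteq> tj"
  using i j ij by (auto simp: verts_def)

lemma hook_product_none:
  assumes "ti \<notin> \<Union>D" "tj \<notin> \<Union>D"
  shows "Gprime n (hook n i j) D = insert {ti, tj} D" "ell n (hook n i j) D = 1"
proof -
  have R: "insert {ti, tj} D \<in> diagrams n"
    by (rule insert_diagram[OF D verts_ti_tj assms])
  have "of_bool (ti \<in> S \<longleftrightarrow> tj \<in> S) * (of_bool (compat D (S \<union> {ti, tj})) +
      of_bool (compat D (S - {ti, tj}))) = (2 ^ 1 * of_bool (compat (insert {ti, tj} D) S) :: nat)" for S
    unfolding compat_avoid(1,2)[OF assms] compat_insert by simp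
  note hook_product_eqI[OF R this]
  then show "Gprime n (hook n i j) D = insert {ti, tj} D" "ell n (hook n i j) D = 1" by auto
qed

lemma hook_product_one:
  assumes e: "{ti, p} \<in> D" and iso: "tj \<notin> \<Union>D"
  shows "Gprime n (hook n i j) D = insert {ti, tj} {e \<in> D. ti \<notin> e}" "ell n (hook n i j) D = 0"
proof -
  let ?R = "{e \<in> D. ti \<notin> e}"
  have Deq: "D = insert {ti, p} ?R" by (rule matching_insert_eq[OF diagram_matching[OF D] e])
  have p: "p \<noteq> ti" "p \<noteq> tj" using matching_irrefl[OF diagram_matching[OF D], of p] e iso by auto
  have av: "ti \<notin> \<Union>?R" "tj \<notin> \<Union>?R" using iso by auto
  have R: "insert {ti, tj} ?R \<in> diagrams n"
    by (rule insert_diagram[OF subset_diagram[OF D] verts_ti_tj av]) auto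
  have c: "compat D S \<longleftrightarrow> (ti \<in> S \<longleftrightarrow> p \<in> S) \<and> compat ?R S" for S
    by (subst Deq) (rule compat_insert)
  have "of_bool (ti \<in> S \<longleftrightarrow> tj \<in> S) * (of_bool (compat D (S \<union> {ti, tj})) +
      of_bool (compat D (S - {ti, tj}))) = (2 ^ 0 * of_bool (compat (insert {ti, tj} ?R) S) :: nat)" for S
    unfolding c compat_avoid(1,2)[OF av] compat_insert using p by simp
  note hook_product_eqI[OF R this]
  then show "Gprime n (hook n i j) D = insert {ti, tj} ?R" "ell n (hook n i j) D = 0" by auto
qed

lemma hook_product_two:
  assumes e: "{ti, p} \<in> D" and e': "{tj, q} \<in> D" and pj: "p \<noteq> tj"
  shows "Gprime n (hook n i j) D = insert {ti, tj} (insert {p, q} {e \<in> D. ti \<notin> e \<and> tj \<notin> e})"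
    "ell n (hook n i j) D = 0"
proof -
  note m = diagram_matching[OF D]
  let ?R = "{e \<in> D. ti \<notin> e \<and> tj \<notin> e}"
  have e'i: "ti \<notin> {tj, q}"
    using matching_unique[OF m e, of q] matching_unique[OF m e, of tj] e' pj ij by (auto simp: insert_commute)
  have "D = insert {ti, p} {e \<in> D. ti \<notin> e}" by (rule matching_insert_eq[OF m e])
  also have "{e \<in> D. ti \<notin> e} = insert {tj, q} ?R"
    using matching_insert_eq[OF m e'] e' e'i by auto
  finally have Deq: "D = insert {ti, p} (insert {tj, q} ?R)" .
  have p: "p \<noteq> ti" "q \<noteq> tj" using matching_irrefl[OF m, of p] matching_irrefl[OF m, of q] e e' by auto
  have q: "q \<noteq> ti" using e'i by auto
  have pq: "p \<noteq> q"
    using matching_unique[OF m, of p ti tj] e e' ij by (auto simp: insert_commute)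
  have av: "ti \<notin> \<Union>?R" "tj \<notin> \<Union>?R" by auto
  have pR: "p \<notin> \<Union>?R" using matching_disjoint[OF m _ e] p by fastforce
  have qR: "q \<notin> \<Union>?R" using matching_disjoint[OF m _ e'] p by fastforce
  have pv: "p \<in> verts n" "q \<in> verts n"
    using diagram_verts[OF D, of p ti] diagram_verts[OF D, of q tj] e e' by (auto simp: insert_commute)
  have R0: "insert {p, q} ?R \<in> diagrams n"
    by (rule insert_diagram[OF subset_diagram[OF D] pv pq pR qR]) auto
  have R: "insert {ti, tj} (insert {p, q} ?R) \<in> diagrams n"
    by (rule insert_diagram[OF R0 verts_ti_tj]) (use p q pj in auto)
  have c: "compat D S \<longleftrightarrow> (ti \<in> S \<longleftrightarrow> p \<in> S) \<and> (tj \<in> S \<longleftrightarrow> q \<in> S) \<and> compat ?R S" for S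
    by (subst Deq) (simp add: compat_insert)
  have "of_bool (ti \<in> S \<longleftrightarrow> tj \<in> S) * (of_bool (compat D (S \<union> {ti, tj})) +
      of_bool (compat D (S - {ti, tj}))) =
      (2 ^ 0 * of_bool (compat (insert {ti, tj} (insert {p, q} ?R)) S) :: nat)" for S
    unfolding c compat_avoid(1,2)[OF av] compat_insert using p q pj by simp
  note hook_product_eqI[OF R this]
  then show "Gprime n (hook n i j) D = insert {ti, tj} (insert {p, q} ?R)" "ell n (hook n i j) D = 0" by auto
qed

end

lemma diagrams_mono: "D \<in> diagrams n \<Longrightarrow> n \<le> m \<Longrightarrow> D \<in> diagrams m"
  by (rule diagramI[OF diagram_matching]) (use diagram_verts in \<open>force simp: verts_def\<close>)+

text \<open>In size \<open>Suc n\<close> the middle vertex \<open>n\<close> is isolated, an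
  additional inner component: its colour is free, which doubles every matrix entry.\<close>

lemma product_Suc:
  assumes a: "a \<in> diagrams n" and b: "b \<in> diagrams n"
  shows "Gprime (Suc n) a b = Gprime n a b" "ell (Suc n) a b = Suc (ell n a b)"
proof -
  have up: "D \<in> diagrams n \<Longrightarrow> D \<in> diagrams (Suc n)" for D using diagrams_mono by auto
  have cut: "dmat D I J = dmat D (I \<inter> {..<n}) (J \<inter> {..<n})" if "D \<in> diagrams n" for D I J
  proof -
    have "compat D (colouring I J) = compat D (colouring (I \<inter> {..<n}) (J \<inter> {..<n}))"
      by (rule compat_cong[OF that]) (auto simp: verts_def colouring_def)
    then show ?thesis by (simp add: dmat_def)
  qed
  have "(\<Sum>J\<in>Pow {..<Suc n}. dmat a I J * dmat b J K) = 2 ^ Suc (ell n a b) * dmat (Gprime n a b) I K"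
    if "I \<subseteq> {..<Suc n}" "K \<subseteq> {..<Suc n}" for I K
  proof -
    let ?I = "I \<inter> {..<n}" and ?K = "K \<inter> {..<n}" and ?P = "Pow {..<n}"
    let ?g = "\<lambda>J. dmat a I J * dmat b J K"
    have "{..<Suc n} = insert n {..<n}" by auto
    then have P: "Pow {..<Suc n} = ?P \<union> insert n ` ?P" using Pow_insert by metis
    have inj: "inj_on (insert n) ?P" by (rule inj_onI) (metis Diff_insert_absorb PowD lessThan_iff less_irrefl subset_iff)
    have "(\<Sum>J\<in>Pow {..<Suc n}. ?g J) = (\<Sum>J\<in>?P. ?g J) + (\<Sum>J\<in>insert n ` ?P. ?g J)"
      unfolding P by (rule sum.union_disjoint) auto
    also have "(\<Sum>J\<in>insert n ` ?P. ?g J) = (\<Sum>J\<in>?P. ?g (insert n J))"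
      by (simp add: sum.reindex[OF inj])
    also have "\<dots> = (\<Sum>J\<in>?P. ?g J)"
    proof (rule sum.cong[OF refl])
      fix J assume "J \<in> ?P"
      have "insert n J \<inter> {..<n} = J \<inter> {..<n}" by auto
      then show "?g (insert n J) = ?g J"
        using cut[OF a, of I "insert n J"] cut[OF a, of I J] cut[OF b, of "insert n J" K] cut[OF b, of J K] by simp
    qed
    also have "(\<Sum>J\<in>?P. ?g J) = (\<Sum>J\<in>?P. dmat a ?I J * dmat b J ?K)"
    proof (rule sum.cong[OF refl])
      fix J assume "J \<in> ?P"
      then have "J \<inter> {..<n} = J" by auto
      then show "?g J = dmat a ?I J * dmat b J ?K" using cut[OF a, of I J] cut[OF b, of J K] by simp
    qed
    also have "\<dots> = 2 ^ ell n a b * dmat (Gprime n a b) ?I ?K"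
      by (rule dmat_product[OF a b]) auto
    also have "dmat (Gprime n a b) ?I ?K = dmat (Gprime n a b) I K"
      by (rule cut[OF Gprime_diagram[OF a b], symmetric])
    finally show ?thesis by simp
  qed
  note product_eqI[OF up[OF a] up[OF b] up[OF Gprime_diagram[OF a b]] this]
  then show "Gprime (Suc n) a b = Gprime n a b" "ell (Suc n) a b = Suc (ell n a b)" by auto
qed

section \<open>Elements annihilated by dots and hooks\<close>

context perm_algebra
begin

text \<open>Multiplying the equation by \<open>e \<alpha>\<close> from the left leaves two
  possibilities: \<open>e \<alpha> \<odot> v = 0\<close>, or \<open>r\<close> is the integer
  \<open>\<alpha> a + \<alpha> b\<close>.\<close>

lemma jm_sum_eigenvector_zero:
  assumes ab: "a < n" "b < n" and v: "v \<in> B"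
    and eq: "X a \<odot> v + X b \<odot> v = r *s v" and r: "r \<notin> range of_int"
  shows "v = 0"
proof -
  obtain \<Lambda> e where jm: "jm_decomposition \<Lambda> e" using exists_jm_decomposition by blast
  have "e \<alpha> \<odot> v = 0" if "\<alpha> \<in> \<Lambda>" for \<alpha>
  proof -
    have "r *s (e \<alpha> \<odot> v) = e \<alpha> \<odot> (X a \<odot> v + X b \<odot> v)" by (simp add: eq)
    also have "\<dots> = (e \<alpha> \<odot> X a) \<odot> v + (e \<alpha> \<odot> X b) \<odot> v" by (simp add: mul_add mul_assoc)
    also have "\<dots> = of_int (\<alpha> a + \<alpha> b) *s (e \<alpha> \<odot> v)"
      using jm_decompositionD(9)[OF jm that] ab by (simp add: scale_left_distrib)
    finally have "r = of_int (\<alpha> a + \<alpha> b) \<or> e \<alpha> \<odot> v = 0" by (simp only: scale_cancel_right)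
    then show ?thesis using r by blast
  qed
  then show ?thesis using sum_idem_mul[OF jm v] by simp
qed

lemma G_mul_perm_sum:
  assumes h: "h permutes {..<n}"
  shows "G h \<odot> (\<Sum>g\<in>perms. f g *s G (inv g)) = (\<Sum>g\<in>perms. f (g \<circ> h) *s G (inv g))"
proof -
  have "G h \<odot> (\<Sum>g\<in>perms. f g *s G (inv g)) = (\<Sum>g\<in>perms. f g *s G (h \<circ> inv g))"
    unfolding mul_sum using h by (intro sum.cong) (auto simp: G_mul permutes_inv)
  also have "\<dots> = (\<Sum>g\<in>perms. f (g \<circ> h) *s G (h \<circ> inv (g \<circ> h)))"
    by (rule sum_permutations_compose_right[OF h])
  also have "\<dots> = (\<Sum>g\<in>perms. f (g \<circ> h) *s G (inv g))"
  proof (rule sum.cong[OF refl])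
    fix g assume "g \<in> perms"
    then have "inv (g \<circ> h) = inv h \<circ> inv g" using h by (intro o_inv_distrib) (auto simp: permutes_bij)
    then have "h \<circ> inv (g \<circ> h) = inv g" using permutes_inv_o(1)[OF h] by (simp add: o_assoc)
    then show "f (g \<circ> h) *s G (h \<circ> inv (g \<circ> h)) = f (g \<circ> h) *s G (inv g)" by simp
  qed
  finally show ?thesis .
qed

text \<open>The function is encoded as the element with coefficient \<open>f g\<close> at
  \<open>inv g\<close>, so that left multiplication by a transposition becomes right translation of
  \<open>f\<close>. The lone summand \<open>f g\<close> is the term of \<open>X (n - 1)\<close> for
  the transposition under which \<open>f\<close> is invariant; the equation then says that
  \<open>X (n - 2) + X (n - 1)\<close> acts as \<open>r\<close>.\<close>

lemma perm_function_zero: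
  fixes f :: "(nat \<Rightarrow> nat) \<Rightarrow> 'a"
  assumes n: "2 \<le> n" and r: "r \<notin> range of_int"
    and inv: "\<And>g. g permutes {..<n} \<Longrightarrow> f (g \<circ> transpose (n - 2) (n - 1)) = f g"
    and eq: "\<And>g. g permutes {..<n} \<Longrightarrow>
      (\<Sum>l<n - 2. f (g \<circ> transpose l (n - 2)) + f (g \<circ> transpose l (n - 1))) + f g = r * f g"
    and g: "g permutes {..<n}"
  shows "f g = 0"
proof -
  define v where "v = (\<Sum>g\<in>perms. f g *s G (inv g))"
  have vB: "v \<in> B" unfolding v_def by (intro B_sum B_scale G_in_B) (auto intro: permutes_inv)
  have GX: "X k \<odot> v = (\<Sum>g\<in>perms. (\<Sum>l<k. f (g \<circ> transpose l k)) *s G (inv g))" if k: "k < n" for k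
  proof -
    have "X k \<odot> v = (\<Sum>l<k. G (transpose l k) \<odot> v)" by (simp add: X_def sum_mul)
    also have "\<dots> = (\<Sum>l<k. \<Sum>g\<in>perms. f (g \<circ> transpose l k) *s G (inv g))"
      unfolding v_def using k by (intro sum.cong refl G_mul_perm_sum transpose_perm) auto
    also have "\<dots> = (\<Sum>g\<in>perms. \<Sum>l<k. f (g \<circ> transpose l k) *s G (inv g))" by (rule sum.swap)
    finally show ?thesis by (simp add: scale_sum_left)
  qed
  have "{..<n - 1} = insert (n - 2) {..<n - 2}" using n by auto
  then have S: "(\<Sum>l<n - 1. h l) = h (n - 2) + (\<Sum>l<n - 2. h l)" for h :: "nat \<Rightarrow> 'a" by simp
  have "X (n - 2) \<odot> v + X (n - 1) \<odot> v = (\<Sum>g\<in>perms. ((\<Sum>l<n - 2. f (g \<circ> transpose l (n - 2))) +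
      (\<Sum>l<n - 1. f (g \<circ> transpose l (n - 1)))) *s G (inv g))"
    using n by (simp add: GX scale_left_distrib sum.distrib)
  also have "\<dots> = (\<Sum>g\<in>perms. (r * f g) *s G (inv g))"
  proof (rule sum.cong[OF refl])
    fix g assume "g \<in> perms"
    then have g: "g permutes {..<n}" by simp
    have "(\<Sum>l<n - 2. f (g \<circ> transpose l (n - 2))) + (\<Sum>l<n - 1. f (g \<circ> transpose l (n - 1))) = r * f g"
      using eq[OF g] inv[OF g] unfolding S by (simp add: sum.distrib algebra_simps)
    then show "((\<Sum>l<n - 2. f (g \<circ> transpose l (n - 2))) + (\<Sum>l<n - 1. f (g \<circ> transpose l (n - 1)))) *s G (inv g)
       = (r * f g) *s G (inv g)" by simp
  qed
  also have "\<dots> = r *s v" by (simp add: v_def scale_sum_right)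
  finally have "v = 0" using jm_sum_eigenvector_zero[of "n - 2" "n - 1" v r] n vB r by auto
  \<comment> \<open>Multiplication by \<open>G g\<close> moves the coefficient \<open>f g\<close> to
    the identity, where \<open>tr\<close> reads it.\<close>
  then have "0 = tr (G g \<odot> v)" by (simp add: tr_0)
  also have "\<dots> = (\<Sum>h\<in>perms. f (h \<circ> g) * tr (G (inv h)))"
    unfolding v_def G_mul_perm_sum[OF g] by (simp add: tr_sum tr_scale)
  also have "\<dots> = (\<Sum>h\<in>perms. if h = id then f g else 0)"
  proof (rule sum.cong[OF refl])
    fix h assume h: "h \<in> perms"
    have "inv h = id \<longleftrightarrow> h = id" using permutes_inv_inv[of h "{..<n}"] h by (metis inv_id mem_Collect_eq)
    then show "f (h \<circ> g) * tr (G (inv h)) = (if h = id then f g else 0)"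
      using h tr_G[OF permutes_inv, of h] by auto
  qed
  also have "\<dots> = f g" by (simp add: sum.delta finite_perms permutes_id)
  finally show ?thesis by simp
qed

end

section \<open>Diagrams whose only defect is one loop or one cap\<close>

lemma vertex_edge:
  assumes "matching D" "t \<in> \<Union>D"
  shows "\<exists>p. {t, p} \<in> D"
proof -
  obtain e where e: "e \<in> D" "t \<in> e" using assms(2) by auto
  obtain u v where "e = {u, v}" using matching_edge[OF assms(1) e(1)] by blast
  then show ?thesis using e by (auto simp: insert_commute)
qed

lemma act_act: "act v (act w D) = act (v \<circ> w) D"
proof -
  have "top_map v (top_map w u) = top_map (v \<circ> w) u" for u by (simp add: top_map_def)
  then show ?thesis by (simp add: act_def image_image)
qed

lemma act_edge: "{u, v} \<in> D \<Longrightarrow> {top_map w u, top_map w v} \<in> act w D"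
  unfolding act_def using imageI[of "{u, v}" D "(`) (top_map w)"] by simp

text \<open>
  Only the top vertices below \<open>N\<close> count as top vertices here; those from \<open>N\<close> on are treated like
  bottom vertices.
\<close>

definition joined_outside :: "nat \<Rightarrow> diagram \<Rightarrow> nat \<Rightarrow> bool" where
  "joined_outside N D k \<longleftrightarrow> (\<exists>v. {(False, k), v} \<in> D \<and> v \<notin> {False} \<times> {..<N})"

definition one_cap :: "nat \<Rightarrow> diagram \<Rightarrow> nat \<Rightarrow> nat \<Rightarrow> bool" where
  "one_cap N D i j \<longleftrightarrow> {(False, i), (False, j)} \<in> D \<and> (\<forall>k<N. k \<noteq> i \<longrightarrow> k \<noteq> j \<longrightarrow> joined_outside N D k)"

lemma one_cap_commute: "one_cap N D i j \<longleftrightarrow> one_cap N D j i"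
  unfolding one_cap_def by (auto simp: insert_commute)

lemma joined_outsideI: "{(False, k), v} \<in> D \<Longrightarrow> v \<notin> {False} \<times> {..<N} \<Longrightarrow> joined_outside N D k"
  unfolding joined_outside_def by (intro exI conjI)

lemma joined_outsideE:
  assumes "joined_outside N D k"
  obtains v where "{(False, k), v} \<in> D" "v \<notin> {False} \<times> {..<N}"
  using assms unfolding joined_outside_def by (elim exE conjE)

lemma joined_outside_mono: "joined_outside N D k \<Longrightarrow> D \<subseteq> D' \<Longrightarrow> joined_outside N D' k"
  by (elim joined_outsideE, rule joined_outsideI, erule subsetD, assumption+)

lemma joined_outside_partner:
  assumes "matching D" "joined_outside N D k" "{(False, k), v} \<in> D"
  shows "v \<notin> {False} \<times> {..<N}"
  using assms(2) by (elim joined_outsideE) (use matching_unique[OF assms(1,3)] in blast)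

lemma act_transpose_cap:
  assumes m: "matching D" and cap: "{(False, i), (False, j)} \<in> D" and e: "{(False, l), q} \<in> D"
    and ij: "i \<noteq> j" "l \<noteq> i" "l \<noteq> j"
  shows "act (transpose j l) D = insert {(False, i), (False, l)} (insert {(False, j), q}
     (D - {{(False, i), (False, j)}, {(False, l), q}}))"
proof -
  let ?f = "top_map (transpose j l)"
  let ?cap = "{(False, i), (False, j)}" and ?e = "{(False, l), q}"
  let ?R = "D - {?cap, ?e}"
  have q: "q \<noteq> (False, j)" "q \<noteq> (False, l)"
  proof -
    show "q \<noteq> (False, j)"
      using matching_unique[OF m, of "(False, j)" "(False, i)" "(False, l)"] cap e ij by (auto simp: insert_commute)
    show "q \<noteq> (False, l)" using matching_irrefl[OF m] e by auto
  qed
  have fixed: "?f v = v" if "v \<noteq> (False, j)" "v \<noteq> (False, l)" for v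
    using that by (cases v) (auto simp: top_map_def transpose_def)
  have "D = insert ?cap (insert ?e ?R)" using cap e by auto
  then have "act (transpose j l) D = insert (?f ` ?cap) (insert (?f ` ?e) ((`) ?f ` ?R))"
    unfolding act_def by (metis image_insert)
  also have "?f ` ?cap = {(False, i), (False, l)}" using ij by (simp add: top_map_def)
  also have "?f ` ?e = {(False, j), q}" using fixed[OF q] by (simp add: top_map_def)
  also have "(`) ?f ` ?R = ?R"
  proof -
    have "?f ` e' = e'" if e': "e' \<in> ?R" for e'
    proof -
      have "e' \<inter> ?cap = {}" "e' \<inter> ?e = {}" using matching_disjoint[OF m] e' cap e by auto
      then have "?f v = v" if "v \<in> e'" for v using that by (intro fixed) auto
      then show ?thesis by simp
    qed
    then show ?thesis by simp
  qed
  finally show ?thesis .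
qed

text \<open>In the transposed diagram \<open>i\<close> is capped with \<open>l\<close>, and
  \<open>j\<close> takes over the outside partner of \<open>l\<close>. The hook reconnects
  \<open>l\<close> with that partner and \<open>i\<close> with \<open>j\<close>, which gives back
  \<open>D\<close>. The statements about partners serve to tell such preimages apart.\<close>

lemma hook_act_transpose:
  assumes D: "D \<in> diagrams n" and N: "N \<le> n" and oc: "one_cap N D i j"
    and ij: "i < N" "j < N" "i \<noteq> j" "l < N" "l \<noteq> i" "l \<noteq> j"
  shows "Gprime n (hook n i j) (act (transpose j l) D) = D" "ell n (hook n i j) (act (transpose j l) D) = 0"
    "partner (act (transpose j l) D) (False, i) = (False, l)"
    "partner (act (transpose j l) D) (False, j) \<notin> {False} \<times> {..<N}"
    "act (transpose j l) D \<in> diagrams n"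
proof -
  note m = diagram_matching[OF D]
  let ?b = "act (transpose j l) D"
  have "joined_outside N D l" using oc ij unfolding one_cap_def by auto
  then obtain q where q: "{(False, l), q} \<in> D" "q \<notin> {False} \<times> {..<N}" by (rule joined_outsideE)
  have cap: "{(False, i), (False, j)} \<in> D" using oc unfolding one_cap_def by auto
  let ?R = "D - {{(False, i), (False, j)}, {(False, l), q}}"
  have beq: "?b = insert {(False, i), (False, l)} (insert {(False, j), q} ?R)"
    by (rule act_transpose_cap[OF m cap q(1)]) (use ij in auto)
  show b: "?b \<in> diagrams n" using ij N by (intro act_diagram[OF D] permutes_swap_id) auto
  have e: "{(False, i), (False, l)} \<in> ?b" "{(False, j), q} \<in> ?b" unfolding beq by auto
  show "partner ?b (False, i) = (False, l)" by (rule partner_eq[OF diagram_matching[OF b] e(1)])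
  show "partner ?b (False, j) \<notin> {False} \<times> {..<N}"
    using partner_eq[OF diagram_matching[OF b] e(2)] q(2) by simp
  have av: "(False, i) \<notin> e'" "(False, j) \<notin> e'" if "e' \<in> ?R" for e'
    using matching_disjoint[OF m _ cap, of e'] that by auto
  have R: "{e \<in> ?b. (False, i) \<notin> e \<and> (False, j) \<notin> e} = ?R"
  proof (intro equalityI subsetI)
    fix e' assume "e' \<in> {e \<in> ?b. (False, i) \<notin> e \<and> (False, j) \<notin> e}"
    then have "e' \<in> ?b" "e' \<noteq> {(False, i), (False, l)}" "e' \<noteq> {(False, j), q}" by blast+
    then show "e' \<in> ?R" unfolding beq by blast
  next
    fix e' assume e': "e' \<in> ?R"
    then have "e' \<in> ?b" unfolding beq by blast
    then show "e' \<in> {e \<in> ?b. (False, i) \<notin> e \<and> (False, j) \<notin> e}" using av[OF e'] by blast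
  qed
  have 1: "i < n" "j < n" using ij N by auto
  have "(False, l) \<noteq> (False, j)" using ij by simp
  note hp = hook_product_two[OF b 1 ij(3) e this]
  show "Gprime n (hook n i j) ?b = D" unfolding hp(1) R using cap q(1) by auto
  show "ell n (hook n i j) ?b = 0" by (rule hp(2))
qed

text \<open>The sums are the coefficients at \<open>D\<close> of a dot or hook times the element
  with coefficients \<open>c\<close>. Only top vertices below \<open>N\<close> are tested, and
  \<open>full\<close> is the boundary condition of the descent in \<open>N\<close>.\<close>

context
  fixes n N :: nat and c :: "diagram \<Rightarrow> 'a::field" and x :: 'a
  assumes N: "N \<le> n" and x0: "x \<noteq> 0"
    and dotz: "\<And>i D. i < N \<Longrightarrow>
      (\<Sum>b\<in>diagrams n. if Gprime n (dot n i) b = D then c b * x ^ ell n (dot n i) b else 0) = 0"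
    and hookz: "\<And>i j D. i < N \<Longrightarrow> j < N \<Longrightarrow> i \<noteq> j \<Longrightarrow>
      (\<Sum>b\<in>diagrams n. if Gprime n (hook n i j) b = D then c b * x ^ ell n (hook n i j) b else 0) = 0"
    and full: "\<And>b. b \<in> diagrams n \<Longrightarrow> (\<And>k. k < N \<Longrightarrow> joined_outside N b k) \<Longrightarrow> c b = 0"
begin

text \<open>In the coefficient of the dot product at \<open>D\<close>, the diagram \<open>D\<close>
  itself counts with factor \<open>x\<close>. Any other preimage joins \<open>i\<close> to a vertex
  that is isolated in \<open>D\<close>. This is no counted top vertex, since those are joined
  outside, so the preimage has no defect and coefficient zero.\<close>

lemma coefficient_one_dot:
  assumes D: "D \<in> diagrams n" and i: "i < N" and iso: "(False, i) \<notin> \<Union>D"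
    and others: "\<And>k. k < N \<Longrightarrow> k \<noteq> i \<Longrightarrow> joined_outside N D k"
  shows "c D = 0"
proof -
  let ?t = "(False, i)"
  have i': "i < n" using i N by simp
  have "(\<Sum>b\<in>diagrams n. if Gprime n (dot n i) b = D then c b * x ^ ell n (dot n i) b else 0) =
      (\<Sum>b\<in>diagrams n. if b = D then c D * x else 0)"
  proof (rule sum.cong[OF refl])
    fix b assume b: "b \<in> diagrams n"
    note m = diagram_matching[OF b]
    show "(if Gprime n (dot n i) b = D then c b * x ^ ell n (dot n i) b else 0) = (if b = D then c D * x else 0)"
    proof (cases "?t \<in> \<Union>b")
      case False
      then show ?thesis using dot_product_isolated[OF b i' False] by (cases "b = D") auto
    next
      case True
      then obtain p where p: "{?t, p} \<in> b" using vertex_edge[OF m] by blast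
      note dp = dot_product_joined[OF b i' p]
      have "c b = 0" if Deq: "D = {e \<in> b. ?t \<notin> e}"
      proof (rule full[OF b])
        have sub: "D \<subseteq> b" using Deq by auto
        have pX: "p \<notin> {False} \<times> {..<N}"
        proof
          assume "p \<in> {False} \<times> {..<N}"
          then obtain k where k: "k < N" "p = (False, k)" by auto
          have "k \<noteq> i" using matching_irrefl[OF m] p k by auto
          then obtain v where v: "{p, v} \<in> D" "v \<notin> {False} \<times> {..<N}" using joined_outsideE[OF others[OF k(1)]] k(2) by metis
          then have "v = ?t" using matching_unique[OF m, of p v ?t] p sub by (auto simp: insert_commute)
          then show False using v(2) i by auto
        qed
        fix k assume k: "k < N"
        show "joined_outside N b k"
        proof (cases "k = i")
          case True then show ?thesis using joined_outsideI[OF _ pX] p by simp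
        next
          case False then show ?thesis using joined_outside_mono[OF others[OF k] sub] by simp
        qed
      qed
      moreover have "b \<noteq> D" using iso True by auto
      ultimately show ?thesis using dp by auto
    qed
  qed
  also have "\<dots> = c D * x" using D by (simp add: sum.delta finite_diagrams)
  finally show ?thesis using dotz[OF i, of D] x0 by simp
qed

context
  fixes D :: diagram and i j :: nat
  assumes D: "D \<in> diagrams n" and oc: "one_cap N D i j" and ij: "i < N" "j < N" "i \<noteq> j"
begin

abbreviation (input) "t \<equiv> (False, i)"
abbreviation (input) "t' \<equiv> (False, j)"

lemma cap_edge: "{t, t'} \<in> D" "k < N \<Longrightarrow> k \<noteq> i \<Longrightarrow> k \<noteq> j \<Longrightarrow> joined_outside N D k"
  using oc unfolding one_cap_def by auto

lemma cap_removed: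
  "D - {{t, t'}} \<in> diagrams n" "t \<notin> \<Union>(D - {{t, t'}})" "t' \<notin> \<Union>(D - {{t, t'}})"
  "k < N \<Longrightarrow> k \<noteq> i \<Longrightarrow> k \<noteq> j \<Longrightarrow> joined_outside N (D - {{t, t'}}) k"
proof -
  show "D - {{t, t'}} \<in> diagrams n" by (rule subset_diagram[OF D]) auto
  show "t \<notin> \<Union>(D - {{t, t'}})" "t' \<notin> \<Union>(D - {{t, t'}})"
    using matching_disjoint[OF diagram_matching[OF D] _ cap_edge(1)] by auto
  assume k: "k < N" "k \<noteq> i" "k \<noteq> j"
  obtain v where v: "{(False, k), v} \<in> D" "v \<notin> {False} \<times> {..<N}" by (rule joined_outsideE[OF cap_edge(2)[OF k]])
  have "{(False, k), v} \<noteq> {t, t'}" using k by (auto simp: doubleton_eq_iff)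
  then show "joined_outside N (D - {{t, t'}}) k" using v by (intro joined_outsideI[OF _ v(2)]) simp
qed

lemma partner_outside:
  assumes b: "matching b" and sub: "D - {{t, t'}} \<subseteq> b" and p: "{t, p} \<in> b" and pt: "p \<noteq> t'"
  shows "p \<notin> {False} \<times> {..<N}"
proof
  assume "p \<in> {False} \<times> {..<N}"
  then obtain k where k: "k < N" "p = (False, k)" by auto
  have "k \<noteq> i" "k \<noteq> j" using matching_irrefl[OF b] p k pt by auto
  then obtain v where v: "{p, v} \<in> D - {{t, t'}}" "v \<notin> {False} \<times> {..<N}"
    using joined_outsideE[OF cap_removed(4)[OF k(1)]] k(2) by metis
  have "{p, v} \<in> b" using sub v(1) by (rule subsetD)
  moreover have "{p, t} \<in> b" using p by (simp add: insert_commute)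
  ultimately have "v = t" by (rule matching_unique[OF b])
  then show False using v(2) ij by simp
qed

text \<open>Whatever edge \<open>i\<close> has instead of the cap leads outside, so the loop at
  \<open>j\<close> is the only defect left.\<close>

lemma coefficient_one_dot_extended:
  assumes b: "b \<in> diagrams n" and sub: "D - {{t, t'}} \<subseteq> b" and p: "{t, p} \<in> b" and iso: "t' \<notin> \<Union>b"
  shows "c b = 0"
proof (rule coefficient_one_dot[OF b ij(2) iso])
  have "p \<noteq> t'" using p iso by auto
  note pX = partner_outside[OF diagram_matching[OF b] sub p this]
  fix k assume k: "k < N" "k \<noteq> j"
  show "joined_outside N b k"
  proof (cases "k = i")
    case True then show ?thesis using joined_outsideI[OF _ pX] p by simp
  next
    case False show ?thesis by (rule joined_outside_mono[OF cap_removed(4)[OF k(1) False k(2)] sub])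
  qed
qed

text \<open>This is the coefficient of the dot product at \<open>D\<close> without its cap. The dot
  cuts the cap of \<open>D\<close> with factor 1 and closes a component on the diagram already
  lacking it, with factor \<open>x\<close>. All other preimages have a single loop, at
  \<open>j\<close>, so their coefficients vanish.\<close>

lemma coefficient_cap_removed: "x * c (D - {{t, t'}}) + c D = 0"
proof -
  let ?D = "D - {{t, t'}}"
  let ?F = "\<lambda>b. if Gprime n (dot n i) b = ?D then c b * x ^ ell n (dot n i) b else 0"
  have i': "i < n" using ij N by simp
  have FD: "?F D = c D"
  proof -
    have "{e \<in> D. t \<notin> e} = ?D" using cap_removed(2) by auto
    then show ?thesis using dot_product_joined[OF D i' cap_edge(1)] by simp
  qed
  have FD': "?F ?D = x * c ?D"
    using dot_product_isolated[OF cap_removed(1) i' cap_removed(2)] by simp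
  have "(\<Sum>b\<in>diagrams n. ?F b) = (\<Sum>b\<in>{D, ?D}. ?F b)"
  proof (rule sum.mono_neutral_right[OF finite_diagrams])
    show "{D, ?D} \<subseteq> diagrams n" using D cap_removed(1) by auto
    show "\<forall>b\<in>diagrams n - {D, ?D}. ?F b = 0"
    proof
      fix b assume b: "b \<in> diagrams n - {D, ?D}"
      then have bd: "b \<in> diagrams n" by simp
      note m = diagram_matching[OF bd]
      show "?F b = 0"
      proof (cases "t \<in> \<Union>b")
        case False
        then show ?thesis using dot_product_isolated[OF bd i' False] b by auto
      next
        case True
        then obtain p where p: "{t, p} \<in> b" using vertex_edge[OF m] by blast
        have "c b = 0" if Deq: "?D = {e \<in> b. t \<notin> e}"
        proof -
          have beq: "b = insert {t, p} ?D" using matching_insert_eq[OF m p] Deq by simp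
          have pt: "p \<noteq> t'"
          proof
            assume "p = t'"
            then have "b = D" using beq cap_edge(1) by auto
            then show False using b by simp
          qed
          show ?thesis
          proof (rule coefficient_one_dot_extended[OF bd _ p])
            show "?D \<subseteq> b" using beq by auto
            show "t' \<notin> \<Union>b" unfolding beq using cap_removed(3) pt ij by auto
          qed
        qed
        then show ?thesis using dot_product_joined[OF bd i' p] by auto
      qed
    qed
  qed
  also have "D \<noteq> ?D" using cap_edge(1) by auto
  then have "(\<Sum>b\<in>{D, ?D}. ?F b) = ?F D + ?F ?D" by simp
  finally show ?thesis using dotz[OF ij(1), of ?D] FD FD' by (simp add: add.commute)
qed

end

text \<open>The product is decided by how \<open>i\<close> and \<open>j\<close> are matched in
  \<open>b\<close>. If just one of them is matched, \<open>b\<close> has a single loop; if both lead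
  outside, \<open>b\<close> has no defect. In both cases \<open>c b\<close> would be zero, which
  leaves the listed diagrams.\<close>

lemma hook_preimage:
  assumes D: "D \<in> diagrams n" and oc: "one_cap N D i j" and ij: "i < N" "j < N" "i \<noteq> j"
    and b: "b \<in> diagrams n" and G: "Gprime n (hook n i j) b = D" and cb: "c b \<noteq> 0"
  shows "b = D \<or> b = D - {{(False, i), (False, j)}} \<or>
    (\<exists>l<N. l \<noteq> i \<and> l \<noteq> j \<and> (b = act (transpose j l) D \<or> b = act (transpose i l) D))"
proof -
  let ?t = "(False, i)" and ?t' = "(False, j)"
  let ?cap = "{?t, ?t'}"
  note m = diagram_matching[OF b] and mD = diagram_matching[OF D]
  have n': "i < n" "j < n" using ij N by auto
  have oc': "one_cap N D j i" using oc one_cap_commute by blast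
  note cap = cap_edge[OF D oc ij]
  consider "?cap \<in> b" | "?t \<notin> \<Union>b" "?t' \<notin> \<Union>b" | p where "{?t, p} \<in> b" "?t' \<notin> \<Union>b"
    | q where "{?t', q} \<in> b" "?t \<notin> \<Union>b" | p q where "{?t, p} \<in> b" "{?t', q} \<in> b" "p \<noteq> ?t'"
    using vertex_edge[OF m, of ?t] vertex_edge[OF m, of ?t'] by metis
  then show ?thesis
  proof cases
    case 1
    then show ?thesis using hook_product_cap(1)[OF b n' ij(3)] G by simp
  next
    case 2
    then have "insert ?cap b = D" using hook_product_none(1)[OF b n' ij(3)] G by simp
    moreover have "?cap \<notin> b" using 2 by auto
    ultimately have "b = D - {?cap}" by auto
    then show ?thesis by simp
  next
    case 3
    then have "insert ?cap {e \<in> b. ?t \<notin> e} = D" using hook_product_one(1)[OF b n' ij(3)] G by simp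
    then have "D - {?cap} \<subseteq> b" by auto
    then have "c b = 0" using coefficient_one_dot_extended[OF D oc ij b _ 3] by simp
    then show ?thesis using cb by simp
  next
    case 4
    have "insert {?t', ?t} {e \<in> b. ?t' \<notin> e} = D"
      using hook_product_one(1)[OF b n'(2,1) ij(3)[symmetric] 4] G by (simp add: hook_commute)
    then have "D - {{?t', ?t}} \<subseteq> b" by auto
    then have "c b = 0"
      using coefficient_one_dot_extended[OF D oc' ij(2,1) ij(3)[symmetric] b _ 4] by simp
    then show ?thesis using cb by simp
  next
    case 5
    let ?R = "{e \<in> b. ?t \<notin> e \<and> ?t' \<notin> e}"
    have Deq: "insert ?cap (insert {p, q} ?R) = D"
      using hook_product_two(1)[OF b n' ij(3) 5] G by simp
    have qt: "q \<noteq> ?t" using matching_unique[OF m, of ?t p ?t'] 5 by (auto simp: insert_commute)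
    have pt: "p \<noteq> ?t" "q \<noteq> ?t'" using matching_irrefl[OF m] 5 by auto
    have beq: "b = insert {?t, p} (insert {?t', q} ?R)"
    proof -
      have "b = insert {?t, p} {e \<in> b. ?t \<notin> e}" by (rule matching_insert_eq[OF m 5(1)])
      also have "{e \<in> b. ?t \<notin> e} = insert {?t', q} ?R"
        using matching_insert_eq[OF m 5(2)] 5(2) qt ij(3) by auto
      finally show ?thesis .
    qed
    have pq: "{p, q} \<notin> b" using matching_unique[OF m, of p q ?t] 5 qt by (auto simp: insert_commute)
    have Req: "D - {?cap, {p, q}} = ?R" using Deq pq by auto
    have pqD: "{p, q} \<in> D" using Deq by auto
    show ?thesis
    proof (cases "p \<in> {False} \<times> {..<N}")
      case True
      then obtain l where l: "l < N" "p = (False, l)" by auto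
      have lij: "l \<noteq> i" "l \<noteq> j" using pt 5 l by auto
      have "act (transpose j l) D = insert {?t, p} (insert {?t', q} (D - {?cap, {p, q}}))"
        using act_transpose_cap[OF mD cap(1), of l q] pqD ij lij l by simp
      then have "b = act (transpose j l) D" using Req beq by simp
      then show ?thesis using l lij by blast
    next
      case pX: False
      show ?thesis
      proof (cases "q \<in> {False} \<times> {..<N}")
        case True
        then obtain l where l: "l < N" "q = (False, l)" by auto
        have lij: "l \<noteq> i" "l \<noteq> j" using pt qt l by auto
        have "act (transpose i l) D = insert {?t', q} (insert {?t, p} (D - {{?t', ?t}, {q, p}}))"
          using act_transpose_cap[OF mD, of j i l p] cap(1) pqD ij lij l by (simp add: insert_commute)
        also have "\<dots> = b" using Req beq by (simp add: insert_commute)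
        finally show ?thesis using l lij by blast
      next
        case qX: False
        have "c b = 0"
        proof (rule full[OF b])
          fix k assume k: "k < N"
          show "joined_outside N b k"
          proof (cases "k = i \<or> k = j")
            case True then show ?thesis using joined_outsideI[OF 5(1) pX] joined_outsideI[OF 5(2) qX] by auto
          next
            case False
            then obtain v where v: "{(False, k), v} \<in> D" "v \<notin> {False} \<times> {..<N}"
              using joined_outsideE[OF cap(2)[OF k]] by metis
            have "{(False, k), v} \<noteq> ?cap" using False by (auto simp: doubleton_eq_iff)
            moreover have "{(False, k), v} \<noteq> {p, q}" using pX qX k by (auto simp: doubleton_eq_iff)
            ultimately have "{(False, k), v} \<in> D - {?cap, {p, q}}" using v by simp
            then have "{(False, k), v} \<in> b" unfolding Req by simp
            then show ?thesis by (rule joined_outsideI[OF _ v(2)])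
          qed
        qed
        then show ?thesis using cb by simp
      qed
    qed
  qed
qed

text \<open>\<open>D\<close> enters with factor \<open>x\<close>; so does \<open>D\<close> without
  its cap, whose contribution is \<open>- c D\<close> by \<open>coefficient_cap_removed\<close>. The
  remaining preimages create no inner component and count with factor 1.\<close>

lemma coefficient_hook_equation:
  assumes D: "D \<in> diagrams n" and oc: "one_cap N D i j" and ij: "i < N" "j < N" "i \<noteq> j"
  shows "(x - 1) * c D + (\<Sum>l\<in>{..<N} - {i, j}. c (act (transpose i l) D) + c (act (transpose j l) D)) = 0"
proof -
  let ?t = "(False, i)" and ?t' = "(False, j)"
  let ?D = "D - {{?t, ?t'}}" and ?L = "{..<N} - {i, j}"
  let ?A1 = "\<lambda>l. act (transpose j l) D" and ?A2 = "\<lambda>l. act (transpose i l) D"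
  let ?F = "\<lambda>b. if Gprime n (hook n i j) b = D then c b * x ^ ell n (hook n i j) b else 0"
  have n': "i < n" "j < n" using ij N by auto
  have oc': "one_cap N D j i" using oc one_cap_commute by blast
  note h1 = hook_act_transpose[OF D N oc ij]
  note h2 = hook_act_transpose[OF D N oc' ij(2,1) ij(3)[symmetric], unfolded hook_commute[of n j i]]
  note cap = cap_edge(1)[OF D oc ij] and rem = cap_removed[OF D oc ij]
  note mD = diagram_matching[OF D]
  \<comment> \<open>The preimages are shown to be different by comparing the partners of the cap
    ends.\<close>
  have pD: "partner D ?t = ?t'" by (rule partner_eq[OF mD cap])
  have pD': "partner ?D ?t = ?t" using partner_edge[of ?D ?t] rem(2) by blast
  have FD: "?F D = x * c D" using hook_product_cap[OF D n' ij(3) cap] by simp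
  have FD': "?F ?D = x * c ?D"
  proof -
    have "insert {?t, ?t'} ?D = D" using cap by auto
    then show ?thesis using hook_product_none[OF rem(1) n' ij(3) rem(2,3)] by simp
  qed
  have F1: "?F (?A1 l) = c (?A1 l)" and F2: "?F (?A2 l) = c (?A2 l)" if "l \<in> ?L" for l
    using h1(1,2)[of l] h2(1,2)[of l] that by simp_all
  have inj1: "inj_on ?A1 ?L"
    by (rule inj_on_inverseI[of _ "\<lambda>b. snd (partner b ?t)"]) (simp add: h1(3))
  have inj2: "inj_on ?A2 ?L"
    by (rule inj_on_inverseI[of _ "\<lambda>b. snd (partner b ?t')"]) (simp add: h2(3))
  have d12: "?A1 ` ?L \<inter> ?A2 ` ?L = {}"
  proof -
    have "?A1 l \<noteq> ?A2 l'" if "l \<in> ?L" "l' \<in> ?L" for l l'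
    proof
      assume eq: "?A1 l = ?A2 l'"
      have "partner (?A2 l') ?t = (False, l)" unfolding eq[symmetric] using h1(3)[of l] that by simp
      then show False using h2(4)[of l'] that by auto
    qed
    then show ?thesis by auto
  qed
  have dD: "{D, ?D} \<inter> (?A1 ` ?L \<union> ?A2 ` ?L) = {}"
  proof -
    have ne: "b \<noteq> b'" if "partner b ?t \<noteq> partner b' ?t" for b b' using that by blast
    have 1: "D \<noteq> ?A1 l" "?D \<noteq> ?A1 l" if l: "l \<in> ?L" for l
      using h1(3)[of l] l by (intro ne; simp add: pD pD')+
    have 2: "D \<noteq> ?A2 l" "?D \<noteq> ?A2 l" if l: "l \<in> ?L" for l
    proof -
      have "partner (?A2 l) ?t \<notin> {False} \<times> {..<N}" using h2(4)[of l] l by simp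
      moreover have "?t \<in> {False} \<times> {..<N}" "?t' \<in> {False} \<times> {..<N}" using ij by auto
      ultimately have "?t' \<noteq> partner (?A2 l) ?t" "?t \<noteq> partner (?A2 l) ?t" by metis+
      then show "D \<noteq> ?A2 l" "?D \<noteq> ?A2 l" using pD pD' by (intro ne; simp)+
    qed
    show ?thesis using 1 2 by blast
  qed
  let ?T = "{D, ?D} \<union> (?A1 ` ?L \<union> ?A2 ` ?L)"
  have "0 = (\<Sum>b\<in>diagrams n. ?F b)" using hookz[OF ij, of D] by simp
  also have "\<dots> = (\<Sum>b\<in>?T. ?F b)"
  proof (rule sum.mono_neutral_right[OF finite_diagrams])
    show "?T \<subseteq> diagrams n" using D rem(1) h1(5) h2(5) by auto
    show "\<forall>b\<in>diagrams n - ?T. ?F b = 0"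
    proof
      fix b assume b: "b \<in> diagrams n - ?T"
      show "?F b = 0"
      proof (rule ccontr)
        assume "?F b \<noteq> 0"
        then have "Gprime n (hook n i j) b = D" "c b \<noteq> 0" by (auto split: if_splits)
        then show False using hook_preimage[OF D oc ij, of b] b by blast
      qed
    qed
  qed
  also have "\<dots> = (\<Sum>b\<in>{D, ?D}. ?F b) + (\<Sum>b\<in>?A1 ` ?L \<union> ?A2 ` ?L. ?F b)"
    by (rule sum.union_disjoint[OF _ _ dD]) auto
  also have "(\<Sum>b\<in>?A1 ` ?L \<union> ?A2 ` ?L. ?F b) = (\<Sum>b\<in>?A1 ` ?L. ?F b) + (\<Sum>b\<in>?A2 ` ?L. ?F b)"
    by (rule sum.union_disjoint[OF _ _ d12]) auto
  also have "(\<Sum>b\<in>?A1 ` ?L. ?F b) = (\<Sum>l\<in>?L. c (?A1 l))"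
    unfolding sum.reindex[OF inj1] o_def by (rule sum.cong[OF refl]) (rule F1)
  also have "(\<Sum>b\<in>?A2 ` ?L. ?F b) = (\<Sum>l\<in>?L. c (?A2 l))"
    unfolding sum.reindex[OF inj2] o_def by (rule sum.cong[OF refl]) (rule F2)
  also have "D \<noteq> ?D" using cap by auto
  then have "(\<Sum>b\<in>{D, ?D}. ?F b) = ?F D + ?F ?D" by simp
  also have "\<dots> = x * c D + x * c ?D" unfolding FD FD' ..
  also have "x * c ?D = - c D" using coefficient_cap_removed[OF D oc ij] by (simp add: eq_neg_iff_add_eq_0)
  finally show ?thesis by (simp add: sum.distrib algebra_simps)
qed

end

lemma one_cap_act:
  assumes oc: "one_cap N D i j" and g: "g permutes {..<N}"
  shows "one_cap N (act g D) (g i) (g j)"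
  unfolding one_cap_def
proof (intro conjI allI impI)
  have cap: "{(False, i), (False, j)} \<in> D" using oc unfolding one_cap_def by simp
  show "{(False, g i), (False, g j)} \<in> act g D" using act_edge[OF cap, of g] by (simp add: top_map_def)
  fix k assume k: "k < N" "k \<noteq> g i" "k \<noteq> g j"
  define k0 where "k0 = inv g k"
  have gk0: "g k0 = k" unfolding k0_def using permutes_inverses(1)[OF g] .
  have "k0 < N" using gk0 k permutes_in_image[OF g, of k0] by simp
  moreover have "k0 \<noteq> i" "k0 \<noteq> j" using gk0 k by auto
  ultimately have "joined_outside N D k0" using oc unfolding one_cap_def by simp
  then obtain v where v: "{(False, k0), v} \<in> D" "v \<notin> {False} \<times> {..<N}" by (rule joined_outsideE)
  have "{(False, k), top_map g v} \<in> act g D" using act_edge[OF v(1), of g] by (simp add: top_map_def gk0)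
  moreover have "top_map g v \<notin> {False} \<times> {..<N}"
    using v(2) permutes_in_image[OF g, of "snd v"] by (cases v) (auto simp: top_map_def)
  ultimately show "joined_outside N (act g D) k" by (rule joined_outsideI)
qed

lemma transpose_comp_perm:
  assumes "inj g"
  shows "transpose (g a) (g b) \<circ> g = g \<circ> transpose a b"
proof
  fix y show "(transpose (g a) (g b) \<circ> g) y = (g \<circ> transpose a b) y"
    using injD[OF assms, of y a] injD[OF assms, of y b] by (auto simp: transpose_def)
qed

text \<open>The coefficients along the orbit of a diagram with the cap at the last two counted
  vertices form a function on permutations. Exchanging the ends of that cap fixes the diagram, and
  the hook equations at all members of the orbit become the hypothesis of
  \<open>perm_function_zero\<close> with \<open>r = 2 - x\<close>.\<close>

lemma coefficient_one_cap:
  fixes c :: "diagram \<Rightarrow> 'a::field_char_0"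
  assumes N: "N \<le> n" and x0: "x \<noteq> 0" and x: "x \<notin> range of_int"
    and dotz: "\<And>i D. i < N \<Longrightarrow>
      (\<Sum>b\<in>diagrams n. if Gprime n (dot n i) b = D then c b * x ^ ell n (dot n i) b else 0) = 0"
    and hookz: "\<And>i j D. i < N \<Longrightarrow> j < N \<Longrightarrow> i \<noteq> j \<Longrightarrow>
      (\<Sum>b\<in>diagrams n. if Gprime n (hook n i j) b = D then c b * x ^ ell n (hook n i j) b else 0) = 0"
    and full: "\<And>b. b \<in> diagrams n \<Longrightarrow> (\<And>k. k < N \<Longrightarrow> joined_outside N b k) \<Longrightarrow> c b = 0"
    and D: "D \<in> diagrams n" and oc: "one_cap N D i j" and ij: "i < N" "j < N" "i \<noteq> j"
  shows "c D = 0"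
proof -
  have N2: "2 \<le> N" using ij by linarith
  define a b where "a = N - 2" and "b = N - 1"
  have ab: "a < N" "b < N" "a \<noteq> b" using N2 by (auto simp: a_def b_def)
  \<comment> \<open>Sends \<open>a\<close> to \<open>i\<close> and \<open>b\<close> to
    \<open>j\<close>: the inner transposition takes \<open>b\<close> to
    \<open>transpose a i j\<close>, which the outer one takes to \<open>j\<close>.\<close>
  define g0 where "g0 = transpose a i \<circ> transpose b (transpose a i j)"
  have tj: "transpose a i j < N" using ab ij by (auto simp: transpose_def)
  have g0: "g0 permutes {..<N}"
    unfolding g0_def using ab ij tj by (intro permutes_compose permutes_swap_id) auto
  have "transpose a i j \<noteq> a" using ij(3) by (auto simp: transpose_def)
  then have g0v: "g0 a = i" "g0 b = j" using ab by (auto simp: g0_def)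
  define D0 where "D0 = act (inv g0) D"
  have g0i: "inv g0 permutes {..<N}" by (rule permutes_inv[OF g0])
  have pn: "g permutes {..<n}" if "g permutes {..<N}" for g
    using permutes_subset[OF that] N by auto
  have D0: "D0 \<in> diagrams n" unfolding D0_def by (rule act_diagram[OF D pn[OF g0i]])
  have oc0: "one_cap N D0 a b"
  proof -
    have "inv g0 i = a" "inv g0 j = b" using g0v permutes_inverses(2)[OF g0] by auto
    then show ?thesis using one_cap_act[OF oc g0i] by (simp add: D0_def)
  qed
  have DD0: "act g0 D0 = D" unfolding D0_def act_act permutes_inv_o(1)[OF g0] act_id ..
  define f where "f g = c (act g D0)" for g
  have inv: "f (g \<circ> transpose a b) = f g" for g
  proof -
    have fixed: "top_map (transpose a b) ` e = e" if e: "e \<in> D0" for e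
    proof (cases "e = {(False, a), (False, b)}")
      case True
      then show ?thesis by (auto simp: top_map_def)
    next
      case False
      have "{(False, a), (False, b)} \<in> D0" using oc0 unfolding one_cap_def by simp
      from matching_disjoint[OF diagram_matching[OF D0] e this False]
      have "top_map (transpose a b) v = v" if "v \<in> e" for v
        using that by (cases v; cases "fst v") (auto simp: top_map_def transpose_def)
      then show ?thesis by simp
    qed
    then have "act (transpose a b) D0 = D0" unfolding act_def by simp
    then show ?thesis unfolding f_def act_act[symmetric] by simp
  qed
  \<comment> \<open>Only permutation diagrams enter, and their products close no inner component, so
    the value 1 of the parameter is an arbitrary choice.\<close>
  interpret P: perm_algebra scl "An_mult N (1::'a)" N "\<lambda>w. delta (perm_diag N w)" flipf
    "\<lambda>f. f (perm_diag N id)"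
    by (rule An_perm_algebra)
  have "f g0 = 0"
  proof (rule P.perm_function_zero[OF N2 _ _ _ g0])
    show "2 - x \<notin> range of_int"
    proof
      assume "2 - x \<in> range of_int"
      then obtain k where "2 - x = of_int k" by auto
      then have "x = of_int (2 - k)" by (simp add: algebra_simps)
      then show False using x by blast
    qed
    show "f (g \<circ> transpose (N - 2) (N - 1)) = f g" for g using inv unfolding a_def b_def .
    fix g assume g: "g permutes {..<N}"
    note inj = permutes_inj[OF g]
    have gN: "g k < N" if "k < N" for k using permutes_in_image[OF g, of k] that by simp
    let ?E = "act g D0"
    have E: "?E \<in> diagrams n" by (rule act_diagram[OF D0 pn[OF g]])
    have gab: "g a < N" "g b < N" "g a \<noteq> g b" using gN ab injD[OF inj] by auto
    have "(x - 1) * c ?E + (\<Sum>l\<in>{..<N} - {g a, g b}. c (act (transpose (g a) l) ?E) +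
        c (act (transpose (g b) l) ?E)) = 0"
      by (rule coefficient_hook_equation[OF N x0 dotz hookz full E one_cap_act[OF oc0 g] gab])
    also have "{..<N} - {g a, g b} = g ` {..<N - 2}"
    proof -
      have "{..<N - 2} = {..<N} - {a, b}" using N2 by (auto simp: a_def b_def)
      then show ?thesis using permutes_image[OF g] image_set_diff[OF inj, of "{..<N}" "{a, b}"] by simp
    qed
    also have "(\<Sum>l\<in>g ` {..<N - 2}. c (act (transpose (g a) l) ?E) + c (act (transpose (g b) l) ?E)) =
        (\<Sum>l<N - 2. f (g \<circ> transpose a l) + f (g \<circ> transpose b l))"
      by (subst sum.reindex) (use inj in \<open>auto simp: inj_on_def f_def act_act transpose_comp_perm\<close>)
    finally have "(x - 1) * f g + (\<Sum>l<N - 2. f (g \<circ> transpose a l) + f (g \<circ> transpose b l)) = 0"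
      unfolding f_def .
    then show "(\<Sum>l<N - 2. f (g \<circ> transpose l (N - 2)) + f (g \<circ> transpose l (N - 1))) + f g = (2 - x) * f g"
      unfolding a_def b_def by (simp add: transpose_commute algebra_simps)
  qed
  then show ?thesis by (simp add: f_def DD0)
qed

text \<open>The induction hypothesis asks for vanishing on the diagrams without defect at
  \<open>m\<close>, where vertex \<open>m\<close> counts as outside. Seen from \<open>Suc m\<close>,
  vertex \<open>m\<close> of such a diagram is isolated, capped with one smaller vertex, or joined
  outside: one loop, one cap, or no defect.\<close>

theorem coefficients_vanish:
  fixes c :: "diagram \<Rightarrow> 'a::field_char_0"
  assumes x0: "x \<noteq> 0" and x: "x \<notin> range of_int"
  shows "N \<le> n \<Longrightarrow>
    (\<And>i D. i < N \<Longrightarrow>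
      (\<Sum>b\<in>diagrams n. if Gprime n (dot n i) b = D then c b * x ^ ell n (dot n i) b else 0) = 0) \<Longrightarrow>
    (\<And>i j D. i < N \<Longrightarrow> j < N \<Longrightarrow> i \<noteq> j \<Longrightarrow>
      (\<Sum>b\<in>diagrams n. if Gprime n (hook n i j) b = D then c b * x ^ ell n (hook n i j) b else 0) = 0) \<Longrightarrow>
    (\<And>b. b \<in> diagrams n \<Longrightarrow> (\<And>k. k < N \<Longrightarrow> joined_outside N b k) \<Longrightarrow> c b = 0) \<Longrightarrow>
    D \<in> diagrams n \<Longrightarrow> c D = 0"
proof (induction N arbitrary: D)
  case 0 then show ?case by simp
next
  case (Suc m)
  note prems = Suc.prems
  show ?case
  proof (rule Suc.IH)
    show "m \<le> n" using prems(1) by simp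
    show "D \<in> diagrams n" by (rule prems(5))
    show "(\<Sum>b\<in>diagrams n. if Gprime n (dot n i) b = D then c b * x ^ ell n (dot n i) b else 0) = 0"
      if "i < m" for i D using that by (intro prems(2)) simp
    show "(\<Sum>b\<in>diagrams n. if Gprime n (hook n i j) b = D then c b * x ^ ell n (hook n i j) b else 0) = 0"
      if "i < m" "j < m" "i \<noteq> j" for i j D using that by (intro prems(3)) simp_all
    fix b assume b: "b \<in> diagrams n" and e: "\<And>k. k < m \<Longrightarrow> joined_outside m b k"
    note mb = diagram_matching[OF b]
    \<comment> \<open>In passing from \<open>m\<close> to \<open>Suc m\<close> only the top vertex
      \<open>m\<close> stops being outside.\<close>
    have step: "v = (False, m) \<or> joined_outside (Suc m) b k" if "{(False, k), v} \<in> b" "k < m" for k v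
    proof -
      have "v \<notin> {False} \<times> {..<m}" by (rule joined_outside_partner[OF mb e[OF that(2)] that(1)])
      then have "v = (False, m) \<or> v \<notin> {False} \<times> {..<Suc m}" by (cases v) (auto simp: less_Suc_eq)
      then show ?thesis using joined_outsideI[OF that(1)] by blast
    qed
    show "c b = 0"
    proof (cases "\<exists>i<m. {(False, i), (False, m)} \<in> b")
      case True
      then obtain i where i: "i < m" "{(False, i), (False, m)} \<in> b" by blast
      have "one_cap (Suc m) b i m"
        unfolding one_cap_def
      proof (intro conjI allI impI)
        show "{(False, i), (False, m)} \<in> b" by (rule i(2))
        fix k assume k: "k < Suc m" "k \<noteq> i" "k \<noteq> m"
        then have km: "k < m" by simp
        obtain v where v: "{(False, k), v} \<in> b" by (rule joined_outsideE[OF e[OF km]])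
        have "v \<noteq> (False, m)"
        proof
          assume "v = (False, m)"
          then have "(False, k) = (False, i)"
            using matching_unique[OF mb, of "(False, m)" "(False, k)" "(False, i)"] v i(2) by (simp add: insert_commute)
          then show False using k(2) by simp
        qed
        then show "joined_outside (Suc m) b k" using step[OF v km] by simp
      qed
      then show ?thesis
        using i by (intro coefficient_one_cap[OF prems(1) x0 x prems(2,3,4) b]) auto
    next
      case False
      have ek: "joined_outside (Suc m) b k" if "k < m" for k
        using joined_outsideE[OF e[OF that]] step[OF _ that] False that by metis
      show ?thesis
      proof (cases "(False, m) \<in> \<Union>b")
        case out: False
        show ?thesis
        proof (rule coefficient_one_dot[OF prems(1) x0 prems(2,3,4) b _ out])
          show "joined_outside (Suc m) b k" if "k < Suc m" "k \<noteq> m" for k using ek that by simp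
        qed auto
      next
        case True
        then obtain v where v: "{(False, m), v} \<in> b" using vertex_edge[OF mb] by blast
        have "v \<notin> {False} \<times> {..<Suc m}"
        proof
          assume "v \<in> {False} \<times> {..<Suc m}"
          then obtain k where k: "v = (False, k)" "k < Suc m" by auto
          have "k \<noteq> m" using matching_irrefl[OF mb] v k by auto
          then show False using False k v by (auto simp: insert_commute)
        qed
        then have "joined_outside (Suc m) b m" by (rule joined_outsideI[OF v])
        then have "joined_outside (Suc m) b k" if "k < Suc m" for k using ek that by (cases "k = m") auto
        then show ?thesis by (rule prems(4)[OF b])
      qed
    qed
  qed
qed

text \<open>Each top vertex has a bottom partner, the partners are distinct, and both rows have
  \<open>n\<close> vertices; so every vertex is used and no further edge fits.\<close>

lemma perm_diag_if_joined:
  assumes D: "D \<in> diagrams n" and e: "\<And>i. i < n \<Longrightarrow> joined_outside n D i"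
  shows "\<exists>w. w permutes {..<n} \<and> D = perm_diag n w"
proof -
  note m = diagram_matching[OF D]
  have "\<exists>k<n. {(False, i), (True, k)} \<in> D" if i: "i < n" for i
  proof -
    obtain v where v: "{(False, i), v} \<in> D" "v \<notin> {False} \<times> {..<n}" by (rule joined_outsideE[OF e[OF i]])
    have "v \<in> verts n" using diagram_verts[OF D, of v "(False, i)"] v(1) by (simp add: insert_commute)
    then obtain k where "v = (True, k)" "k < n" using v(2) by (auto simp: verts_def)
    then show ?thesis using v(1) by auto
  qed
  then obtain u0 where u0: "\<And>i. i < n \<Longrightarrow> u0 i < n \<and> {(False, i), (True, u0 i)} \<in> D" by metis
  define u where "u i = (if i < n then u0 i else i)" for i
  have u: "u i < n" "{(False, i), (True, u i)} \<in> D" if "i < n" for i using u0[OF that] that by (auto simp: u_def)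
  have inj: "inj_on u {..<n}"
  proof (rule inj_onI)
    fix i i' assume h: "i \<in> {..<n}" "i' \<in> {..<n}" "u i = u i'"
    then have "{(True, u i), (False, i)} \<in> D" "{(True, u i), (False, i')} \<in> D"
      using u(2)[of i] u(2)[of i'] by (simp_all add: insert_commute)
    from matching_unique[OF m this] show "i = i'" by simp
  qed
  have "bij_betw u {..<n} {..<n}"
    unfolding bij_betw_def using inj endo_inj_surj[OF _ _ inj] u(1) by auto
  then have up: "u permutes {..<n}" by (rule bij_imp_permutes) (simp add: u_def)
  have ui: "u (inv u k) = k" "inv u (u k) = k" for k using permutes_inverses[OF up] by auto
  have uin: "inv u k < n \<longleftrightarrow> k < n" for k using permutes_in_image[OF permutes_inv[OF up], of k] by simp
  have eD: "{(False, inv u k), (True, k)} \<in> D" if "k < n" for k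
    using u(2)[of "inv u k"] uin that ui by simp
  \<comment> \<open>The inverse appears because \<open>perm_diag\<close> is indexed by bottom
    vertices while \<open>u\<close> maps top to bottom.\<close>
  have "D = perm_diag n (inv u)"
  proof (intro equalityI subsetI)
    fix d assume d: "d \<in> D"
    obtain a b where ab: "d = {a, b}" "a \<in> verts n" by (rule diagram_edgeE[OF D d])
    have "\<exists>k<n. d = {(False, inv u k), (True, k)}"
    proof (cases "fst a")
      case False
      then obtain i where i: "a = (False, i)" "i < n" using ab(2) by (cases a) (auto simp: verts_def)
      then have "b = (True, u i)" using matching_unique[OF m _ u(2)[OF i(2)]] d ab(1) by simp
      then show ?thesis using ab(1) i u(1)[OF i(2)] ui(2) by (intro exI[of _ "u i"]) simp
    next
      case True
      then obtain k where k: "a = (True, k)" "k < n" using ab(2) by (cases a) (auto simp: verts_def)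
      have "{a, (False, inv u k)} \<in> D" using eD[OF k(2)] k(1) by (simp add: insert_commute)
      then have "b = (False, inv u k)" using matching_unique[OF m] d ab(1) by metis
      then show ?thesis using ab(1) k by (intro exI[of _ k]) (simp add: insert_commute)
    qed
    then show "d \<in> perm_diag n (inv u)" unfolding perm_diag_def by blast
  next
    fix d assume "d \<in> perm_diag n (inv u)"
    then show "d \<in> D" unfolding perm_diag_def using eD by blast
  qed
  then show ?thesis using permutes_inv[OF up] by blast
qed

section \<open>The ideal of diagrams that are not permutations\<close>

definition is_perm :: "nat \<Rightarrow> diagram \<Rightarrow> bool" where
  "is_perm n D \<longleftrightarrow> (\<exists>w. w permutes {..<n} \<and> D = perm_diag n w)"

lemma not_perm_cases:
  assumes D: "D \<in> diagrams n" and np: "\<not> is_perm n D"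
  obtains i where "i < n" "(False, i) \<notin> \<Union>D"
    | i j where "i < n" "j < n" "i \<noteq> j" "{(False, i), (False, j)} \<in> D"
proof -
  note m = diagram_matching[OF D]
  obtain i where i: "i < n" "\<not> joined_outside n D i" using perm_diag_if_joined[OF D] np unfolding is_perm_def by blast
  show thesis
  proof (cases "(False, i) \<in> \<Union>D")
    case True
    then obtain v where v: "{(False, i), v} \<in> D" using vertex_edge[OF m] by blast
    then have "v \<in> {False} \<times> {..<n}" using joined_outsideI[OF v] i(2) by blast
    then obtain j where j: "v = (False, j)" "j < n" by auto
    have "i \<noteq> j" using matching_irrefl[OF m] v j by auto
    then show ?thesis using that(2)[of i j] i j v by simp
  qed (use that(1) i in blast)
qed

lemma perm_diag_top_edge:
  assumes "w permutes {..<n}" "i < n"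
  shows "{(False, i), (True, inv w i)} \<in> perm_diag n w"
proof -
  have "inv w i < n" using permutes_in_image[OF permutes_inv[OF assms(1)], of i] assms(2) by simp
  then show ?thesis unfolding perm_diag_edge using permutes_inverses(1)[OF assms(1), of i] by auto
qed

lemma dot_not_perm: "i < n \<Longrightarrow> \<not> is_perm n (dot n i)"
  unfolding is_perm_def
proof
  assume i: "i < n" and "\<exists>w. w permutes {..<n} \<and> dot n i = perm_diag n w"
  then obtain w where "w permutes {..<n}" "dot n i = perm_diag n w" by blast
  then have "{(False, i), (True, inv w i)} \<in> dot n i" using perm_diag_top_edge[OF _ i] by metis
  then show False unfolding dot_def by (auto simp: doubleton_eq_iff)
qed

lemma hook_not_perm: "\<not> is_perm n (hook n i j)"
  unfolding is_perm_def
proof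
  assume "\<exists>w. w permutes {..<n} \<and> hook n i j = perm_diag n w"
  then obtain w where "hook n i j = perm_diag n w" by blast
  then have "{(False, i), (False, j)} \<in> perm_diag n w" unfolding hook_def by blast
  then show False unfolding perm_diag_edge by auto
qed

text \<open>A loop or cap in the top row of \<open>a\<close> is absorbed by the corresponding dot or
  hook: it reproduces \<open>a\<close> and, by associativity, the product. But a dot removes an edge
  from a permutation diagram, and a hook puts a cap into it.\<close>

lemma perm_product_left:
  assumes a: "a \<in> diagrams n" and b: "b \<in> diagrams n" and p: "is_perm n (Gprime n a b)"
  shows "is_perm n a"
proof (rule ccontr)
  assume np: "\<not> is_perm n a"
  obtain w where w: "w permutes {..<n}" "Gprime n a b = perm_diag n w" using p unfolding is_perm_def by blast
  note pd = perm_diag_diagram[OF w(1)]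
  from a np show False
  proof (cases rule: not_perm_cases)
    case (1 i)
    have "Gprime n (dot n i) (Gprime n a b) = Gprime n a b"
      unfolding product_assoc(1)[OF dot_diagram a b, symmetric] dot_product_isolated(1)[OF a 1] ..
    then have "{e \<in> perm_diag n w. (False, i) \<notin> e} = perm_diag n w"
      using dot_product_joined(1)[OF pd 1(1) perm_diag_top_edge[OF w(1) 1(1)]] w(2) by simp
    then have "{(False, i), (True, inv w i)} \<in> {e \<in> perm_diag n w. (False, i) \<notin> e}"
      using perm_diag_top_edge[OF w(1) 1(1)] by simp
    then show False by simp
  next
    case (2 i j)
    note hd = hook_diagram[OF 2(1,2,3)]
    have "Gprime n (hook n i j) (Gprime n a b) = Gprime n a b"
      unfolding product_assoc(1)[OF hd a b, symmetric] hook_product_cap(1)[OF a 2] ..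
    moreover have "{(False, i), (False, j)} \<in> Gprime n (hook n i j) (perm_diag n w)"
      using hook_product_two(1)[OF pd 2(1,2,3) perm_diag_top_edge[OF w(1) 2(1)] perm_diag_top_edge[OF w(1) 2(2)]]
      by simp
    ultimately have "{(False, i), (False, j)} \<in> perm_diag n w" using w(2) by simp
    then show False unfolding perm_diag_edge by auto
  qed
qed

lemma is_perm_flip: "is_perm n (flip D) \<longleftrightarrow> is_perm n D"
proof -
  have "is_perm n (flip D)" if "is_perm n D" for D
    using that flip_perm_diag permutes_inv unfolding is_perm_def by blast
  from this[of D] this[of "flip D"] show ?thesis by (auto simp: flip_flip)
qed

lemma perm_product_right:
  assumes a: "a \<in> diagrams n" and b: "b \<in> diagrams n" and p: "is_perm n (Gprime n a b)"
  shows "is_perm n b"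
  using perm_product_left[OF flip_diagram[OF b] flip_diagram[OF a]] flip_product(1)[OF a b] p
  by (simp add: is_perm_flip)

definition Jideal :: "nat \<Rightarrow> (diagram \<Rightarrow> 'a::field) set" where
  "Jideal n = {f \<in> An_carrier n. \<forall>D. is_perm n D \<longrightarrow> f D = 0}"

lemma Jideal_mul:
  assumes "f \<in> Jideal n"
  shows "An_mult n x f g \<in> Jideal n" "An_mult n x g f \<in> Jideal n"
proof -
  have 0: "f D = 0" if "is_perm n D" for D using assms that unfolding Jideal_def by blast
  have "An_mult n x f g D = 0" if "is_perm n D" for D
    unfolding An_mult_def using 0 perm_product_left that by (intro sum.neutral ballI) auto
  then show "An_mult n x f g \<in> Jideal n" unfolding Jideal_def using An_mult_carrier by blast
  have "An_mult n x g f D = 0" if "is_perm n D" for D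
    unfolding An_mult_def using 0 perm_product_right that by (intro sum.neutral ballI) auto
  then show "An_mult n x g f \<in> Jideal n" unfolding Jideal_def using An_mult_carrier by blast
qed

lemma delta_Jideal: "D \<in> diagrams n \<Longrightarrow> \<not> is_perm n D \<Longrightarrow> delta D \<in> Jideal n"
  unfolding Jideal_def using delta_carrier by (auto simp: delta_apply)

lemma flipf_Jideal: "f \<in> Jideal n \<Longrightarrow> flipf f \<in> Jideal n"
proof -
  assume f: "f \<in> Jideal n"
  have "flipf f D = 0" if "D \<notin> diagrams n" for D
  proof -
    have "flip D \<notin> diagrams n" using that flip_diagram[of "flip D" n] by (auto simp: flip_flip)
    then show ?thesis using f by (simp add: Jideal_def An_carrier_def flipf_def)
  qed
  moreover have "flipf f D = 0" if "is_perm n D" for D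
    using f that is_perm_flip[of n D] by (simp add: Jideal_def flipf_def)
  ultimately show ?thesis by (simp add: Jideal_def An_carrier_def)
qed

text \<open>Dots and hooks lie in the ideal, so \<open>v\<close> satisfies the equations at all top
  vertices, and it vanishes at permutation diagrams, the only ones without defect. This is the case
  \<open>N = n\<close> of \<open>coefficients_vanish\<close>.\<close>

lemma Jideal_left_faithful:
  fixes x :: "'a::field_char_0"
  assumes x0: "x \<noteq> 0" and x: "x \<notin> range of_int" and v: "v \<in> Jideal n"
    and h: "\<And>f. f \<in> Jideal n \<Longrightarrow> An_mult n x f v = 0"
  shows "v = 0"
proof
  fix D
  show "v D = 0 D"
  proof (cases "D \<in> diagrams n")
    case True
    have "v D = 0"
    proof (rule coefficients_vanish[OF x0 x order_refl _ _ _ True])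
      show "(\<Sum>b\<in>diagrams n. if Gprime n (dot n i) b = D then v b * x ^ ell n (dot n i) b else 0) = 0"
        if "i < n" for i D
        using fun_cong[OF h[OF delta_Jideal[OF dot_diagram dot_not_perm[OF that]]], of D]
        unfolding An_mult_delta_left[OF dot_diagram] by simp
      show "(\<Sum>b\<in>diagrams n. if Gprime n (hook n i j) b = D then v b * x ^ ell n (hook n i j) b else 0) = 0"
        if "i < n" "j < n" "i \<noteq> j" for i j D
        using fun_cong[OF h[OF delta_Jideal[OF hook_diagram[OF that] hook_not_perm]], of D]
        unfolding An_mult_delta_left[OF hook_diagram[OF that]] by simp
      show "v b = 0" if "b \<in> diagrams n" "\<And>k. k < n \<Longrightarrow> joined_outside n b k" for b
        using perm_diag_if_joined[OF that] v unfolding Jideal_def is_perm_def by blast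
    qed
    then show ?thesis by simp
  next
    case False
    then show ?thesis using v by (simp add: Jideal_def An_carrier_def)
  qed
qed

lemma Jideal_right_faithful:
  fixes x :: "'a::field_char_0"
  assumes x0: "x \<noteq> 0" and x: "x \<notin> range of_int" and v: "v \<in> Jideal n"
    and h: "\<And>f. f \<in> Jideal n \<Longrightarrow> An_mult n x v f = 0"
  shows "v = 0"
proof -
  have "An_mult n x f (flipf v) = 0" if "f \<in> Jideal n" for f
    using arg_cong[OF h[OF flipf_Jideal[OF that]], of flipf]
    by (simp add: flipf_mult flipf_flipf) (simp add: flipf_def zero_fun_def)
  then have "flipf v = 0" by (rule Jideal_left_faithful[OF x0 x flipf_Jideal[OF v]])
  then have "flipf (flipf v) = flipf 0" by simp
  then show ?thesis unfolding flipf_flipf by (simp add: flipf_def zero_fun_def)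
qed

section \<open>Semisimplicity\<close>

lemma An_carrier_subset_span:
  "An_carrier n \<subseteq> module.span scl (delta ` diagrams n :: (diagram \<Rightarrow> 'a::field) set)"
proof
  interpret assoc_algebra scl "An_mult n (1::'a)" by (rule An_algebra)
  fix f :: "diagram \<Rightarrow> 'a" assume f: "f \<in> An_carrier n"
  have "(\<Sum>D\<in>diagrams n. scl (f D) (delta D)) \<in> span (delta ` diagrams n)"
    by (intro span_sum span_scale span_base) auto
  then show "f \<in> span (delta ` diagrams n)" using An_expand[OF f] by simp
qed

lemma split_algebra_if_generates_Jideal:
  fixes x :: "'a::field_char_0"
  assumes x0: "x \<noteq> 0" and x: "x \<notin> range of_int"
    and E: "assoc_algebra.primitive_family scl (An_mult n x) (An_carrier n) E"
    and gen: "assoc_algebra.generated_ideal scl (An_mult n x) (An_carrier n) E = Jideal n"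
  shows "\<exists>E'. assoc_algebra.split_algebra scl (An_mult n x) (An_carrier n) (delta (perm_diag n id)) E'"
proof -
  interpret P: perm_algebra scl "An_mult n x" n "\<lambda>w. delta (perm_diag n w)" flipf
    "\<lambda>f. f (perm_diag n id)"
    by (rule An_perm_algebra)
  obtain F where F: "P.split_algebra P.B (delta (perm_diag n id)) F"
    using P.split_algebra_B unfolding P.one_def by blast
  have Bsupp: "f D = 0" if "f \<in> P.B" "\<not> is_perm n D" for f D
    using that(1)
  proof (induction rule: P.B_induct)
    case (G w)
    then show ?case using that(2) unfolding is_perm_def by (auto simp: delta_apply)
  qed auto
  have BC: "P.B \<subseteq> An_carrier n"
  proof
    fix f assume "f \<in> P.B"
    moreover have "\<not> is_perm n D" if "D \<notin> diagrams n" for D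
      using that perm_diag_diagram unfolding is_perm_def by blast
    ultimately show "f \<in> An_carrier n" using Bsupp unfolding An_carrier_def by blast
  qed
  show ?thesis
  proof (rule P.split_algebra_extension[OF An_unital E _ An_carrier_subset_span _ _ BC F])
    show "finite (delta ` diagrams n)" using finite_diagrams by blast
    show "v = 0" if "v \<in> P.generated_ideal (An_carrier n) E"
      "\<And>j. j \<in> P.generated_ideal (An_carrier n) E \<Longrightarrow> An_mult n x j v = 0" for v
      using that unfolding gen by (rule Jideal_left_faithful[OF x0 x])
    show "v = 0" if "v \<in> P.generated_ideal (An_carrier n) E"
      "\<And>j. j \<in> P.generated_ideal (An_carrier n) E \<Longrightarrow> An_mult n x v j = 0" for v
      using that unfolding gen by (rule Jideal_right_faithful[OF x0 x])
    show "P.generated_ideal (An_carrier n) E \<inter> P.B \<subseteq> {0}"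
    proof
      fix f assume f: "f \<in> P.generated_ideal (An_carrier n) E \<inter> P.B"
      then have "f D = 0" for D using Bsupp[of f D] unfolding gen Jideal_def by blast
      then show "f \<in> {0}" by (simp add: fun_eq_iff)
    qed
    fix c :: "diagram \<Rightarrow> 'a" assume c: "c \<in> An_carrier n"
    define b where "b = (\<Sum>w\<in>{w. w permutes {..<n}}. scl (c (perm_diag n w)) (delta (perm_diag n w)))"
    have bB: "b \<in> P.B" unfolding b_def by (intro P.B_sum P.B_scale P.G_in_B) simp
    have bv: "b (perm_diag n v) = c (perm_diag n v)" if v: "v permutes {..<n}" for v
    proof -
      have "b (perm_diag n v) = (\<Sum>w\<in>{w. w permutes {..<n}}. if w = v then c (perm_diag n v) else 0)"
        unfolding b_def sum_fun_apply
        by (rule sum.cong[OF refl]) (use perm_diag_inject[OF v] in \<open>auto simp: delta_apply\<close>)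
      then show ?thesis using v P.finite_perms by (simp add: sum.delta)
    qed
    have "c - b \<in> Jideal n"
      using c BC bB bv unfolding Jideal_def is_perm_def An_carrier_def by auto
    then show "\<exists>j\<in>P.generated_ideal (An_carrier n) E. \<exists>b\<in>P.B. c = j + b"
      using bB unfolding gen by (intro bexI[of _ "c - b"] bexI[of _ b]) auto
  qed
qed

text \<open>For nonzero \<open>x\<close> this makes \<open>scl (inverse x)\<close> a multiplicative
  embedding of the algebra of size \<open>n\<close> into that of size \<open>Suc n\<close>; in
  particular it carries idempotents to idempotents.\<close>

lemma An_mult_Suc:
  assumes f: "f \<in> An_carrier n" and g: "g \<in> An_carrier n"
  shows "An_mult (Suc n) x f g = scl x (An_mult n x f g)"
proof
  fix c
  have sub: "diagrams n \<subseteq> diagrams (Suc n)" using diagrams_mono by auto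
  have f0: "f D = 0" and g0: "g D = 0" if "D \<notin> diagrams n" for D
    using f g that by (auto simp: An_carrier_def)
  have "An_mult (Suc n) x f g c = (\<Sum>a\<in>diagrams n. \<Sum>b\<in>diagrams (Suc n).
      if Gprime (Suc n) a b = c then f a * g b * x ^ ell (Suc n) a b else 0)"
    unfolding An_mult_def by (rule sum.mono_neutral_right[OF finite_diagrams sub]) (auto simp: f0 intro!: sum.neutral)
  also have "\<dots> = (\<Sum>a\<in>diagrams n. \<Sum>b\<in>diagrams n.
      if Gprime (Suc n) a b = c then f a * g b * x ^ ell (Suc n) a b else 0)"
    by (intro sum.cong refl sum.mono_neutral_right[OF finite_diagrams sub]) (auto simp: g0)
  also have "\<dots> = (\<Sum>a\<in>diagrams n. \<Sum>b\<in>diagrams n.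
      x * (if Gprime n a b = c then f a * g b * x ^ ell n a b else 0))"
    by (intro sum.cong refl) (simp add: product_Suc)
  finally show "An_mult (Suc n) x f g c = scl x (An_mult n x f g) c"
    by (simp add: An_mult_def sum_distrib_left)
qed

lemma An_carrier_mono: "f \<in> An_carrier n \<Longrightarrow> f \<in> An_carrier (Suc n)"
  unfolding An_carrier_def using diagrams_mono[of _ n "Suc n"] by auto

lemma perm_diag_eq_dot: "perm_diag n id = dot (Suc n) n"
proof -
  have "k < n \<longleftrightarrow> k < Suc n \<and> k \<noteq> n" for k by auto
  then show ?thesis unfolding perm_diag_def dot_def by simp
qed

lemma diagram_Suc_cases:
  assumes "D \<in> diagrams (Suc n)" "(False, n) \<notin> \<Union>D" "(True, n) \<notin> \<Union>D"
  shows "D \<in> diagrams n"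
proof (rule diagramI[OF diagram_matching[OF assms(1)]])
  fix u v assume uv: "{u, v} \<in> D"
  have "u \<in> \<Union>D" using uv by auto
  then have "u \<noteq> (False, n)" "u \<noteq> (True, n)" using assms(2,3) by auto
  moreover have "u \<in> verts (Suc n)" by (rule diagram_verts[OF assms(1) uv])
  ultimately show "u \<in> verts n" by (cases u; cases "fst u") (auto simp: verts_def less_Suc_eq)
qed

lemma dot_mult_support:
  assumes "An_mult (Suc n) x (delta (dot (Suc n) n)) f D \<noteq> 0"
  shows "(False, n) \<notin> \<Union>D"
proof -
  have "\<exists>b\<in>diagrams (Suc n). Gprime (Suc n) (dot (Suc n) n) b = D"
  proof (rule ccontr)
    assume "\<not> ?thesis"
    then have "An_mult (Suc n) x (delta (dot (Suc n) n)) f D = 0"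
      unfolding An_mult_delta_left[OF dot_diagram] by (intro sum.neutral) auto
    then show False using assms by simp
  qed
  then obtain b where b: "b \<in> diagrams (Suc n)" "Gprime (Suc n) (dot (Suc n) n) b = D" by blast
  show ?thesis
  proof (cases "(False, n) \<in> \<Union>b")
    case False
    then show ?thesis using dot_product_isolated(1)[OF b(1) _ False] b(2) by simp
  next
    case True
    then obtain p where "{(False, n), p} \<in> b" using vertex_edge[OF diagram_matching[OF b(1)]] by blast
    then show ?thesis using dot_product_joined(1)[OF b(1), of n p] b(2) by auto
  qed
qed

text \<open>The left factor is a dot and isolates top vertex \<open>n\<close>; by the flip symmetry
  the right factor isolates bottom vertex \<open>n\<close>. What remains are diagrams of size
  \<open>n\<close>.\<close>

lemma corner_carrier:
  fixes a :: "diagram \<Rightarrow> 'a::field" and n :: nat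
  defines "p \<equiv> delta (perm_diag n id) :: diagram \<Rightarrow> 'a"
  shows "An_mult (Suc n) x p (An_mult (Suc n) x a p) \<in> An_carrier n"
proof -
  have flipp: "flipf p = p" unfolding p_def by (simp add: flipf_delta flip_perm_diag[OF permutes_id])
  have pd: "p = delta (dot (Suc n) n)" by (simp add: p_def perm_diag_eq_dot)
  let ?r = "An_mult (Suc n) x p (An_mult (Suc n) x a p)"
  show ?thesis unfolding An_carrier_def
  proof (intro CollectI allI impI, rule ccontr)
    fix D assume D: "D \<notin> diagrams n" and nz: "?r D \<noteq> 0"
    have 1: "D \<in> diagrams (Suc n)" using nz An_mult_carrier[of "Suc n" x p] unfolding An_carrier_def by blast
    have 2: "(False, n) \<notin> \<Union>D" using dot_mult_support nz unfolding pd by blast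
    have "flipf ?r (flip D) \<noteq> 0" using nz by (simp add: flipf_def flip_flip)
    moreover have "flipf ?r = An_mult (Suc n) x p (An_mult (Suc n) x (flipf a) p)"
      by (simp add: flipf_mult flipp An_mult_assoc)
    ultimately have "(False, n) \<notin> \<Union>(flip D)" using dot_mult_support unfolding pd by metis
    then have 3: "(True, n) \<notin> \<Union>D"
      unfolding flip_def using imageI[of "(True, n)" _ flip_vert] by (auto simp: flip_vert_def)
    show False using diagram_Suc_cases[OF 1 2 3] D by simp
  qed
qed

lemma carrier_not_perm:
  assumes "e \<in> An_carrier n"
  shows "e \<in> Jideal (Suc n)"
proof -
  have "e D = 0" if pD: "is_perm (Suc n) D" for D
  proof (rule ccontr)
    assume "e D \<noteq> 0"
    then have D: "D \<in> diagrams n" using assms unfolding An_carrier_def by blast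
    obtain w where w: "w permutes {..<Suc n}" "D = perm_diag (Suc n) w" using pD unfolding is_perm_def by blast
    have "{(False, n), (True, inv w n)} \<in> D" using perm_diag_top_edge[OF w(1), of n] w(2) by simp
    then have "(False, n) \<in> verts n" by (rule diagram_verts[OF D])
    then show False by (simp add: verts_def)
  qed
  then show ?thesis unfolding Jideal_def using An_carrier_mono[OF assms] by blast
qed

text \<open>Rescaling by \<open>inverse x\<close> compensates the additional inner component.
  Primitivity survives because products sandwiched between old elements can be computed in the
  corner, which is the old algebra. The ideal contains \<open>p\<close>, hence the diagrams with a
  loop at top vertex \<open>n\<close>, by permuting those with any top loop, and by hooks those with
  a top cap.\<close>

lemma split_algebra_Suc:
  fixes x :: "'a::field_char_0"
  assumes x0: "x \<noteq> 0" and x: "x \<notin> range of_int"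
    and sp: "assoc_algebra.split_algebra scl (An_mult n x) (An_carrier n) (delta (perm_diag n id)) E"
  shows "\<exists>E'. assoc_algebra.split_algebra scl (An_mult (Suc n) x) (An_carrier (Suc n))
    (delta (perm_diag (Suc n) id)) E'"
proof -
  interpret A: assoc_algebra scl "An_mult n x" by (rule An_algebra)
  interpret S: assoc_algebra scl "An_mult (Suc n) x" by (rule An_algebra)
  let ?C = "An_carrier n :: (diagram \<Rightarrow> 'a) set" and ?C' = "An_carrier (Suc n) :: (diagram \<Rightarrow> 'a) set"
  let ?m = "An_mult n x" and ?M = "An_mult (Suc n) x"
  define p :: "diagram \<Rightarrow> 'a" where "p = delta (perm_diag n id)"
  note un = An_unital[of n x] and uS = An_unital[of "Suc n" x]
  note Cd = A.unital_subalgebraD[OF un, folded p_def] and Sd = S.unital_subalgebraD[OF uS]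
  have E: "A.primitive_family ?C E" and gen: "p \<in> A.generated_ideal ?C E"
    using sp unfolding A.split_algebra_def p_def by auto
  note Ed = A.primitive_familyD[OF E]
  define E' where "E' = scl (inverse x) ` E"
  have scl_scl: "scl r (scl s f) = scl (r * s) f" for r s and f :: "diagram \<Rightarrow> 'a" by (simp add: fun_eq_iff)
  have scl_1: "scl 1 f = f" for f :: "diagram \<Rightarrow> 'a" by (simp add: fun_eq_iff)
  \<comment> \<open>Both \<open>e\<close> and \<open>f\<close> absorb \<open>p\<close> up to a
    factor \<open>x\<close>, so \<open>a\<close> may be replaced by
    \<open>?M p (?M a p)\<close>.\<close>
  have corner: "\<exists>a'\<in>?C. ?M e (?M a f) = ?m e (?m a' f)" if e: "e \<in> ?C" and f: "f \<in> ?C" for e f a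
  proof -
    let ?a = "?M p (?M a p)"
    have a: "?a \<in> ?C" unfolding p_def by (rule corner_carrier)
    have pe: "?M p f = scl x f" using An_mult_Suc[OF Cd(3) f, of x] Cd(4)[OF f] by simp
    have ep: "?M e p = scl x e" using An_mult_Suc[OF e Cd(3), of x] Cd(5)[OF e] by simp
    have "scl (x * x) (?M e (?M a f)) = ?M (scl x e) (?M a (scl x f))"
      by (simp add: An_mult_scl_left An_mult_scl_right scl_scl)
    also have "\<dots> = ?M e (?M ?a f)" unfolding pe[symmetric] ep[symmetric] by (simp add: S.mul_assoc)
    also have "\<dots> = scl (x * x) (?m e (?m ?a f))"
      using An_mult_Suc[OF a f, of x] An_mult_Suc[OF e Cd(2)[OF a f], of x]
      by (simp add: An_mult_scl_right scl_scl)
    finally have "?M e (?M a f) = ?m e (?m ?a f)" using x0 by (simp add: fun_eq_iff)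
    then show ?thesis using a by blast
  qed
  have E'J: "E' \<subseteq> Jideal (Suc n)"
  proof
    fix e assume "e \<in> E'"
    then obtain f where f: "f \<in> E" "e = scl (inverse x) f" unfolding E'_def by blast
    have "e \<in> ?C" using Ed(2)[OF f(1)] f(2) Cd(1) by (simp add: A.subspace_scale)
    then show "e \<in> Jideal (Suc n)" by (rule carrier_not_perm)
  qed
  have prim: "S.primitive_family ?C' E'"
    unfolding S.primitive_family_def
  proof (intro conjI ballI impI)
    show "finite E'" unfolding E'_def using Ed(1) by blast
    show "E' \<subseteq> ?C'" using E'J unfolding Jideal_def by blast
    fix e assume "e \<in> E'"
    then obtain e0 where e0: "e0 \<in> E" "e = scl (inverse x) e0" unfolding E'_def by blast
    note e0C = Ed(2)[OF e0(1)]
    show "e \<noteq> 0"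
    proof
      assume "e = 0"
      then have "scl x e = 0" by (simp add: fun_eq_iff)
      then show False using Ed(3)[OF e0(1)] x0 unfolding e0(2) scl_scl by (simp add: scl_1)
    qed
    show "?M e e = e"
      unfolding e0(2) An_mult_scl_left An_mult_scl_right An_mult_Suc[OF e0C e0C] Ed(4)[OF e0(1)] scl_scl
      using x0 by simp
    show "\<exists>r. ?M e (?M a e) = scl r e" for a
    proof -
      obtain a' where a': "a' \<in> ?C" "?M e0 (?M a e0) = ?m e0 (?m a' e0)" using corner[OF e0C e0C] by blast
      obtain r where "?m e0 (?m a' e0) = scl r e0" using Ed(5)[OF e0(1) a'(1)] by blast
      then have "?M e (?M a e) = scl (inverse x * inverse x * r) e0"
        unfolding e0(2) An_mult_scl_left An_mult_scl_right a'(2) scl_scl by (simp add: scl_scl mult.assoc)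
      then show ?thesis unfolding e0(2) by (intro exI[of _ "inverse x * r"]) (simp add: scl_scl mult_ac)
    qed
    fix f a assume f: "f \<in> E'" and ne: "e \<noteq> f"
    obtain f0 where f0: "f0 \<in> E" "f = scl (inverse x) f0" using f unfolding E'_def by blast
    have "e0 \<noteq> f0" using ne e0 f0 by blast
    obtain a' where a': "a' \<in> ?C" "?M e0 (?M a f0) = ?m e0 (?m a' f0)" using corner[OF e0C Ed(2)[OF f0(1)]] by blast
    then show "?M e (?M a f) = 0"
      unfolding e0(2) f0(2) An_mult_scl_left An_mult_scl_right a'(2)
      using Ed(6)[OF e0(1) f0(1) \<open>e0 \<noteq> f0\<close> a'(1)] by (simp add: fun_eq_iff)
  qed
  have E'C: "E' \<subseteq> ?C'" using E'J unfolding Jideal_def by blast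
  let ?I = "S.generated_ideal ?C' E'"
  note Isub = S.subspace_generated_ideal[of ?C' E']
  have "?I = Jideal (Suc n)"
  proof (intro equalityI subsetI)
    fix y assume "y \<in> ?I"
    then show "y \<in> Jideal (Suc n)"
    proof (induction rule: S.generated_ideal_induct)
      case (generator a e b)
      then show ?case using E'J by (intro Jideal_mul) auto
    qed (auto simp: Jideal_def An_carrier_def)
  next
    have pI: "p \<in> ?I" using gen
    proof (induction rule: A.generated_ideal_induct)
      case (generator a e b)
      have eb: "?m e b \<in> ?C" using Cd(2) Ed(2) generator by blast
      have "?M a (?M (scl (inverse x) e) b) \<in> ?I"
        using generator An_carrier_mono by (intro S.generated_idealI) (auto simp: E'_def)
      moreover have "?M a (?M (scl (inverse x) e) b) = scl (inverse x * (x * x)) (?m a (?m e b))"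
        using An_mult_Suc[OF Ed(2)[OF generator(2)] generator(3), of x] An_mult_Suc[OF generator(1) eb, of x]
        by (simp add: An_mult_scl_left An_mult_scl_right scl_scl)
      ultimately have "scl (inverse x) (scl (inverse x * (x * x)) (?m a (?m e b))) \<in> ?I"
        using A.subspace_scale[OF Isub] by metis
      moreover have "scl (inverse x) (scl (inverse x * (x * x)) (?m a (?m e b))) = ?m a (?m e b)"
        using x0 by (simp add: fun_eq_iff field_simps)
      ultimately show ?case by metis
    next
      case zero show ?case by (rule A.subspace_0[OF Isub])
    next
      case (add y z) then show ?case by (rule A.subspace_add[OF Isub])
    next
      case (scale r y) then show ?case by (rule A.subspace_scale[OF Isub])
    qed
    note Imul = S.generated_ideal_mul[OF uS E'C]
    have dotI: "delta D \<in> ?I" if D: "D \<in> diagrams (Suc n)" and i: "i < Suc n" and iso: "(False, i) \<notin> \<Union>D" for D i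
    proof -
      \<comment> \<open>Moves the loop from top vertex \<open>i\<close> to \<open>n\<close>, where
        \<open>p\<close> acts as the scalar \<open>x\<close>.\<close>
      let ?\<tau> = "transpose i n"
      have \<tau>: "?\<tau> permutes {..<Suc n}" using i by (intro permutes_swap_id) auto
      define D1 where "D1 = act ?\<tau> D"
      have D1: "D1 \<in> diagrams (Suc n)" unfolding D1_def by (rule act_diagram[OF D \<tau>])
      have "act ?\<tau> D1 = D" unfolding D1_def act_act by (simp add: act_id)
      have iso1: "(False, n) \<notin> \<Union>D1"
      proof
        assume "(False, n) \<in> \<Union>D1"
        then obtain e v where e: "e \<in> D" "v \<in> e" "(False, n) = top_map ?\<tau> v" unfolding D1_def act_def by blast
        have "v = (False, i)" using e(3) by (cases v) (auto simp: top_map_def transpose_def split: if_splits)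
        then show False using iso e by blast
      qed
      have "?M p (delta D1) \<in> ?I" using Imul(3)[OF pI delta_carrier[OF D1]] .
      moreover have "?M p (delta D1) = scl x (delta D1)"
        unfolding p_def perm_diag_eq_dot An_mult_delta[OF dot_diagram D1]
        using dot_product_isolated[OF D1 _ iso1] by simp
      ultimately have "scl (inverse x) (scl x (delta D1)) \<in> ?I" using A.subspace_scale[OF Isub] by metis
      then have "delta D1 \<in> ?I" using x0 by (simp add: scl_scl scl_1)
      then have "?M (delta (perm_diag (Suc n) ?\<tau>)) (delta D1) \<in> ?I"
        by (rule Imul(2)[OF _ delta_carrier[OF perm_diag_diagram[OF \<tau>]]])
      then show ?thesis
        unfolding An_mult_delta[OF perm_diag_diagram[OF \<tau>] D1] perm_product[OF D1 \<tau>] \<open>act ?\<tau> D1 = D\<close>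
        by (simp add: scl_1)
    qed
    have npI: "delta D \<in> ?I" if D: "D \<in> diagrams (Suc n)" and np: "\<not> is_perm (Suc n) D" for D
      using D np
    proof (cases rule: not_perm_cases)
      case (1 i)
      then show ?thesis using dotI[OF D] by blast
    next
      case (2 i j)
      let ?cap = "{(False, i), (False, j)}"
      let ?D = "D - {?cap}"
      have D': "?D \<in> diagrams (Suc n)" by (rule subset_diagram[OF D]) auto
      have iso: "(False, i) \<notin> \<Union>?D" "(False, j) \<notin> \<Union>?D"
        using matching_disjoint[OF diagram_matching[OF D] _ 2(4)] by auto
      note hd = hook_diagram[OF 2(1,2,3)]
      have "insert ?cap ?D = D" using 2(4) by auto
      then have "?M (delta (hook (Suc n) i j)) (delta ?D) = scl x (delta D)"
        unfolding An_mult_delta[OF hd D'] using hook_product_none[OF D' 2(1,2,3) iso] by simp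
      moreover have "?M (delta (hook (Suc n) i j)) (delta ?D) \<in> ?I"
        by (rule Imul(2)[OF dotI[OF D' 2(1) iso(1)] delta_carrier[OF hd]])
      ultimately have "scl (inverse x) (scl x (delta D)) \<in> ?I" using A.subspace_scale[OF Isub] by metis
      then show ?thesis using x0 by (simp add: scl_scl scl_1)
    qed
    fix f :: "diagram \<Rightarrow> 'a" assume f: "f \<in> Jideal (Suc n)"
    have "scl (f D) (delta D) \<in> ?I" if D: "D \<in> diagrams (Suc n)" for D
    proof (cases "is_perm (Suc n) D")
      case True
      then have "scl (f D) (delta D) = 0" using f by (simp add: Jideal_def fun_eq_iff)
      then show ?thesis using A.subspace_0[OF Isub] by metis
    next
      case False
      then show ?thesis using npI[OF D] A.subspace_scale[OF Isub] by blast
    qed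
    then have "(\<Sum>D\<in>diagrams (Suc n). scl (f D) (delta D)) \<in> ?I" by (rule A.subspace_sum[OF Isub])
    moreover have "f \<in> ?C'" using f unfolding Jideal_def by blast
    ultimately show "f \<in> ?I" using An_expand by metis
  qed
  then show ?thesis by (rule split_algebra_if_generates_Jideal[OF x0 x prim])
qed

lemma split_algebra_An:
  fixes x :: "'a::field_char_0"
  assumes x0: "x \<noteq> 0" and x: "x \<notin> range of_int"
  shows "\<exists>E. assoc_algebra.split_algebra scl (An_mult n x) (An_carrier n) (delta (perm_diag n id)) E"
proof (induction n)
  \<comment> \<open>The only diagram is empty and counts as a permutation diagram, so the ideal is
    zero and is generated by the empty family.\<close>
  case 0
  interpret assoc_algebra scl "An_mult 0 x" by (rule An_algebra)
  have perm: "is_perm 0 D" if "D \<in> diagrams 0" for D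
    using perm_diag_if_joined[OF that] unfolding is_perm_def by simp
  have "Jideal 0 = {0 :: diagram \<Rightarrow> 'a}"
  proof (intro equalityI subsetI)
    fix f :: "diagram \<Rightarrow> 'a" assume f: "f \<in> Jideal 0"
    have "f D = 0" for D
      using f perm[of D] unfolding Jideal_def An_carrier_def by blast
    then show "f \<in> {0}" by (simp add: fun_eq_iff)
  qed (auto simp: Jideal_def An_carrier_def)
  moreover have "generated_ideal (An_carrier 0) {} = {0}" unfolding generated_ideal_def by simp
  moreover have "primitive_family (An_carrier 0) {}" unfolding primitive_family_def by simp
  ultimately show ?case by (intro split_algebra_if_generates_Jideal[OF x0 x]) auto
next
  case (Suc n)
  then show ?case using split_algebra_Suc[OF x0 x] by blast
qed

theorem theorem4p4:
  fixes x :: "'a::field_char_0" and n :: nat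
  assumes "x \<noteq> 0"
    and "x \<notin> range (of_int :: int \<Rightarrow> 'a)"
  shows "An_semisimple n x"
proof -
  interpret assoc_algebra scl "An_mult n x" by (rule An_algebra)
  obtain E where "split_algebra (An_carrier n) (delta (perm_diag n id)) E"
    using split_algebra_An[OF assms] by blast
  from split_algebra_iso_matrices[OF this _ An_carrier_subset_span] finite_diagrams
  show ?thesis unfolding An_semisimple_def plus_fun_def scl_def by auto
qed

end
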